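(* Suppose $\mathcal G$ is of infinite order. Let $m\in\mathbb N$ be such that $M_0=m\mathbb N$, and let $R$ be a representation set (complete set of representatives) of $\{\rho\in\widehat{\mathcal T\mathcal F}:\rho|_{\mathcal T^m}=I_{d_\rho}\}/{\sim}$. Then there are a null-set $N\subset\widehat{\mathcal G}$ (with respect to the Plancherel measure $\mu_{\mathcal G}$) and, for each $\rho\in R$, a null-set $N_\rho\subset\mathbb R^{d_2}/\mathcal G_\rho$ such that the mapping $$\bigsqcup_{\rho\in R}(\mathbb R^{d_2}/\mathcal G_\rho)\setminus N_\rho\to\widehat{\mathcal G}\setminus N,\qquad(\mathcal G_\rho\cdot k,\rho)\mapsto\operatorname{Ind}_{\mathcal T\mathcal F}^{\mathcal G}(\chi_k\rho)$$ is (well-defined and) bijective.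
   Context: $\mathbb N=\{1,2,\dots\}$. $E(d)=O(d)\ltimes\mathbb R^d$ is the Euclidean group: elements $(A,b)$ with product $(A_1,b_1)(A_2,b_2)=(A_1A_2,b_1+A_1b_2)$, acting on $\mathbb R^d$ by $(A,b)\cdot x=Ax+b$; write $L(A,b)=A$, $\tau(A,b)=b$. A translation is an element $(I_d,b)$. A $d$-dimensional space group is a discrete subgroup of $E(d)$ containing $d$ translations with linearly independent translation vectors. For $A_1\in O(d_1)$ and $(A_2,b_2)\in E(d_2)$ put $A_1\oplus(A_2,b_2):=\left(\begin{pmatrix}A_1&0\\ 0&A_2\end{pmatrix},\begin{pmatrix}0\\ b_2\end{pmatrix}\right)\in E(d_1+d_2)$. Setting: $d\in\mathbb N$, $d_1,d_2\in\mathbb N_0$ with $d=d_1+d_2$; $\mathcal S$ is a $d_2$-dimensional space group; $\mathcal G$ is a discrete subgroup of $O(d_1)\oplus\mathcal S=\{A\oplus g: A\in O(d_1),g\in\mathcal S\}$ (understood as $O(d)$ if $d_1=d$ and as $\mathcal S$ if $d_1=0$) such that $\pi(\mathcal G)=\mathcal S$, where $\pi(A\oplus g)=g$. $\mathcal F=\ker(\pi|_{\mathcal G})$; $\mathcal T_{\mathcal S}$ is the group of translations of $\mathcal S$. $\mathcal T\subset\mathcal G$ is a fixed subset such that $\pi|_{\mathcal T}:\mathcal T\to\mathcal T_{\mathcal S}$ is bijective ($\mathcal T$ need not be a group). For a subset $X$ of a group, $X^n:=\{x^n:x\in X\}$. $M_0:=\{m\in\mathbb N:\mathcal T^m\text{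 is a normal subgroup of }\mathcal G\}$; an $m\in\mathbb N$ with $M_0=m\mathbb N$ exists and is unique. $\mathcal T\mathcal F=\{tf:t\in\mathcal T,f\in\mathcal F\}=(\pi|_{\mathcal G})^{-1}(\mathcal T_{\mathcal S})$ is a normal subgroup of $\mathcal G$ of finite index. Representations: a representation of a group $\mathcal H$ is a homomorphism $\rho:\mathcal H\to U(d_\rho)$ into a finite-dimensional unitary group; equivalence is unitary equivalence; $\widehat{\mathcal H}$ is the set of equivalence classes of irreducible representations. $\rho|_{\mathcal T^m}=I_{d_\rho}$ means $\rho(t)=I_{d_\rho}$ for all $t\in\mathcal T^m$. $\mathcal G$ acts on $\widehat{\mathcal T\mathcal F}$ by $(g\cdot\rho)(n)=\rho(g^{-1}ng)$. For a subgroup $\mathcal K\le\mathcal H$ of finite index, $\operatorname{Ind}_{\mathcal K}^{\mathcal H}\rho$ is the usual induced (unitary) representation, regarded up to equivalence. For $k\in\mathbb R^{d_2}$, $\chi_k\in\widehat{\mathcal T\mathcal F}$ is $\chi_k(g)=\exp(2\pi i\langle k,\tau(\pi(g))\rangle)$. On $\widehat{\mathcal T\mathcal F}$ the equivalence relation $\sim$ is: $\rho\sim\rho'$ iff there exist $g\in\mathcal G$ and $k\in\mathbb R^{d_2}$ with $g\cdot\rho=\chi_k\rho'$. For $\rho\in\widehat{\mathcal T\mathcal F}$, $\mathcal G_\rho:=\{(L(\pi(g)),k): g\in\mathcal G,\ k\in\mathbb R^{d_2},\ g\cdot\rho=\chi_k\rho\}\subset E(d_2)$, which is a $d_2$-dimensional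 space group. $\mathbb R^{d_2}/\mathcal G_\rho$ is the set of orbits $\mathcal G_\rho\cdot k$. Measures: for a $d_2$-dimensional space group $\mathcal H$, $\mathbb R^{d_2}/\mathcal H$ carries the pushforward, under the quotient map, of the $d_2$-dimensional Lebesgue measure restricted to a fundamental domain of $\mathcal H$. The dual $\widehat{\mathcal G}$ carries the Plancherel measure $\mu_{\mathcal G}$, i.e. the unique measure with $\sum_{g\in\mathcal G}|f(g)|^2=\int_{\widehat{\mathcal G}}\operatorname{Tr}(\rho(f)^H\rho(f))\,d\mu_{\mathcal G}(\rho)$ for all $f\in\ell^1(\mathcal G)$, where $\rho(f)=\sum_{g\in\mathcal G}f(g)\rho(g)$ and $^H$ is the Hermitian adjoint. *)

theory Defs
  imports
    "HOL-Analysis.Analysis"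
    "HOL-Algebra.Coset"
    "Jordan_Normal_Form.Schur_Decomposition"
begin

text \<open>
  Vectors and matrices are those of \<^theory>\<open>Jordan_Normal_Form.Matrix\<close>, so that all dimensions,
  including 0, are ordinary natural numbers.
\<close>

unbundle no vec_syntax
no_notation inner (infix \<open>\<bullet>\<close> 70)
hide_const (open) Finite_Cartesian_Product.vec Finite_Cartesian_Product.mat

type_synonym isometry = "real mat \<times> real vec"

definition orthogonal_mats :: "nat \<Rightarrow> real mat set" where
  "orthogonal_mats d = {A \<in> carrier_mat d d. A * transpose_mat A = 1\<^sub>m d}"

definition euclidean_group :: "nat \<Rightarrow> isometry monoid" where
  "euclidean_group d =
     \<lparr>carrier = orthogonal_mats d \<times> carrier_vec d,
      mult = (\<lambda>(A\<^sub>1, b\<^sub>1) (A\<^sub>2, b\<^sub>2). (A\<^sub>1 * A\<^sub>2, b\<^sub>1 + A\<^sub>1 *\<^sub>v b\<^sub>2)),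
      one = (1\<^sub>m d, 0\<^sub>v d)\<rparr>"

definition act :: "isometry \<Rightarrow> real vec \<Rightarrow> real vec" where
  "act g x = fst g *\<^sub>v x + snd g"

abbreviation as_group :: "nat \<Rightarrow> isometry set \<Rightarrow> isometry monoid" where
  "as_group d X \<equiv> (euclidean_group d)\<lparr>carrier := X\<rparr>"

text \<open>
  Discreteness refers to the topology \<open>E(d)\<close> inherits from \<open>\<real>\<^sup>d\<^sup>\<times>\<^sup>d \<times> \<real>\<^sup>d\<close>, here given by
  entrywise closeness: every point of \<open>G\<close> is isolated in \<open>G\<close>.
\<close>

definition discrete_subgroup :: "nat \<Rightarrow> isometry set \<Rightarrow> bool" where
  "discrete_subgroup d G \<longleftrightarrow>
     subgroup G (euclidean_group d) \<and>
     (\<forall>(A, a) \<in> G. \<exists>\<epsilon>>0. \<forall>(B, b) \<in> G.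
        (\<forall>i<d. \<forall>j<d. \<bar>A $$ (i, j) - B $$ (i, j)\<bar> < \<epsilon>) \<and> (\<forall>i<d. \<bar>a $ i - b $ i\<bar> < \<epsilon>)
          \<longrightarrow> (B, b) = (A, a))"

definition translation_subgroup :: "nat \<Rightarrow> isometry set \<Rightarrow> isometry set" where
  "translation_subgroup d S = {g \<in> S. fst g = 1\<^sub>m d}"

definition space_group :: "nat \<Rightarrow> isometry set \<Rightarrow> bool" where
  "space_group d S \<longleftrightarrow>
     discrete_subgroup d S \<and>
     (\<exists>B. B \<subseteq> carrier_vec d \<and> finite B \<and> card B = d \<and>
        \<not> LinearCombinations.module.lin_dep class_ring (module_vec TYPE(real) d) B \<and>
        (\<forall>b\<in>B. (1\<^sub>m d, b) \<in> translation_subgroup d S))"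

definition oplus :: "nat \<Rightarrow> nat \<Rightarrow> real mat \<Rightarrow> isometry \<Rightarrow> isometry" where
  "oplus d\<^sub>1 d\<^sub>2 A g =
     (four_block_mat A (0\<^sub>m d\<^sub>1 d\<^sub>2) (0\<^sub>m d\<^sub>2 d\<^sub>1) (fst g), 0\<^sub>v d\<^sub>1 @\<^sub>v snd g)"

definition oplus_group :: "nat \<Rightarrow> nat \<Rightarrow> isometry set \<Rightarrow> isometry set" where
  "oplus_group d\<^sub>1 d\<^sub>2 S = {oplus d\<^sub>1 d\<^sub>2 A g | A g. A \<in> orthogonal_mats d\<^sub>1 \<and> g \<in> S}"

text \<open>The projection \<open>\<pi>(A \<oplus> g) = g\<close> reads off the last \<open>d\<^sub>2\<close> coordinates.\<close>

definition proj :: "nat \<Rightarrow> nat \<Rightarrow> isometry \<Rightarrow> isometry" where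
  "proj d\<^sub>1 d\<^sub>2 g =
     (mat d\<^sub>2 d\<^sub>2 (\<lambda>(i, j). fst g $$ (d\<^sub>1 + i, d\<^sub>1 + j)), vec d\<^sub>2 (\<lambda>i. snd g $ (d\<^sub>1 + i)))"

lemma proj_oplus:
  assumes "A \<in> carrier_mat d\<^sub>1 d\<^sub>1" "g \<in> carrier_mat d\<^sub>2 d\<^sub>2 \<times> carrier_vec d\<^sub>2"
  shows "proj d\<^sub>1 d\<^sub>2 (oplus d\<^sub>1 d\<^sub>2 A g) = g"
  using assms by (cases g) (auto simp: proj_def oplus_def)

definition proj_kernel :: "nat \<Rightarrow> nat \<Rightarrow> isometry set \<Rightarrow> isometry set" where
  "proj_kernel d\<^sub>1 d\<^sub>2 G = kernel (as_group (d\<^sub>1 + d\<^sub>2) G) (euclidean_group d\<^sub>2) (proj d\<^sub>1 d\<^sub>2)"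

definition TF :: "nat \<Rightarrow> nat \<Rightarrow> isometry set \<Rightarrow> isometry set \<Rightarrow> isometry set" where
  "TF d\<^sub>1 d\<^sub>2 G T = set_mult (euclidean_group (d\<^sub>1 + d\<^sub>2)) T (proj_kernel d\<^sub>1 d\<^sub>2 G)"

definition power_set :: "nat \<Rightarrow> isometry set \<Rightarrow> nat \<Rightarrow> isometry set" where
  "power_set d X n = (\<lambda>x. x [^]\<^bsub>euclidean_group d\<^esub> n) ` X"

definition normal_exponents :: "nat \<Rightarrow> isometry set \<Rightarrow> isometry set \<Rightarrow> nat set" where
  "normal_exponents d G T = {n. n \<ge> 1 \<and> power_set d T n \<lhd> as_group d G}"

definition unitary_group :: "nat \<Rightarrow> complex mat monoid" where
  "unitary_group n =
     \<lparr>carrier = {U \<in> carrier_mat n n. U * mat_adjoint U = 1\<^sub>m n}, mult = (*), one = 1\<^sub>m n\<rparr>"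

definition rep_dim :: "('a, 'b) monoid_scheme \<Rightarrow> ('a \<Rightarrow> complex mat) \<Rightarrow> nat" where
  "rep_dim H \<rho> = dim_row (\<rho> \<one>\<^bsub>H\<^esub>)"

definition unitary_rep :: "('a, 'b) monoid_scheme \<Rightarrow> ('a \<Rightarrow> complex mat) \<Rightarrow> bool" where
  "unitary_rep H \<rho> \<longleftrightarrow> (\<exists>n. \<rho> \<in> hom H (unitary_group n))"

definition irreducible_rep :: "('a, 'b) monoid_scheme \<Rightarrow> ('a \<Rightarrow> complex mat) \<Rightarrow> bool" where
  "irreducible_rep H \<rho> \<longleftrightarrow>
     unitary_rep H \<rho> \<and> rep_dim H \<rho> > 0 \<and>
     (\<forall>W. VectorSpace.subspace class_ring W (module_vec TYPE(complex) (rep_dim H \<rho>)) \<and>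
          (\<forall>h \<in> carrier H. \<forall>w \<in> W. \<rho> h *\<^sub>v w \<in> W)
        \<longrightarrow> W = {0\<^sub>v (rep_dim H \<rho>)} \<or> W = carrier_vec (rep_dim H \<rho>))"

definition rep_equiv ::
  "('a, 'b) monoid_scheme \<Rightarrow> ('a \<Rightarrow> complex mat) \<Rightarrow> ('a \<Rightarrow> complex mat) \<Rightarrow> bool" where
  "rep_equiv H \<rho> \<sigma> \<longleftrightarrow>
     (\<exists>U \<in> carrier (unitary_group (rep_dim H \<rho>)). \<forall>h \<in> carrier H. \<sigma> h = U * \<rho> h * mat_adjoint U)"

text \<open>
  Representations are total functions on the type \<open>'a\<close>; their values outside \<^term>\<open>carrier H\<close> are
  irrelevant, since equivalence ignores them.
\<close>

definition rep_class ::
  "('a, 'b) monoid_scheme \<Rightarrow> ('a \<Rightarrow> complex mat) \<Rightarrow> ('a \<Rightarrow> complex mat) set" where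
  "rep_class H \<rho> = {\<sigma>. unitary_rep H \<sigma> \<and> rep_equiv H \<rho> \<sigma>}"

definition dual :: "('a, 'b) monoid_scheme \<Rightarrow> ('a \<Rightarrow> complex mat) set set" where
  "dual H = rep_class H ` {\<rho>. irreducible_rep H \<rho>}"

text \<open>
  Operations on equivalence classes. Each is the union, over the representatives \<open>\<rho>\<close> of a class, of
  the class of the transformed representation; these classes all coincide.
\<close>

definition dual_act ::
  "('a, 'b) monoid_scheme \<Rightarrow> ('a, 'b) monoid_scheme \<Rightarrow> 'a
     \<Rightarrow> ('a \<Rightarrow> complex mat) set \<Rightarrow> ('a \<Rightarrow> complex mat) set" where
  "dual_act H K h c = (\<Union>\<rho>\<in>c. rep_class K (\<lambda>n. \<rho> (inv\<^bsub>H\<^esub> h \<otimes>\<^bsub>H\<^esub> n \<otimes>\<^bsub>H\<^esub> h)))"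

definition dual_twist ::
  "('a, 'b) monoid_scheme \<Rightarrow> ('a \<Rightarrow> complex)
     \<Rightarrow> ('a \<Rightarrow> complex mat) set \<Rightarrow> ('a \<Rightarrow> complex mat) set" where
  "dual_twist K \<chi> c = (\<Union>\<rho>\<in>c. rep_class K (\<lambda>n. \<chi> n \<cdot>\<^sub>m \<rho> n))"

text \<open>
  For \<open>K \<le> H\<close> of finite index with left coset representatives \<open>r\<^sub>0, \<dots>, r\<^sub>l\<^sub>-\<^sub>1\<close> and \<open>\<rho>\<close> of dimension
  \<open>n\<close>, the induced representation sends \<open>h\<close> to the \<open>l \<times> l\<close> block matrix whose block \<open>(p, q)\<close> is
  \<open>\<rho> (r\<^sub>p\<inverse> h r\<^sub>q)\<close> if \<open>r\<^sub>p\<inverse> h r\<^sub>q \<in> K\<close>, and the \<open>n \<times> n\<close> zero matrix otherwise.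
\<close>

definition left_transversal :: "('a, 'b) monoid_scheme \<Rightarrow> 'a set \<Rightarrow> 'a list \<Rightarrow> bool" where
  "left_transversal H K rs \<longleftrightarrow>
     set rs \<subseteq> carrier H \<and> (\<forall>h \<in> carrier H. \<exists>!p. p < length rs \<and> h \<in> rs ! p <#\<^bsub>H\<^esub> K)"

definition induced_rep ::
  "('a, 'b) monoid_scheme \<Rightarrow> 'a set \<Rightarrow> 'a list \<Rightarrow> nat \<Rightarrow> ('a \<Rightarrow> complex mat) \<Rightarrow> 'a \<Rightarrow> complex mat" where
  "induced_rep H K rs n \<rho> h =
     mat (length rs * n) (length rs * n)
       (\<lambda>(i, j). let x = inv\<^bsub>H\<^esub> (rs ! (i div n)) \<otimes>\<^bsub>H\<^esub> h \<otimes>\<^bsub>H\<^esub> rs ! (j div n)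
                 in if x \<in> K then \<rho> x $$ (i mod n, j mod n) else 0)"

definition dual_induce ::
  "('a, 'b) monoid_scheme \<Rightarrow> 'a set \<Rightarrow> ('a \<Rightarrow> complex mat) set \<Rightarrow> ('a \<Rightarrow> complex mat) set" where
  "dual_induce H K c =
     (\<Union>\<rho>\<in>c. \<Union>rs\<in>{rs. left_transversal H K rs}. rep_class H (induced_rep H K rs (rep_dim H \<rho>) \<rho>))"

definition irreps :: "('a, 'b) monoid_scheme \<Rightarrow> nat \<Rightarrow> ('a \<Rightarrow> complex mat) set" where
  "irreps H n = {\<rho>. irreducible_rep H \<rho> \<and> rep_dim H \<rho> = n}"

text \<open>
  The Mackey Borel structure of the dual: the \<open>n\<close>-dimensional irreducible representations carry the
  \<open>\<sigma>\<close>-algebra generated by the matrix coefficients \<open>\<rho> \<mapsto> \<rho>(h)\<^sub>i\<^sub>j\<close>, and the dual carries the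
  quotient \<open>\<sigma>\<close>-algebra.
\<close>

definition irreps_borel ::
  "('a, 'b) monoid_scheme \<Rightarrow> nat \<Rightarrow> ('a \<Rightarrow> complex mat) measure" where
  "irreps_borel H n =
     sigma (irreps H n)
       {{\<rho> \<in> irreps H n. \<rho> h $$ (i, j) \<in> B} | h i j B.
          h \<in> carrier H \<and> i < n \<and> j < n \<and> B \<in> sets (borel :: complex measure)}"

definition dual_borel ::
  "('a, 'b) monoid_scheme \<Rightarrow> ('a \<Rightarrow> complex mat) set measure" where
  "dual_borel H =
     sigma (dual H)
       {E. E \<subseteq> dual H \<and> (\<forall>n. {\<rho> \<in> irreps H n. rep_class H \<rho> \<in> E} \<in> sets (irreps_borel H n))}"

definition rep_sum ::
  "('a, 'b) monoid_scheme \<Rightarrow> ('a \<Rightarrow> complex mat) \<Rightarrow> ('a \<Rightarrow> complex) \<Rightarrow> complex mat" where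
  "rep_sum H \<rho> f =
     mat (rep_dim H \<rho>) (rep_dim H \<rho>) (\<lambda>(i, j). \<Sum>\<^sub>\<infinity>h\<in>carrier H. f h * \<rho> h $$ (i, j))"

definition mat_trace :: "complex mat \<Rightarrow> complex" where
  "mat_trace A = (\<Sum>i<dim_row A. A $$ (i, i))"

text \<open>
  The trace is real, nonnegative and constant on equivalence classes, so it may be evaluated at any
  representative of the class.
\<close>

definition plancherel_measure ::
  "('a, 'b) monoid_scheme \<Rightarrow> ('a \<Rightarrow> complex mat) set measure \<Rightarrow> bool" where
  "plancherel_measure H \<mu> \<longleftrightarrow>
     sets \<mu> = sets (dual_borel H) \<and>
     (\<forall>f. (\<lambda>h. norm (f h)) summable_on carrier H \<longrightarrow>
        ennreal (\<Sum>\<^sub>\<infinity>h\<in>carrier H. (norm (f h))\<^sup>2) =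
        (\<integral>\<^sup>+ c. (let \<rho> = (SOME \<rho>. \<rho> \<in> c)
                in ennreal (Re (mat_trace (mat_adjoint (rep_sum H \<rho> f) * rep_sum H \<rho> f)))) \<partial>\<mu>))"

definition lborel_vec :: "nat \<Rightarrow> real vec measure" where
  "lborel_vec n = embed_measure (\<Pi>\<^sub>M i\<in>{..<n}. lborel) (\<lambda>x. vec n x)"

definition orbit_of :: "isometry set \<Rightarrow> real vec \<Rightarrow> real vec set" where
  "orbit_of H k = (\<lambda>h. act h k) ` H"

definition orbit_space :: "nat \<Rightarrow> isometry set \<Rightarrow> real vec set set" where
  "orbit_space n H = orbit_of H ` carrier_vec n"

text \<open>Fundamental domains only need to cover, and to have disjoint translates, up to null sets.\<close>

definition fundamental_domain :: "nat \<Rightarrow> isometry set \<Rightarrow> real vec set \<Rightarrow> bool" where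
  "fundamental_domain n H D \<longleftrightarrow>
     D \<in> sets (lborel_vec n) \<and>
     carrier_vec n - (\<Union>h\<in>H. act h ` D) \<in> null_sets (lborel_vec n) \<and>
     (\<forall>h\<in>H. h \<noteq> \<one>\<^bsub>euclidean_group n\<^esub> \<longrightarrow> D \<inter> act h ` D \<in> null_sets (lborel_vec n))"

definition orbit_borel :: "nat \<Rightarrow> isometry set \<Rightarrow> real vec set measure" where
  "orbit_borel n H =
     sigma (orbit_space n H)
       {E. E \<subseteq> orbit_space n H \<and> {k \<in> carrier_vec n. orbit_of H k \<in> E} \<in> sets (lborel_vec n)}"

definition orbit_measure :: "nat \<Rightarrow> isometry set \<Rightarrow> real vec set \<Rightarrow> real vec set measure" where
  "orbit_measure n H D = distr (restrict_space (lborel_vec n) D) (orbit_borel n H) (orbit_of H)"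

text \<open>The measure does not depend on the fundamental domain; null sets are required to be null for
  every choice of it.\<close>

definition orbit_null_set :: "nat \<Rightarrow> isometry set \<Rightarrow> real vec set set \<Rightarrow> bool" where
  "orbit_null_set n H N \<longleftrightarrow>
     N \<in> sets (orbit_borel n H) \<and>
     (\<forall>D. fundamental_domain n H D \<longrightarrow> N \<in> null_sets (orbit_measure n H D))"

definition chi :: "nat \<Rightarrow> nat \<Rightarrow> real vec \<Rightarrow> isometry \<Rightarrow> complex" where
  "chi d\<^sub>1 d\<^sub>2 k g = exp (2 * pi * \<i> * complex_of_real (k \<bullet> snd (proj d\<^sub>1 d\<^sub>2 g)))"

abbreviation TF_group :: "nat \<Rightarrow> nat \<Rightarrow> isometry set \<Rightarrow> isometry set \<Rightarrow> isometry monoid" where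
  "TF_group d\<^sub>1 d\<^sub>2 G T \<equiv> as_group (d\<^sub>1 + d\<^sub>2) (TF d\<^sub>1 d\<^sub>2 G T)"

abbreviation TF_act ::
  "nat \<Rightarrow> nat \<Rightarrow> isometry set \<Rightarrow> isometry set \<Rightarrow> isometry
     \<Rightarrow> (isometry \<Rightarrow> complex mat) set \<Rightarrow> (isometry \<Rightarrow> complex mat) set" where
  "TF_act d\<^sub>1 d\<^sub>2 G T \<equiv> dual_act (as_group (d\<^sub>1 + d\<^sub>2) G) (TF_group d\<^sub>1 d\<^sub>2 G T)"

abbreviation TF_twist ::
  "nat \<Rightarrow> nat \<Rightarrow> isometry set \<Rightarrow> isometry set \<Rightarrow> real vec
     \<Rightarrow> (isometry \<Rightarrow> complex mat) set \<Rightarrow> (isometry \<Rightarrow> complex mat) set" where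
  "TF_twist d\<^sub>1 d\<^sub>2 G T k \<equiv> dual_twist (TF_group d\<^sub>1 d\<^sub>2 G T) (chi d\<^sub>1 d\<^sub>2 k)"

definition TF_rel ::
  "nat \<Rightarrow> nat \<Rightarrow> isometry set \<Rightarrow> isometry set
     \<Rightarrow> (isometry \<Rightarrow> complex mat) set \<Rightarrow> (isometry \<Rightarrow> complex mat) set \<Rightarrow> bool" where
  "TF_rel d\<^sub>1 d\<^sub>2 G T \<rho> \<rho>' \<longleftrightarrow>
     (\<exists>g\<in>G. \<exists>k\<in>carrier_vec d\<^sub>2. TF_act d\<^sub>1 d\<^sub>2 G T g \<rho> = TF_twist d\<^sub>1 d\<^sub>2 G T k \<rho>')"

definition stab_group ::
  "nat \<Rightarrow> nat \<Rightarrow> isometry set \<Rightarrow> isometry set \<Rightarrow> (isometry \<Rightarrow> complex mat) set \<Rightarrow> isometry set" where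
  "stab_group d\<^sub>1 d\<^sub>2 G T \<rho> =
     {(fst (proj d\<^sub>1 d\<^sub>2 g), k) | g k.
        g \<in> G \<and> k \<in> carrier_vec d\<^sub>2 \<and> TF_act d\<^sub>1 d\<^sub>2 G T g \<rho> = TF_twist d\<^sub>1 d\<^sub>2 G T k \<rho>}"

definition TF_dual_trivial_on ::
  "nat \<Rightarrow> nat \<Rightarrow> isometry set \<Rightarrow> isometry set \<Rightarrow> nat \<Rightarrow> (isometry \<Rightarrow> complex mat) set set" where
  "TF_dual_trivial_on d\<^sub>1 d\<^sub>2 G T m =
     {c \<in> dual (TF_group d\<^sub>1 d\<^sub>2 G T).
        \<forall>\<rho>\<in>c. \<forall>t \<in> power_set (d\<^sub>1 + d\<^sub>2) T m. \<rho> t = 1\<^sub>m (rep_dim (TF_group d\<^sub>1 d\<^sub>2 G T) \<rho>)}"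

definition representation_set :: "'a set \<Rightarrow> ('a \<Rightarrow> 'a \<Rightarrow> bool) \<Rightarrow> 'a set \<Rightarrow> bool" where
  "representation_set X r R \<longleftrightarrow> R \<subseteq> X \<and> (\<forall>x\<in>X. \<exists>!y. y \<in> R \<and> r x y)"

end

theory Submission
  imports
    Defs
    "Jordan_Normal_Form.Spectral_Radius"
    "Jordan_Normal_Form.DL_Rank"
begin

text \<open>
  Put \<open>A = \<T>\<^sup>m\<close>. The projection \<open>\<tau> \<circ> \<pi>\<close> maps the normal subgroup \<open>A\<close> isomorphically onto a lattice,
  \<open>\<T>\<F>\<close> is the centralizer of \<open>A\<close>, and it has finite index because the point group preserves the
  lattice. Every character of \<open>A\<close> is the restriction of some \<open>\<chi>\<^sub>k\<close>, and \<open>A\<close> acts on an irreducible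
  representation of \<open>\<T>\<F>\<close> by scalars; hence every such representation is \<open>\<chi>\<^sub>k \<rho>\<close> with \<open>\<rho>\<close> trivial on
  \<open>A\<close>.

  The exceptional sets consist of the \<open>k\<close> for which \<open>\<chi>\<^sub>k\<close> is not injective on \<open>A\<close> (countably many
  hyperplanes), and of the representations of \<open>\<G>\<close> in which some \<open>a \<in> A\<close>, \<open>a \<noteq> 1\<close>, fixes a nonzero
  vector. For fixed \<open>a\<close> the latter form a Plancherel null set, as the Plancherel formula for the
  averages of \<open>1, a, \<dots>, a\<^bsup>n-1\<^esup>\<close> shows. Away from them, the conjugates of \<open>\<chi>\<^sub>k\<close> under distinct cosets of
  \<open>\<T>\<F>\<close> differ on \<open>A\<close>, so \<open>Ind (\<chi>\<^sub>k \<rho>)\<close> is irreducible, and every irreducible representation of \<open>\<G>\<close>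
  is induced from any of its irreducible \<open>\<T>\<F>\<close>-components. By Schur's lemma, two irreducible
  representations of \<open>\<T>\<F>\<close> induce equivalent representations only if they are conjugate under \<open>\<G>\<close>,
  and for \<open>\<chi>\<^sub>k \<rho>\<close> this is the relation defining \<open>R\<close> and the orbits of \<open>\<G>\<^sub>\<rho>\<close>.
\<close>

section \<open>Isometric complex matrices\<close>

text \<open>Mackey's analysis would attach to every character of \<open>A\<close> a little group,
  its stabilizer modulo \<open>TF\<close>. The exceptional sets remove every character for which
  this group could be nontrivial: an element that fixes an injective character centralizes
  \<open>A\<close>, so it lies in \<open>TF\<close>. What remains is plain induction. The Plancherel
  measure itself is never computed; its defining formula is only tested on finitely supported
  functions. The exponent \<open>m\<close> enters because \<open>T\<close> is a mere set of lifts of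
  translations, whereas its \<open>m\<close>-th powers form a normal subgroup, and normality is what
  lets conjugation act on the lattice. Two encodings shape the matrix part. Subspaces are replaced
  by matrices \<open>E\<close> with orthonormal columns, so that invariance becomes an equation
  \<open>\<rho> h * E = E * M\<close> and a projection becomes \<open>E\<close> times its adjoint.
  Induction is replaced by the relation \<open>induced_via\<close>, which mentions neither coset
  representatives nor a basis of the large space; the block matrix of the definition is compared
  with it afterwards.\<close>

lemma mat_adjoint_eq:
  "mat_adjoint (A :: complex mat) = mat (dim_col A) (dim_row A) (\<lambda>(i, j). cnj (A $$ (j, i)))"
  by (rule eq_matI) (auto simp: mat_adjoint_def mat_of_rows_def)

lemma mat_adjoint_carrier [simp]:
  "A \<in> carrier_mat n m \<Longrightarrow> mat_adjoint (A :: complex mat) \<in> carrier_mat m n"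
  by (auto simp: mat_adjoint_eq)

lemma dim_mat_adjoint [simp]:
  "dim_row (mat_adjoint (A :: complex mat)) = dim_col A"
  "dim_col (mat_adjoint (A :: complex mat)) = dim_row A"
  by (auto simp: mat_adjoint_eq)

lemma mat_adjoint_adjoint [simp]: "mat_adjoint (mat_adjoint (A :: complex mat)) = A"
  by (rule eq_matI) (auto simp: mat_adjoint_eq)

lemma mat_adjoint_one [simp]: "mat_adjoint (1\<^sub>m n :: complex mat) = 1\<^sub>m n"
  by (rule eq_matI) (auto simp: mat_adjoint_eq)

lemma mat_adjoint_smult: "mat_adjoint (c \<cdot>\<^sub>m A :: complex mat) = cnj c \<cdot>\<^sub>m mat_adjoint A"
  by (rule eq_matI) (auto simp: mat_adjoint_eq)

lemma mat_adjoint_mult: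
  assumes "A \<in> carrier_mat n m" "B \<in> carrier_mat m k"
  shows "mat_adjoint (A * B :: complex mat) = mat_adjoint B * mat_adjoint A"
  using assms
  by (intro eq_matI) (auto simp: mat_adjoint_eq scalar_prod_def intro!: sum.cong)

lemma mat_adjoint_mult_index:
  assumes "A \<in> carrier_mat n k" "B \<in> carrier_mat n l" "i < k" "j < l"
  shows "(mat_adjoint A * B) $$ (i, j) = (\<Sum>t<n. cnj (A $$ (t, i)) * (B :: complex mat) $$ (t, j))"
  using assms by (auto simp: mat_adjoint_eq scalar_prod_def atLeast0LessThan)

lemma mat_mult_index_sum:
  assumes "A \<in> carrier_mat n k" "B \<in> carrier_mat k l" "i < n" "j < l"
  shows "(A * B) $$ (i, j) = (\<Sum>t<k. A $$ (i, t) * B $$ (t, j))"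
  using assms by (auto simp: scalar_prod_def atLeast0LessThan)

lemma mat_vec_index_sum:
  assumes "A \<in> carrier_mat n k" "v \<in> carrier_vec k" "i < n"
  shows "(A *\<^sub>v v) $ i = (\<Sum>t<k. A $$ (i, t) * v $ t)"
  using assms by (auto simp: scalar_prod_def atLeast0LessThan)

text \<open>The diagonal entries of the product are the squared norms of the columns of
  \<open>A\<close>.\<close>

lemma adjoint_self_mult_eq_0:
  assumes "A \<in> carrier_mat n k" "mat_adjoint A * A = 0\<^sub>m k k"
  shows "(A :: complex mat) = 0\<^sub>m n k"
proof (rule eq_matI)
  fix i j assume ij: "i < dim_row (0\<^sub>m n k :: complex mat)" "j < dim_col (0\<^sub>m n k :: complex mat)"
  have "(\<Sum>t<n. cnj (A $$ (t, j)) * A $$ (t, j)) = 0"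
    using mat_adjoint_mult_index[OF assms(1) assms(1), of j j] assms(2) ij by simp
  then have "complex_of_real (\<Sum>t<n. (cmod (A $$ (t, j)))\<^sup>2) = 0"
    by (simp only: of_real_sum) (simp add: complex_norm_square mult.commute del: of_real_power)
  then have "(\<Sum>t<n. (cmod (A $$ (t, j)))\<^sup>2) = 0" by (simp only: of_real_eq_0_iff)
  then have "\<forall>t\<in>{..<n}. (cmod (A $$ (t, j)))\<^sup>2 = 0" by (subst (asm) sum_nonneg_eq_0_iff) auto
  then show "A $$ (i, j) = 0\<^sub>m n k $$ (i, j)" using ij by auto
qed (use assms in auto)

text \<open>Orthonormal columns: \<open>E\<close> stands for an \<open>s\<close>-dimensional
  subspace of the \<open>n\<close>-dimensional space together with an orthonormal basis. The adjoint
  of \<open>E\<close> computes coordinates, and \<open>E\<close> times its adjoint is the orthogonal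
  projection.\<close>

definition isometric :: "nat \<Rightarrow> nat \<Rightarrow> complex mat \<Rightarrow> bool" where
  "isometric n s E \<longleftrightarrow> E \<in> carrier_mat n s \<and> mat_adjoint E * E = 1\<^sub>m s"

lemma isometricD:
  assumes "isometric n s E"
  shows "E \<in> carrier_mat n s" "mat_adjoint E \<in> carrier_mat s n" "mat_adjoint E * E = 1\<^sub>m s"
  using assms by (auto simp: isometric_def)

lemma isometric_mult:
  assumes E: "isometric n s E" and F: "isometric s r F"
  shows "isometric n r (E * F)"
proof -
  note [simp] = isometricD[OF E] isometricD[OF F]
    mult_carrier_mat[OF isometricD(1)[OF E] isometricD(1)[OF F]]
  have "mat_adjoint (E * F) * (E * F) = mat_adjoint F * (mat_adjoint E * (E * F))"
    by (subst mat_adjoint_mult[OF isometricD(1)[OF E] isometricD(1)[OF F]])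
       (rule assoc_mult_mat[of _ r s _ n _ r], auto)
  also have "mat_adjoint E * (E * F) = (mat_adjoint E * E) * F"
    by (rule assoc_mult_mat[of _ s n _ s _ r, symmetric]) auto
  also have "mat_adjoint F * \<dots> = 1\<^sub>m r"
    using left_mult_one_mat[OF isometricD(1)[OF F]] isometricD(3)[OF F] isometricD(3)[OF E] by presburger
  finally show ?thesis
    by (simp add: isometric_def)
qed

lemma isometric_one: "isometric n n (1\<^sub>m n)"
  by (simp add: isometric_def)

lemma isometric_right_inverse:
  assumes "isometric n n E"
  shows "E * mat_adjoint E = 1\<^sub>m n"
  using mat_mult_left_right_inverse[of "mat_adjoint E" n E] isometricD[OF assms] by simp

text \<open>If \<open>n < s\<close>, zero rows can be appended to make \<open>E\<close> square
  without changing its Gram matrix. A left inverse of a square matrix is a right inverse, yet the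
  product of \<open>F\<close> with its adjoint vanishes in the appended rows.\<close>

lemma isometric_le:
  assumes "isometric n s E"
  shows "s \<le> n"
proof (rule ccontr)
  note [simp] = isometricD(1)[OF assms]
  assume "\<not> s \<le> n"
  then have ns: "n < s" by simp
  define F where "F = mat s s (\<lambda>(i, j). if i < n then E $$ (i, j) else 0)"
  have F [simp]: "F \<in> carrier_mat s s" by (simp add: F_def)
  have "mat_adjoint F * F = 1\<^sub>m s"
  proof (rule eq_matI)
    fix i j assume ij: "i < dim_row (1\<^sub>m s :: complex mat)" "j < dim_col (1\<^sub>m s :: complex mat)"
    have "(mat_adjoint F * F) $$ (i, j) = (\<Sum>t<s. cnj (F $$ (t, i)) * F $$ (t, j))"
      by (rule mat_adjoint_mult_index) (use ij in auto)
    also have "\<dots> = (\<Sum>t<n. cnj (F $$ (t, i)) * F $$ (t, j))"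
      by (rule sum.mono_neutral_right) (use ij ns in \<open>auto simp: F_def\<close>)
    also have "\<dots> = (\<Sum>t<n. cnj (E $$ (t, i)) * E $$ (t, j))"
      by (rule sum.cong) (use ij ns in \<open>auto simp: F_def\<close>)
    also have "\<dots> = (mat_adjoint E * E) $$ (i, j)"
      by (rule mat_adjoint_mult_index[symmetric]) (use ij in auto)
    also have "\<dots> = 1\<^sub>m s $$ (i, j)" using isometricD[OF assms] by simp
    finally show "(mat_adjoint F * F) $$ (i, j) = 1\<^sub>m s $$ (i, j)" .
  qed (auto simp: F_def)
  then have "F * mat_adjoint F = 1\<^sub>m s"
    using mat_mult_left_right_inverse[of "mat_adjoint F" s F] by simp
  then have "(F * mat_adjoint F) $$ (n, n) = 1" using ns by simp
  moreover have "(F * mat_adjoint F) $$ (n, n) = (\<Sum>t<s. F $$ (n, t) * mat_adjoint F $$ (t, n))"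
    by (rule mat_mult_index_sum) (use ns in auto)
  moreover have "\<dots> = 0" by (rule sum.neutral) (use ns in \<open>auto simp: F_def\<close>)
  ultimately show False by simp
qed

section \<open>Linear subspaces as ranges of isometric matrices\<close>

definition lin_subspace :: "nat \<Rightarrow> complex vec set \<Rightarrow> bool" where
  "lin_subspace n W \<longleftrightarrow> W \<subseteq> carrier_vec n \<and> 0\<^sub>v n \<in> W \<and> (\<forall>v\<in>W. \<forall>w\<in>W. v + w \<in> W) \<and>
     (\<forall>c. \<forall>v\<in>W. c \<cdot>\<^sub>v v \<in> W)"

lemma lin_subspaceD:
  assumes "lin_subspace n W"
  shows "v \<in> W \<Longrightarrow> v \<in> carrier_vec n" "0\<^sub>v n \<in> W" "v \<in> W \<Longrightarrow> w \<in> W \<Longrightarrow> v + w \<in> W"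
    "v \<in> W \<Longrightarrow> c \<cdot>\<^sub>v v \<in> W"
  using assms by (auto simp: lin_subspace_def)

lemma lin_subspace_minus:
  assumes "lin_subspace n W" "v \<in> W" "w \<in> W"
  shows "v - w \<in> W"
proof -
  have "v - w = v + (-1) \<cdot>\<^sub>v w"
    using lin_subspaceD(1)[OF assms(1)] assms(2,3) by (intro eq_vecI) auto
  then show ?thesis using lin_subspaceD[OF assms(1)] assms(2,3) by simp
qed

lemma subspace_iff_lin_subspace:
  "VectorSpace.subspace class_ring W (module_vec TYPE(complex) n) \<longleftrightarrow> lin_subspace n W"
proof -
  interpret vec_space "TYPE(complex)" n .
  show ?thesis
  proof
    assume "subspace class_ring W V"
    then have s: "submodule class_ring W V" by (simp add: VectorSpace.subspace_def)
    show "lin_subspace n W"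
      using s unfolding submodule_def lin_subspace_def
      by (auto simp: module_vec_simps class_ring_simps)
  next
    assume W: "lin_subspace n W"
    have "submodule class_ring W V"
      unfolding submodule_def using W module_axioms
      by (auto simp: lin_subspace_def module_vec_simps class_ring_simps)
    then show "subspace class_ring W V"
      using vectorspace_axioms by (simp add: VectorSpace.subspace_def)
  qed
qed

text \<open>Columns are collected greedily; the residual \<open>v - Q Q\<^sup>* v\<close> of a vector outside the range of
  \<open>Q\<close> would give a further column.\<close>

lemma lin_subspace_range_isometric:
  assumes W: "lin_subspace n W"
  obtains s Q where "isometric n s Q" "W = {Q *\<^sub>v x | x. x \<in> carrier_vec s}"
proof -
  define P where "P s \<longleftrightarrow> (\<exists>Q. isometric n s Q \<and> (\<forall>x\<in>carrier_vec s. Q *\<^sub>v x \<in> W))" for s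
  have P0: "P 0"
  proof -
    have "isometric n 0 (0\<^sub>m n 0)" by (auto simp: isometric_def intro!: eq_matI)
    moreover have "0\<^sub>m n 0 *\<^sub>v x = 0\<^sub>v n" if "x \<in> carrier_vec 0" for x :: "complex vec"
      using that by (intro eq_vecI) (auto simp: scalar_prod_def)
    moreover have "\<forall>x\<in>carrier_vec 0. 0\<^sub>m n 0 *\<^sub>v x \<in> W"
      using lin_subspaceD(2)[OF W] calculation(2) by auto
    ultimately show ?thesis unfolding P_def by blast
  qed
  have Pn: "s \<le> n" if "P s" for s using that isometric_le unfolding P_def by blast
  \<comment> \<open>A largest frame inside \<open>W\<close>: \<open>isometric_le\<close> bounds its
    size, and \<open>P 0\<close> holds for the matrix without columns.\<close>
  define s where "s = Greatest P"
  have Ps: "P s" unfolding s_def by (rule GreatestI_nat[where P = P, OF P0 Pn])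
  have max: "r \<le> s" if "P r" for r unfolding s_def by (rule Greatest_le_nat[where P = P, OF that Pn])
  obtain Q where Q: "isometric n s Q" and QW: "\<And>x. x \<in> carrier_vec s \<Longrightarrow> Q *\<^sub>v x \<in> W"
    using Ps unfolding P_def by blast
  note Qc = isometricD[OF Q]
  have "\<exists>x. x \<in> carrier_vec s \<and> w = Q *\<^sub>v x" if w: "w \<in> W" for w
  proof (rule ccontr)
    assume not: "\<not> ?thesis"
    have wc: "w \<in> carrier_vec n" using lin_subspaceD(1)[OF W w] .
    define x where "x = mat_adjoint Q *\<^sub>v w"
    have x: "x \<in> carrier_vec s" unfolding x_def by (rule mult_mat_vec_carrier[OF Qc(2) wc])
    define u where "u = w - Q *\<^sub>v x"
    have uW: "u \<in> W" unfolding u_def by (rule lin_subspace_minus[OF W w QW[OF x]])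
    then have uc: "u \<in> carrier_vec n" using lin_subspaceD(1)[OF W] by blast
    have Qxc: "Q *\<^sub>v x \<in> carrier_vec n" using Qc x by auto
    have Qu: "mat_adjoint Q *\<^sub>v u = 0\<^sub>v s"
    proof -
      have "mat_adjoint Q *\<^sub>v u = mat_adjoint Q *\<^sub>v w - mat_adjoint Q *\<^sub>v (Q *\<^sub>v x)"
        unfolding u_def by (rule mult_minus_distrib_mat_vec[OF Qc(2) wc Qxc])
      also have "mat_adjoint Q *\<^sub>v (Q *\<^sub>v x) = (mat_adjoint Q * Q) *\<^sub>v x"
        by (rule assoc_mult_mat_vec[OF Qc(2) Qc(1) x, symmetric])
      also have "\<dots> = x" using Qc(3) x by simp
      finally show ?thesis using x by (simp add: x_def)
    qed
    have u0: "u \<noteq> 0\<^sub>v n"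
    proof
      assume u0: "u = 0\<^sub>v n"
      have "w = Q *\<^sub>v x"
      proof (rule eq_vecI)
        fix i assume "i < dim_vec (Q *\<^sub>v x)"
        then have "i < n" using Qc(1) by auto
        then have "u $ i = w $ i - (Q *\<^sub>v x) $ i" using Qc(1) wc unfolding u_def by auto
        then show "w $ i = (Q *\<^sub>v x) $ i" using u0 \<open>i < n\<close> by simp
      qed (use Qc(1) wc in auto)
      then show False using not x by blast
    qed
    define N where "N = (\<Sum>t<n. (cmod (u $ t))\<^sup>2)"
    have "N > 0"
    proof -
      obtain t where "t < n" "u $ t \<noteq> 0" using u0 uc by (metis carrier_vecD eq_vecI index_zero_vec)
      then show ?thesis unfolding N_def by (intro sum_pos2[of _ t]) auto
    qed
    define c where "c = complex_of_real (1 / sqrt N)"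
    define v where "v = c \<cdot>\<^sub>v u"
    have vW: "v \<in> W" unfolding v_def by (rule lin_subspaceD(4)[OF W uW])
    have vc: "v \<in> carrier_vec n" using uc by (simp add: v_def)
    have vv: "(\<Sum>t<n. cnj (v $ t) * v $ t) = 1"
    proof -
      have "(\<Sum>t<n. cnj (v $ t) * v $ t) = (\<Sum>t<n. complex_of_real ((1 / N) * (cmod (u $ t))\<^sup>2))"
      proof (rule sum.cong[OF refl])
        fix t assume "t \<in> {..<n}"
        then have "v $ t = c * u $ t" using uc by (simp add: v_def)
        then have "cnj (v $ t) * v $ t = complex_of_real ((cmod c)\<^sup>2 * (cmod (u $ t))\<^sup>2)"
          using complex_norm_square[of "c * u $ t"]
          by (simp only: norm_mult power_mult_distrib mult.commute[of "cnj _"])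
        moreover have "(cmod c)\<^sup>2 = 1 / N" using \<open>N > 0\<close> by (simp add: c_def norm_divide power_divide)
        ultimately show "cnj (v $ t) * v $ t = complex_of_real ((1 / N) * (cmod (u $ t))\<^sup>2)" by simp
      qed
      also have "\<dots> = complex_of_real ((1 / N) * N)" unfolding N_def sum_distrib_left of_real_sum ..
      finally show ?thesis using \<open>N > 0\<close> by simp
    qed
    have Qv: "(\<Sum>t<n. cnj (Q $$ (t, i)) * v $ t) = 0" if "i < s" for i
    proof -
      have "(mat_adjoint Q *\<^sub>v u) $ i = (\<Sum>t<n. cnj (Q $$ (t, i)) * u $ t)"
        using mat_vec_index_sum[OF Qc(2) uc that] Qc(1) that by (simp add: mat_adjoint_eq)
      then have "(\<Sum>t<n. cnj (Q $$ (t, i)) * u $ t) = 0" using Qu that by simp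
      then have "c * (\<Sum>t<n. cnj (Q $$ (t, i)) * u $ t) = 0" by simp
      then show ?thesis using uc by (simp add: v_def sum_distrib_left mult.left_commute)
    qed
    define F where "F = mat n (Suc s) (\<lambda>(i, j). if j < s then Q $$ (i, j) else v $ i)"
    have Fc: "F \<in> carrier_mat n (Suc s)" by (simp add: F_def)
    have "mat_adjoint F * F = 1\<^sub>m (Suc s)"
    proof (rule eq_matI)
      fix i j assume "i < dim_row (1\<^sub>m (Suc s) :: complex mat)" "j < dim_col (1\<^sub>m (Suc s) :: complex mat)"
      then have ij: "i < Suc s" "j < Suc s" by auto
      have F1: "F $$ (t, j) = (if j < s then Q $$ (t, j) else v $ t)" if "t < n" "j < Suc s" for t j
        using that by (simp add: F_def)
      have eq: "(mat_adjoint F * F) $$ (i, j) = (\<Sum>t<n. cnj (F $$ (t, i)) * F $$ (t, j))"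
        by (rule mat_adjoint_mult_index[OF Fc Fc ij])
      have Qv': "(\<Sum>t<n. cnj (v $ t) * Q $$ (t, j)) = 0" if "j < s" for j
        using arg_cong[OF Qv[OF that], of cnj] by (simp add: mult.commute)
      have QQ: "(\<Sum>t<n. cnj (Q $$ (t, i)) * Q $$ (t, j)) = (if i = j then 1 else 0)" if "i < s" "j < s"
        using mat_adjoint_mult_index[OF Qc(1) Qc(1) that] Qc(3) that by simp
      show "(mat_adjoint F * F) $$ (i, j) = 1\<^sub>m (Suc s) $$ (i, j)"
        unfolding eq using ij Qv Qv' QQ vv
        by (cases "i < s"; cases "j < s") (auto simp: F1 less_Suc_eq)
    qed (use Fc in auto)
    then have F: "isometric n (Suc s) F" using Fc by (simp add: isometric_def)
    have "F *\<^sub>v y \<in> W" if y: "y \<in> carrier_vec (Suc s)" for y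
    proof -
      define z where "z = vec s (\<lambda>i. y $ i)"
      have z: "z \<in> carrier_vec s" by (simp add: z_def)
      have Qzc: "Q *\<^sub>v z \<in> carrier_vec n" using Qc z by auto
      have "F *\<^sub>v y = Q *\<^sub>v z + (y $ s) \<cdot>\<^sub>v v"
      proof (rule eq_vecI)
        fix i assume "i < dim_vec (Q *\<^sub>v z + (y $ s) \<cdot>\<^sub>v v)"
        then have i: "i < n" using vc by simp
        show "(F *\<^sub>v y) $ i = (Q *\<^sub>v z + (y $ s) \<cdot>\<^sub>v v) $ i"
          using i vc Qzc mat_vec_index_sum[OF Fc y i] mat_vec_index_sum[OF Qc(1) z i]
          by (auto simp: F_def z_def lessThan_Suc)
      qed (use Fc vc in auto)
      then show ?thesis using lin_subspaceD[OF W] QW[OF z] vW by simp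
    qed
    then have "P (Suc s)" using F unfolding P_def by blast
    then show False using max by fastforce
  qed
  then have "W = {Q *\<^sub>v x | x. x \<in> carrier_vec s}" using QW by auto
  then show ?thesis using that Q by blast
qed

section \<open>Unitary representations and Schur's lemma\<close>

text \<open>Stated with equations between dimensions instead of carrier memberships, so that the
  simplifier can discharge the side conditions while it reassociates products.\<close>

lemma mat_assoc:
  "dim_col A = dim_row B \<Longrightarrow> dim_col B = dim_row C \<Longrightarrow> A * B * C = A * (B * (C :: 'a :: semiring_0 mat))"
  by (rule assoc_mult_mat[of A "dim_row A" "dim_row B" B "dim_row C" C "dim_col C"]) auto

lemma mat_vec_assoc:
  "dim_col A = dim_row B \<Longrightarrow> dim_col B = dim_vec v \<Longrightarrow> A * B *\<^sub>v v = A *\<^sub>v (B *\<^sub>v (v :: 'a :: semiring_0 vec))"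
  by (rule assoc_mult_mat_vec[of A "dim_row A" "dim_row B" B "dim_vec v"]) auto

lemma mat_smult_left: "dim_col A = dim_row B \<Longrightarrow> (c \<cdot>\<^sub>m A) * B = c \<cdot>\<^sub>m (A * (B :: 'a :: comm_semiring_0 mat))"
  by (rule mult_smult_assoc_mat[of A "dim_row A" "dim_row B" B "dim_col B"]) auto

lemma mat_smult_right: "dim_col A = dim_row B \<Longrightarrow> A * (c \<cdot>\<^sub>m B) = c \<cdot>\<^sub>m (A * (B :: 'a :: comm_semiring_0 mat))"
  by (rule mult_smult_distrib[of A "dim_row A" "dim_row B" B "dim_col B"]) auto

lemma mat_smult_smult: "a \<cdot>\<^sub>m (b \<cdot>\<^sub>m A) = (a * b) \<cdot>\<^sub>m (A :: 'a :: semigroup_mult mat)"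
  by (rule eq_matI) (auto simp: mult.assoc)

lemma mat_one_left: "dim_row A = n \<Longrightarrow> 1\<^sub>m n * A = (A :: 'a :: semiring_1 mat)"
  by auto

lemma mat_one_right: "dim_col A = n \<Longrightarrow> A * 1\<^sub>m n = (A :: 'a :: semiring_1 mat)"
  by auto

lemma mat_eq_by_vec:
  assumes "A \<in> carrier_mat n k" "B \<in> carrier_mat n k"
    "\<And>v. v \<in> carrier_vec k \<Longrightarrow> A *\<^sub>v v = B *\<^sub>v (v :: 'a :: comm_semiring_1 vec)"
  shows "A = B"
proof (rule eq_matI)
  fix i j assume ij: "i < dim_row B" "j < dim_col B"
  have "A *\<^sub>v unit_vec k j = B *\<^sub>v unit_vec k j" by (rule assms(3)) auto
  then have "(A *\<^sub>v unit_vec k j) $ i = (B *\<^sub>v unit_vec k j) $ i" by simp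
  then show "A $$ (i, j) = B $$ (i, j)" using assms(1,2) ij by auto
qed (use assms in auto)

lemma smult_mat_vec: "dim_vec v = dim_col A \<Longrightarrow> (c \<cdot>\<^sub>m A) *\<^sub>v v = c \<cdot>\<^sub>v (A *\<^sub>v (v :: 'a :: comm_ring_1 vec))"
  by (intro eq_vecI) (auto simp: scalar_prod_def sum_distrib_left mult.assoc)

text \<open>\<open>unitary_group\<close> asks for a right inverse, \<open>isometric\<close> for a
  left one; for square matrices either implies the other.\<close>

lemma carrier_unitary_group: "U \<in> carrier (unitary_group n) \<longleftrightarrow> isometric n n U"
  using mat_mult_left_right_inverse[of U n "mat_adjoint U"] isometric_right_inverse[of n U]
  by (auto simp: unitary_group_def isometric_def)

lemma isometric_adjoint: "isometric n n U \<Longrightarrow> isometric n n (mat_adjoint U)"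
  using isometric_right_inverse[of n U] isometricD(2)[of n n U] by (simp add: isometric_def)

lemma mult_unitary_group [simp]: "x \<otimes>\<^bsub>unitary_group n\<^esub> y = x * y"
  by (simp add: unitary_group_def)

section \<open>Unitary representations of an arbitrary group: invariant frames, scalars,
  equivalence\<close>

context group begin

lemma unitary_homD:
  assumes "\<rho> \<in> hom G (unitary_group n)"
  shows "h \<in> carrier G \<Longrightarrow> \<rho> h \<in> carrier_mat n n"
    "h \<in> carrier G \<Longrightarrow> dim_row (\<rho> h) = n" "h \<in> carrier G \<Longrightarrow> dim_col (\<rho> h) = n"
    "h \<in> carrier G \<Longrightarrow> isometric n n (\<rho> h)"
    "h \<in> carrier G \<Longrightarrow> \<rho> h * mat_adjoint (\<rho> h) = 1\<^sub>m n"
    "h \<in> carrier G \<Longrightarrow> mat_adjoint (\<rho> h) * \<rho> h = 1\<^sub>m n"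
    "x \<in> carrier G \<Longrightarrow> y \<in> carrier G \<Longrightarrow> \<rho> (x \<otimes> y) = \<rho> x * \<rho> y"
    "\<rho> \<one> = 1\<^sub>m n" "rep_dim G \<rho> = n" "unitary_rep G \<rho>"
    "h \<in> carrier G \<Longrightarrow> \<rho> (inv h) = mat_adjoint (\<rho> h)"
proof -
  have I: "isometric n n (\<rho> h)" if "h \<in> carrier G" for h
    using assms that carrier_unitary_group by (auto simp: hom_def)
  have M: "\<rho> (x \<otimes> y) = \<rho> x * \<rho> y" if "x \<in> carrier G" "y \<in> carrier G" for x y
    using assms that by (auto simp: hom_def)
  note D = isometricD[OF I] isometric_right_inverse[OF I]
  \<comment> \<open>A unitary idempotent is the identity.\<close>
  have one: "\<rho> \<one> = 1\<^sub>m n"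
  proof -
    have "\<rho> \<one> * \<rho> \<one> = \<rho> \<one>" using M[of \<one> \<one>] by simp
    then have "mat_adjoint (\<rho> \<one>) * (\<rho> \<one> * \<rho> \<one>) = 1\<^sub>m n" using D(3)[of \<one>] by simp
    moreover have "mat_adjoint (\<rho> \<one>) * (\<rho> \<one> * \<rho> \<one>) = mat_adjoint (\<rho> \<one>) * \<rho> \<one> * \<rho> \<one>"
      using D(1)[of \<one>] by (subst mat_assoc) auto
    ultimately show ?thesis using D[of \<one>] by (simp add: mat_one_left)
  qed
  show "\<rho> (inv h) = mat_adjoint (\<rho> h)" if h: "h \<in> carrier G"
  proof -
    have "\<rho> h * \<rho> (inv h) = 1\<^sub>m n" using M[of h "inv h"] h one by simp
    then have "mat_adjoint (\<rho> h) * (\<rho> h * \<rho> (inv h)) = mat_adjoint (\<rho> h)"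
      using D(1)[OF h] by (simp add: mat_one_right)
    moreover have "mat_adjoint (\<rho> h) * (\<rho> h * \<rho> (inv h)) = mat_adjoint (\<rho> h) * \<rho> h * \<rho> (inv h)"
      using D(1)[OF h] D(1)[of "inv h"] h by (subst mat_assoc) auto
    ultimately show ?thesis using D(3)[OF h] D(1)[of "inv h"] h by (simp add: mat_one_left)
  qed
  show "rep_dim G \<rho> = n" by (simp add: rep_dim_def one)
  show "unitary_rep G \<rho>" using assms by (auto simp: unitary_rep_def)
  show "h \<in> carrier G \<Longrightarrow> dim_row (\<rho> h) = n" "h \<in> carrier G \<Longrightarrow> dim_col (\<rho> h) = n"
    using D(1) by auto
  show "h \<in> carrier G \<Longrightarrow> \<rho> h \<in> carrier_mat n n" by (rule D(1))
  show "h \<in> carrier G \<Longrightarrow> isometric n n (\<rho> h)" by (rule I)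
  show "h \<in> carrier G \<Longrightarrow> \<rho> h * mat_adjoint (\<rho> h) = 1\<^sub>m n" by (rule D(4))
  show "h \<in> carrier G \<Longrightarrow> mat_adjoint (\<rho> h) * \<rho> h = 1\<^sub>m n" by (rule D(3))
  show "x \<in> carrier G \<Longrightarrow> y \<in> carrier G \<Longrightarrow> \<rho> (x \<otimes> y) = \<rho> x * \<rho> y" by (rule M)
  show "\<rho> \<one> = 1\<^sub>m n" by (rule one)
qed

lemma unitary_rep_hom: "unitary_rep G \<rho> \<Longrightarrow> \<rho> \<in> hom G (unitary_group (rep_dim G \<rho>))"
  by (auto simp: unitary_rep_def unitary_homD(9))

lemma irreducible_iff:
  assumes "\<rho> \<in> hom G (unitary_group n)"
  shows "irreducible_rep G \<rho> \<longleftrightarrow> n > 0 \<and> (\<forall>W. lin_subspace n W \<and>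
      (\<forall>h\<in>carrier G. \<forall>w\<in>W. \<rho> h *\<^sub>v w \<in> W) \<longrightarrow> W = {0\<^sub>v n} \<or> W = carrier_vec n)"
  unfolding irreducible_rep_def subspace_iff_lin_subspace
  using unitary_homD(9,10)[OF assms] by simp

text \<open>The range of \<open>E\<close> is an invariant subspace, hence zero or everything. If it
  is zero, then \<open>E = 0\<close>, which has orthonormal columns only when there are none;
  otherwise the adjoint of \<open>E\<close> is isometric as well, and \<open>isometric_le\<close>
  applies in both directions.\<close>

lemma irreducible_isometric:
  assumes \<rho>: "\<rho> \<in> hom G (unitary_group n)" and irr: "irreducible_rep G \<rho>" and E: "isometric n s E"
    and inv: "\<And>h. h \<in> carrier G \<Longrightarrow> \<exists>M\<in>carrier_mat s s. \<rho> h * E = E * M"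
  shows "s = 0 \<or> s = n"
proof -
  note Ec = isometricD[OF E]
  define W where "W = {E *\<^sub>v x | x. x \<in> carrier_vec s}"
  have "lin_subspace n W"
    unfolding lin_subspace_def
  proof (intro conjI ballI allI)
    show "W \<subseteq> carrier_vec n" using Ec(1) by (auto simp: W_def)
    show "0\<^sub>v n \<in> W" unfolding W_def using Ec(1) by (intro CollectI exI[of _ "0\<^sub>v s"]) auto
    show "v + w \<in> W" if vw: "v \<in> W" "w \<in> W" for v w
    proof -
      obtain x y where "v = E *\<^sub>v x" "w = E *\<^sub>v y" "x \<in> carrier_vec s" "y \<in> carrier_vec s"
        using vw by (auto simp: W_def)
      then show ?thesis unfolding W_def
        by (intro CollectI exI[of _ "x + y"]) (auto simp: mult_add_distrib_mat_vec[OF Ec(1)])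
    qed
    show "c \<cdot>\<^sub>v v \<in> W" if v: "v \<in> W" for v c
    proof -
      obtain x where "v = E *\<^sub>v x" "x \<in> carrier_vec s" using v by (auto simp: W_def)
      then show ?thesis unfolding W_def
        by (intro CollectI exI[of _ "c \<cdot>\<^sub>v x"]) (auto simp: mult_mat_vec[OF Ec(1)])
    qed
  qed
  moreover have "\<rho> h *\<^sub>v w \<in> W" if h: "h \<in> carrier G" and w: "w \<in> W" for h w
  proof -
    obtain x where x: "w = E *\<^sub>v x" "x \<in> carrier_vec s" using w by (auto simp: W_def)
    obtain M where M: "M \<in> carrier_mat s s" "\<rho> h * E = E * M" using inv[OF h] by blast
    have "\<rho> h *\<^sub>v w = E *\<^sub>v (M *\<^sub>v x)"
    proof -
      have "\<rho> h *\<^sub>v w = \<rho> h * E *\<^sub>v x" using x Ec(1) unitary_homD(1)[OF \<rho> h] by (simp add: mat_vec_assoc)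
      then show ?thesis using x Ec(1) M by (simp add: mat_vec_assoc)
    qed
    then show ?thesis using M(1) x(2) by (auto simp: W_def)
  qed
  ultimately consider "W = {0\<^sub>v n}" | "W = carrier_vec n"
    using irr irreducible_iff[OF \<rho>] by blast
  then show ?thesis
  proof cases
    case 1
    have "E = 0\<^sub>m n s"
    proof (rule mat_eq_by_vec[OF Ec(1)])
      fix v :: "complex vec" assume "v \<in> carrier_vec s"
      moreover from this have "E *\<^sub>v v \<in> W" by (auto simp: W_def)
      ultimately show "E *\<^sub>v v = 0\<^sub>m n s *\<^sub>v v" using 1 by (auto simp: scalar_prod_def intro!: eq_vecI)
    qed simp
    then have "mat_adjoint E * E = 0\<^sub>m s s" using Ec(2) by simp
    then have 0: "1\<^sub>m s = (0\<^sub>m s s :: complex mat)" using Ec(3) by simp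
    have "s = 0"
    proof (rule ccontr)
      assume "s \<noteq> 0"
      then show False using arg_cong[OF 0, of "\<lambda>A. A $$ (0, 0)"] by simp
    qed
    then show ?thesis ..
  next
    case 2
    have "E * mat_adjoint E = 1\<^sub>m n"
    proof (rule mat_eq_by_vec[of _ n n])
      fix v :: "complex vec" assume "v \<in> carrier_vec n"
      then obtain x where x: "v = E *\<^sub>v x" "x \<in> carrier_vec s" using 2 by (auto simp: W_def)
      have "E * mat_adjoint E *\<^sub>v v = E *\<^sub>v (mat_adjoint E * E *\<^sub>v x)"
        using x Ec(1) by (simp add: mat_vec_assoc)
      moreover have "\<dots> = 1\<^sub>m n *\<^sub>v v" using Ec x by simp
      ultimately show "E * mat_adjoint E *\<^sub>v v = 1\<^sub>m n *\<^sub>v v" by simp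
    qed (use Ec in auto)
    then have "isometric s n (mat_adjoint E)" using Ec(2) by (simp add: isometric_def)
    then show ?thesis using isometric_le[OF E] isometric_le[of s n "mat_adjoint E"] by simp
  qed
qed

text \<open>Converse of \<open>irreducible_isometric\<close>: an invariant subspace is the range of
  some \<open>E\<close>, and the required \<open>M\<close> is the compression of the operator by
  \<open>E\<close>, because projecting to the range fixes vectors already in it.\<close>

lemma irreducibleI_isometric:
  assumes \<rho>: "\<rho> \<in> hom G (unitary_group n)" and n: "n > 0"
    and inv: "\<And>s E. isometric n s E \<Longrightarrow> \<forall>h\<in>carrier G. \<exists>M\<in>carrier_mat s s. \<rho> h * E = E * M
      \<Longrightarrow> s = 0 \<or> s = n"
  shows "irreducible_rep G \<rho>"
  unfolding irreducible_iff[OF \<rho>]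
proof (intro conjI n allI impI, elim conjE)
  fix W assume W: "lin_subspace n W" and Winv: "\<forall>h\<in>carrier G. \<forall>w\<in>W. \<rho> h *\<^sub>v w \<in> W"
  obtain s E where E: "isometric n s E" and WE: "W = {E *\<^sub>v x | x. x \<in> carrier_vec s}"
    by (rule lin_subspace_range_isometric[OF W])
  note Ec = isometricD[OF E]
  have proj: "E *\<^sub>v (mat_adjoint E *\<^sub>v w) = w" if w: "w \<in> W" for w
  proof -
    obtain x where x: "w = E *\<^sub>v x" "x \<in> carrier_vec s" using w WE by auto
    have "mat_adjoint E *\<^sub>v w = mat_adjoint E * E *\<^sub>v x" using x Ec(1) by (simp add: mat_vec_assoc)
    then show ?thesis using x Ec(3) by simp
  qed
  have "\<forall>h\<in>carrier G. \<exists>M\<in>carrier_mat s s. \<rho> h * E = E * M"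
  proof
    fix h assume h: "h \<in> carrier G"
    note r = unitary_homD(1)[OF \<rho> h]
    have "\<rho> h * E = E * (mat_adjoint E * (\<rho> h * E))"
    proof (rule mat_eq_by_vec[of _ n s])
      fix v :: "complex vec" assume v: "v \<in> carrier_vec s"
      have "\<rho> h *\<^sub>v (E *\<^sub>v v) \<in> W" using Winv h v WE by auto
      from proj[OF this]
      show "\<rho> h * E *\<^sub>v v = E * (mat_adjoint E * (\<rho> h * E)) *\<^sub>v v"
        using v r Ec(1) by (simp add: mat_vec_assoc)
    qed (use r Ec in auto)
    moreover have "mat_adjoint E * (\<rho> h * E) \<in> carrier_mat s s" using Ec r by auto
    ultimately show "\<exists>M\<in>carrier_mat s s. \<rho> h * E = E * M" by blast
  qed
  from inv[OF E this] show "W = {0\<^sub>v n} \<or> W = carrier_vec n"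
  proof
    assume s: "s = 0"
    have "E *\<^sub>v x = 0\<^sub>v n" if "x \<in> carrier_vec s" for x
      using that s Ec(1) by (intro eq_vecI) (auto simp: scalar_prod_def)
    then have "w = 0\<^sub>v n" if "w \<in> W" for w using that unfolding WE by blast
    then show ?thesis using lin_subspaceD(2)[OF W] by blast
  next
    assume s: "s = n"
    have "v \<in> W" if v: "v \<in> carrier_vec n" for v
    proof -
      have "E *\<^sub>v (mat_adjoint E *\<^sub>v v) = v"
        using isometric_right_inverse[of n E] E s v Ec(1) by (simp flip: mat_vec_assoc)
      moreover have "mat_adjoint E *\<^sub>v v \<in> carrier_vec s" using v Ec(2) s by (intro mult_mat_vec_carrier) auto
      ultimately show ?thesis unfolding WE by (intro CollectI exI[of _ "mat_adjoint E *\<^sub>v v"]) simp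
    qed
    then show ?thesis using lin_subspaceD(1)[OF W] by blast
  qed
qed

text \<open>Over the complex numbers \<open>X\<close> has an eigenvalue, and its eigenspace is
  invariant because \<open>X\<close> commutes with the representation; being nonzero, it is
  everything.\<close>

lemma schur_scalar:
  assumes \<rho>: "\<rho> \<in> hom G (unitary_group n)" and irr: "irreducible_rep G \<rho>"
    and X: "X \<in> carrier_mat n n" and comm: "\<And>h. h \<in> carrier G \<Longrightarrow> \<rho> h * X = X * \<rho> h"
  obtains c where "X = c \<cdot>\<^sub>m 1\<^sub>m n"
proof -
  have n: "n > 0" using irr irreducible_iff[OF \<rho>] by blast
  obtain c where "eigenvalue X c" using spectrum_non_empty[OF X n] by (auto simp: spectrum_def)
  then obtain v where v: "v \<in> carrier_vec n" "v \<noteq> 0\<^sub>v n" "X *\<^sub>v v = c \<cdot>\<^sub>v v"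
    using X by (auto simp: eigenvalue_def eigenvector_def)
  define W where "W = {w \<in> carrier_vec n. X *\<^sub>v w = c \<cdot>\<^sub>v w}"
  have "lin_subspace n W"
    using X by (auto simp: lin_subspace_def W_def mult_add_distrib_mat_vec[OF X] mult_mat_vec[OF X]
        smult_add_distrib_vec smult_smult_assoc mult.commute)
  moreover have "\<forall>h\<in>carrier G. \<forall>w\<in>W. \<rho> h *\<^sub>v w \<in> W"
  proof (intro ballI)
    fix h w assume h: "h \<in> carrier G" and w: "w \<in> W"
    note r = unitary_homD(1)[OF \<rho> h]
    have wc: "w \<in> carrier_vec n" and Xw: "X *\<^sub>v w = c \<cdot>\<^sub>v w" using w by (auto simp: W_def)
    have "X *\<^sub>v (\<rho> h *\<^sub>v w) = \<rho> h *\<^sub>v (X *\<^sub>v w)"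
      using comm[OF h] assoc_mult_mat_vec[OF X r wc] assoc_mult_mat_vec[OF r X wc] by simp
    also have "\<dots> = c \<cdot>\<^sub>v (\<rho> h *\<^sub>v w)" unfolding Xw by (rule mult_mat_vec[OF r wc])
    finally show "\<rho> h *\<^sub>v w \<in> W" using r wc by (simp add: W_def)
  qed
  ultimately have "W = {0\<^sub>v n} \<or> W = carrier_vec n" using irr irreducible_iff[OF \<rho>] by blast
  moreover have "v \<in> W" using v by (simp add: W_def)
  ultimately have W: "W = carrier_vec n" using v(2) by auto
  have "X = c \<cdot>\<^sub>m 1\<^sub>m n"
    by (rule mat_eq_by_vec[OF X]) (use W in \<open>auto simp: W_def smult_mat_vec\<close>)
  then show ?thesis by (rule that)
qed

lemma rep_equivI:
  assumes \<rho>: "\<rho> \<in> hom G (unitary_group n)" and V: "isometric n n V"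
    and \<sigma>: "\<And>h. h \<in> carrier G \<Longrightarrow> \<sigma> h \<in> carrier_mat n n"
    and eq: "\<And>h. h \<in> carrier G \<Longrightarrow> \<rho> h * V = V * \<sigma> h"
  shows "rep_equiv G \<rho> \<sigma>"
  unfolding rep_equiv_def
proof (intro bexI ballI)
  note Vc = isometricD[OF V]
  \<comment> \<open>Intertwiners run in the direction opposite to the conjugating unitary of
    \<open>rep_equiv\<close>, which is therefore the adjoint of \<open>V\<close>.\<close>
  show "mat_adjoint V \<in> carrier (unitary_group (rep_dim G \<rho>))"
    using isometric_adjoint[OF V] by (simp add: unitary_homD(9)[OF \<rho>] carrier_unitary_group)
  fix h assume h: "h \<in> carrier G"
  have "mat_adjoint V * (\<rho> h * V) = (mat_adjoint V * V) * \<sigma> h"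
    unfolding eq[OF h] using Vc(1) \<sigma>[OF h] by (simp add: mat_assoc)
  then show "\<sigma> h = mat_adjoint V * \<rho> h * mat_adjoint (mat_adjoint V)"
    using Vc \<sigma>[OF h] unitary_homD(1)[OF \<rho> h] by (simp add: mat_assoc mat_one_left)
qed

text \<open>The relation constrains only the values of \<open>\<sigma>\<close>; that
  \<open>\<sigma>\<close> is itself a unitary representation of the same dimension follows from the
  conjugation formula and is delivered along with the intertwiner.\<close>

lemma rep_equivE:
  assumes \<rho>: "\<rho> \<in> hom G (unitary_group n)" and eq: "rep_equiv G \<rho> \<sigma>"
  obtains V where "isometric n n V" "\<And>h. h \<in> carrier G \<Longrightarrow> \<sigma> h \<in> carrier_mat n n"
    "\<And>h. h \<in> carrier G \<Longrightarrow> \<rho> h * V = V * \<sigma> h" "\<sigma> \<in> hom G (unitary_group n)"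
proof -
  obtain U where U: "isometric n n U" and \<sigma>: "\<And>h. h \<in> carrier G \<Longrightarrow> \<sigma> h = U * \<rho> h * mat_adjoint U"
    using eq unfolding rep_equiv_def unitary_homD(9)[OF \<rho>] by (auto simp: carrier_unitary_group)
  note Uc = isometricD[OF U]
  have \<sigma>c: "\<sigma> h \<in> carrier_mat n n" if "h \<in> carrier G" for h
    using \<sigma>[OF that] Uc unitary_homD(1)[OF \<rho> that] by auto
  have c: "\<rho> h * mat_adjoint U = mat_adjoint U * \<sigma> h" if h: "h \<in> carrier G" for h
  proof -
    have "mat_adjoint U * \<sigma> h = (mat_adjoint U * U) * (\<rho> h * mat_adjoint U)"
      unfolding \<sigma>[OF h] using Uc(1) unitary_homD(1)[OF \<rho> h] by (simp add: mat_assoc)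
    then show ?thesis using Uc(3) unitary_homD(1)[OF \<rho> h] by (simp add: mat_one_left)
  qed
  have "\<sigma> \<in> hom G (unitary_group n)"
  proof (rule homI)
    fix h assume h: "h \<in> carrier G"
    show "\<sigma> h \<in> carrier (unitary_group n)"
      unfolding \<sigma>[OF h] carrier_unitary_group
      by (intro isometric_mult[of _ n] U isometric_adjoint unitary_homD(4)[OF \<rho> h])
  next
    fix x y assume x: "x \<in> carrier G" and y: "y \<in> carrier G"
    have "\<sigma> x * \<sigma> y = U * \<rho> x * (mat_adjoint U * \<sigma> y)"
      unfolding \<sigma>[OF x] using Uc(1) \<sigma>c[OF y] unitary_homD(1)[OF \<rho> x] by (simp add: mat_assoc)
    also have "\<dots> = U * (\<rho> x * \<rho> y) * mat_adjoint U"
      unfolding c[OF y, symmetric]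
      using Uc(1) unitary_homD(1)[OF \<rho> x] unitary_homD(1)[OF \<rho> y] by (simp add: mat_assoc)
    also have "\<dots> = \<sigma> (x \<otimes> y)" using \<sigma>[of "x \<otimes> y"] unitary_homD(7)[OF \<rho> x y] x y by simp
    finally show "\<sigma> (x \<otimes> y) = \<sigma> x \<otimes>\<^bsub>unitary_group n\<^esub> \<sigma> y" by simp
  qed
  then show ?thesis using that[OF isometric_adjoint[OF U] \<sigma>c c] by blast
qed

lemma rep_equiv_refl: "\<rho> \<in> hom G (unitary_group n) \<Longrightarrow> rep_equiv G \<rho> \<rho>"
  by (rule rep_equivI[of \<rho> n "1\<^sub>m n"])
     (auto simp: isometric_one unitary_homD mat_one_left mat_one_right)

lemma rep_equiv_sym:
  assumes \<rho>: "\<rho> \<in> hom G (unitary_group n)" and eq: "rep_equiv G \<rho> \<sigma>"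
  shows "rep_equiv G \<sigma> \<rho>"
proof -
  obtain V where V: "isometric n n V" "\<And>h. h \<in> carrier G \<Longrightarrow> \<rho> h * V = V * \<sigma> h"
    "\<sigma> \<in> hom G (unitary_group n)" by (rule rep_equivE[OF \<rho> eq]) blast
  note Vc = isometricD[OF V(1)]
  show ?thesis
  proof (rule rep_equivI[OF V(3) isometric_adjoint[OF V(1)]])
    fix h assume h: "h \<in> carrier G"
    note r = unitary_homD(1)[OF \<rho> h] unitary_homD(1)[OF V(3) h]
    have "\<sigma> h * mat_adjoint V = mat_adjoint V * (V * \<sigma> h) * mat_adjoint V"
      using Vc r by (simp flip: mat_assoc add: mat_one_left)
    also have "\<dots> = mat_adjoint V * \<rho> h * (V * mat_adjoint V)"
      unfolding V(2)[OF h, symmetric] using Vc(1) r by (simp add: mat_assoc)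
    finally show "\<sigma> h * mat_adjoint V = mat_adjoint V * \<rho> h"
      using Vc r by (simp add: isometric_right_inverse[OF V(1)] mat_one_right)
  qed (rule unitary_homD(1)[OF \<rho>])
qed

lemma rep_equiv_trans:
  assumes \<rho>: "\<rho> \<in> hom G (unitary_group n)" and eq: "rep_equiv G \<rho> \<sigma>" and eq': "rep_equiv G \<sigma> \<tau>"
  shows "rep_equiv G \<rho> \<tau>"
proof -
  obtain V where V: "isometric n n V" "\<And>h. h \<in> carrier G \<Longrightarrow> \<rho> h * V = V * \<sigma> h"
    "\<sigma> \<in> hom G (unitary_group n)" by (rule rep_equivE[OF \<rho> eq]) blast
  obtain W where W: "isometric n n W" "\<And>h. h \<in> carrier G \<Longrightarrow> \<sigma> h * W = W * \<tau> h"
    "\<tau> \<in> hom G (unitary_group n)" by (rule rep_equivE[OF V(3) eq']) blast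
  show ?thesis
  proof (rule rep_equivI[OF \<rho> isometric_mult[OF V(1) W(1)]])
    fix h assume h: "h \<in> carrier G"
    note r = unitary_homD(1)[OF \<rho> h] unitary_homD(1)[OF V(3) h] unitary_homD(1)[OF W(3) h]
      isometricD(1)[OF V(1)] isometricD(1)[OF W(1)]
    have "\<rho> h * (V * W) = (\<rho> h * V) * W" using r by (simp add: mat_assoc)
    also have "\<dots> = V * (\<sigma> h * W)" unfolding V(2)[OF h] using r by (simp add: mat_assoc)
    also have "\<dots> = V * W * \<tau> h" unfolding W(2)[OF h] using r by (simp add: mat_assoc)
    finally show "\<rho> h * (V * W) = V * W * \<tau> h" .
  qed (rule unitary_homD(1)[OF W(3)])
qed

lemma rep_class_self: "\<rho> \<in> hom G (unitary_group n) \<Longrightarrow> \<rho> \<in> rep_class G \<rho>"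
  by (simp add: rep_class_def rep_equiv_refl unitary_homD(10))

lemma rep_class_mem_hom:
  assumes "\<rho> \<in> hom G (unitary_group n)" "\<sigma> \<in> rep_class G \<rho>"
  shows "\<sigma> \<in> hom G (unitary_group n)" "rep_equiv G \<rho> \<sigma>"
proof -
  show "rep_equiv G \<rho> \<sigma>" using assms by (simp add: rep_class_def)
  from rep_equivE[OF assms(1) this] show "\<sigma> \<in> hom G (unitary_group n)" by blast
qed

text \<open>The dimensions \<open>n\<close> and \<open>m\<close> may be given independently; each
  side forces them to agree, since members of a class share the dimension of its
  representative.\<close>

lemma rep_class_eq_iff:
  assumes \<rho>: "\<rho> \<in> hom G (unitary_group n)" and \<sigma>: "\<sigma> \<in> hom G (unitary_group m)"
  shows "rep_class G \<rho> = rep_class G \<sigma> \<longleftrightarrow> rep_equiv G \<rho> \<sigma>"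
proof
  assume "rep_class G \<rho> = rep_class G \<sigma>"
  then show "rep_equiv G \<rho> \<sigma>" using rep_class_self[OF \<sigma>] by (auto simp: rep_class_def)
next
  assume eq: "rep_equiv G \<rho> \<sigma>"
  show "rep_class G \<rho> = rep_class G \<sigma>"
    using rep_equiv_trans[OF \<rho> eq] rep_equiv_trans[OF \<sigma> rep_equiv_sym[OF \<rho> eq]]
    by (auto simp: rep_class_def)
qed

text \<open>Adjoint of the relation at \<open>inv h\<close>; unitarity replaces the adjoint of the
  value at \<open>inv h\<close> by the value at \<open>h\<close>.\<close>

lemma intertwiner_adjoint:
  assumes \<rho>: "\<rho> \<in> hom G (unitary_group n)" and \<sigma>: "\<sigma> \<in> hom G (unitary_group m)"
    and X: "X \<in> carrier_mat n m" and inter: "\<And>h. h \<in> carrier G \<Longrightarrow> \<rho> h * X = X * \<sigma> h"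
    and h: "h \<in> carrier G"
  shows "mat_adjoint X * \<rho> h = \<sigma> h * mat_adjoint X"
proof -
  have i: "inv h \<in> carrier G" using h by simp
  have "mat_adjoint (\<rho> (inv h) * X) = mat_adjoint (X * \<sigma> (inv h))" using inter[OF i] by simp
  then show ?thesis
    unfolding mat_adjoint_mult[OF unitary_homD(1)[OF \<rho> i] X] mat_adjoint_mult[OF X unitary_homD(1)[OF \<sigma> i]]
    by (simp add: unitary_homD(11)[OF \<rho> h] unitary_homD(11)[OF \<sigma> h])
qed

text \<open>Both products of \<open>X\<close> with its adjoint commute with an irreducible
  representation, so they are scalar. The two scalars coincide and are positive, and dividing
  \<open>X\<close> by the square root of their common value makes it unitary.\<close>

lemma schur_equiv:
  assumes \<rho>: "\<rho> \<in> hom G (unitary_group n)" and irr: "irreducible_rep G \<rho>"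
    and \<sigma>: "\<sigma> \<in> hom G (unitary_group m)" and irr': "irreducible_rep G \<sigma>"
    and X: "X \<in> carrier_mat n m" and X0: "X \<noteq> 0\<^sub>m n m"
    and inter: "\<And>h. h \<in> carrier G \<Longrightarrow> \<rho> h * X = X * \<sigma> h"
  shows "rep_equiv G \<rho> \<sigma>"
proof -
  have inter': "mat_adjoint X * \<rho> h = \<sigma> h * mat_adjoint X" if "h \<in> carrier G" for h
    by (rule intertwiner_adjoint[OF \<rho> \<sigma> X _ that]) (rule inter)
  have Xa: "mat_adjoint X \<in> carrier_mat m n" using X by simp
  have "mat_adjoint X * X \<in> carrier_mat m m" using X Xa by auto
  moreover have "\<sigma> h * (mat_adjoint X * X) = mat_adjoint X * X * \<sigma> h" if h: "h \<in> carrier G" for h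
  proof -
    note r = unitary_homD(1)[OF \<rho> h] unitary_homD(1)[OF \<sigma> h] X Xa
    have "\<sigma> h * (mat_adjoint X * X) = (\<sigma> h * mat_adjoint X) * X" using r by (simp add: mat_assoc)
    also have "\<dots> = mat_adjoint X * (\<rho> h * X)" unfolding inter'[OF h, symmetric] using r by (simp add: mat_assoc)
    finally show ?thesis unfolding inter[OF h] using r by (simp add: mat_assoc)
  qed
  ultimately obtain c where c: "mat_adjoint X * X = c \<cdot>\<^sub>m 1\<^sub>m m" using schur_scalar[OF \<sigma> irr'] by blast
  have "X * mat_adjoint X \<in> carrier_mat n n" using X Xa by auto
  moreover have "\<rho> h * (X * mat_adjoint X) = X * mat_adjoint X * \<rho> h" if h: "h \<in> carrier G" for h
  proof -
    note r = unitary_homD(1)[OF \<rho> h] unitary_homD(1)[OF \<sigma> h] X Xa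
    have "\<rho> h * (X * mat_adjoint X) = (\<rho> h * X) * mat_adjoint X" using r by (simp add: mat_assoc)
    also have "\<dots> = X * (\<sigma> h * mat_adjoint X)" unfolding inter[OF h] using r by (simp add: mat_assoc)
    finally show ?thesis unfolding inter'[OF h, symmetric] using r by (simp add: mat_assoc)
  qed
  ultimately obtain c' where c': "X * mat_adjoint X = c' \<cdot>\<^sub>m 1\<^sub>m n" using schur_scalar[OF \<rho> irr] by blast
  have m: "m > 0" using irr' irreducible_iff[OF \<sigma>] by blast
  have c0: "c \<noteq> 0"
  proof
    assume "c = 0"
    then have "mat_adjoint X * X = 0\<^sub>m m m" using c by auto
    then show False using adjoint_self_mult_eq_0[OF X] X0 by blast
  qed
  \<comment> \<open>Associativity of the product of \<open>X\<close>, its adjoint and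
    \<open>X\<close> compares the two scalars.\<close>
  have "c' \<cdot>\<^sub>m X = c \<cdot>\<^sub>m X"
  proof -
    have "(X * mat_adjoint X) * X = X * (mat_adjoint X * X)" using X by (simp add: mat_assoc)
    then show ?thesis unfolding c c' using X by (simp add: mat_smult_left mat_smult_right mat_one_left mat_one_right)
  qed
  obtain i j where ij: "i < n" "j < m" "X $$ (i, j) \<noteq> 0"
    using X0 X eq_matI[of X "0\<^sub>m n m"] by auto
  have "c' * X $$ (i, j) = c * X $$ (i, j)"
    using arg_cong[OF \<open>c' \<cdot>\<^sub>m X = c \<cdot>\<^sub>m X\<close>, of "\<lambda>A. A $$ (i, j)"] ij X by simp
  then have cc: "c' = c" using ij by simp
  \<comment> \<open>The squared norm of the first column, which exhibits \<open>c\<close> as a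
    nonnegative real number.\<close>
  define r where "r = (\<Sum>t<n. (cmod (X $$ (t, 0)))\<^sup>2)"
  have cr: "c = complex_of_real r"
  proof -
    have "c = (\<Sum>t<n. cnj (X $$ (t, 0)) * X $$ (t, 0))"
      using mat_adjoint_mult_index[OF X X, of 0 0] m c by simp
    also have "\<dots> = (\<Sum>t<n. complex_of_real ((cmod (X $$ (t, 0)))\<^sup>2))"
      by (rule sum.cong) (use complex_norm_square in \<open>auto simp: mult.commute\<close>)
    finally show ?thesis by (simp add: r_def)
  qed
  have "r \<ge> 0" unfolding r_def by (rule sum_nonneg) simp
  moreover have "r \<noteq> 0" using cr c0 by auto
  ultimately have r0: "r > 0" by simp
  define b where "b = complex_of_real (1 / sqrt r)"
  have b: "cnj b * b * c = 1" using r0 by (simp add: b_def cr flip: of_real_mult)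
  define V where "V = b \<cdot>\<^sub>m X"
  have V: "V \<in> carrier_mat n m" using X by (simp add: V_def)
  have "mat_adjoint V * V = (cnj b * b * c) \<cdot>\<^sub>m 1\<^sub>m m"
    unfolding V_def mat_adjoint_smult using X c
    by (simp add: mat_smult_left mat_smult_right mat_smult_smult) (simp add: ac_simps)
  then have V1: "isometric n m V" using V b by (auto simp: isometric_def)
  have "V * mat_adjoint V = (b * cnj b * c) \<cdot>\<^sub>m 1\<^sub>m n"
    unfolding V_def mat_adjoint_smult using X c' cc
    by (simp add: mat_smult_left mat_smult_right mat_smult_smult) (simp add: ac_simps)
  then have "isometric m n (mat_adjoint V)" using V b by (auto simp: isometric_def mult.commute)
  then have nm: "n = m" using isometric_le V1 by (metis le_antisym)
  show ?thesis
  proof (rule rep_equivI[OF \<rho>])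
    show "isometric n n V" using V1 nm by simp
    fix h assume h: "h \<in> carrier G"
    show "\<sigma> h \<in> carrier_mat n n" using unitary_homD(1)[OF \<sigma> h] nm by simp
    show "\<rho> h * V = V * \<sigma> h"
      unfolding V_def using X inter[OF h] unitary_homD(1)[OF \<sigma> h] unitary_homD(1)[OF \<rho> h]
      by (simp add: mat_smult_left mat_smult_right)
  qed
qed

end

section \<open>Induced representations\<close>

text \<open>Juxtaposes the \<open>l\<close> blocks \<open>F 0\<close>, \<open>F 1\<close> and so on,
  each with \<open>s\<close> columns; the splitting of a column index by \<open>div\<close> and
  \<open>mod\<close> matches that of \<open>induced_rep\<close>.\<close>

definition frame_mat :: "nat \<Rightarrow> nat \<Rightarrow> nat \<Rightarrow> (nat \<Rightarrow> complex mat) \<Rightarrow> complex mat" where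
  "frame_mat N l s F = mat N (l * s) (\<lambda>(i, j). F (j div s) $$ (i, j mod s))"

lemma frame_mat_carrier [simp]: "frame_mat N l s F \<in> carrier_mat N (l * s)"
  by (simp add: frame_mat_def)

lemma div_mod_bounds:
  assumes "i < l * (s :: nat)"
  shows "i div s < l" "i mod s < s"
  using assms by (auto simp: less_mult_imp_div_less intro!: mod_less_divisor gr0I)

lemma frame_mat_adjoint_mult_index:
  assumes "\<And>p. p < l \<Longrightarrow> F p \<in> carrier_mat N s" "M \<in> carrier_mat N k" "i < l * s" "j < k"
  shows "(mat_adjoint (frame_mat N l s F) * M) $$ (i, j) = (mat_adjoint (F (i div s)) * M) $$ (i mod s, j)"
proof -
  note b = div_mod_bounds[OF assms(3)]
  have "(mat_adjoint (frame_mat N l s F) * M) $$ (i, j) =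
      (\<Sum>t<N. cnj (frame_mat N l s F $$ (t, i)) * M $$ (t, j))"
    by (rule mat_adjoint_mult_index[OF frame_mat_carrier assms(2-4)])
  also have "\<dots> = (\<Sum>t<N. cnj (F (i div s) $$ (t, i mod s)) * M $$ (t, j))"
    by (rule sum.cong) (use assms(3) in \<open>auto simp: frame_mat_def\<close>)
  also have "\<dots> = (mat_adjoint (F (i div s)) * M) $$ (i mod s, j)"
    by (rule mat_adjoint_mult_index[OF assms(1)[OF b(1)] assms(2) b(2) assms(4), symmetric])
  finally show ?thesis .
qed

lemma isometric_frame_mat:
  assumes F: "\<And>p. p < l \<Longrightarrow> F p \<in> carrier_mat N s"
    and orth: "\<And>p q. p < l \<Longrightarrow> q < l \<Longrightarrow> mat_adjoint (F p) * F q = (if p = q then 1\<^sub>m s else 0\<^sub>m s s)"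
  shows "isometric N (l * s) (frame_mat N l s F)"
  unfolding isometric_def
proof (intro conjI eq_matI)
  fix i j assume "i < dim_row (1\<^sub>m (l * s) :: complex mat)" "j < dim_col (1\<^sub>m (l * s) :: complex mat)"
  then have ij: "i < l * s" "j < l * s" by auto
  note b = div_mod_bounds[OF ij(1)] div_mod_bounds[OF ij(2)]
  have "(mat_adjoint (frame_mat N l s F) * frame_mat N l s F) $$ (i, j) =
      (mat_adjoint (F (i div s)) * frame_mat N l s F) $$ (i mod s, j)"
    by (rule frame_mat_adjoint_mult_index[OF F frame_mat_carrier ij])
  also have "\<dots> = (mat_adjoint (F (i div s)) * F (j div s)) $$ (i mod s, j mod s)"
    using b ij mat_adjoint_mult_index[OF F frame_mat_carrier] mat_adjoint_mult_index[OF F F]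
    by (simp add: frame_mat_def)
  also have "\<dots> = (if i div s = j div s \<and> i mod s = j mod s then 1 else 0)"
    using orth[of "i div s" "j div s"] b by simp
  also have "i div s = j div s \<and> i mod s = j mod s \<longleftrightarrow> i = j" by (metis div_mult_mod_eq)
  finally show "(mat_adjoint (frame_mat N l s F) * frame_mat N l s F) $$ (i, j) = 1\<^sub>m (l * s) $$ (i, j)"
    using ij by simp
qed (auto simp: frame_mat_def)

text \<open>With \<open>N = l * s\<close> the juxtaposed blocks form a square isometric matrix,
  hence a unitary one: being orthogonal to all blocks means being zero.\<close>

lemma frame_complete:
  fixes F :: "nat \<Rightarrow> complex mat"
  assumes F: "\<And>p. p < l \<Longrightarrow> F p \<in> carrier_mat N s"
    and orth: "\<And>p q. p < l \<Longrightarrow> q < l \<Longrightarrow> mat_adjoint (F p) * F q = (if p = q then 1\<^sub>m s else 0\<^sub>m s s)"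
    and N: "N = l * s" and M: "M \<in> carrier_mat N k"
    and zero: "\<And>p. p < l \<Longrightarrow> mat_adjoint (F p) * M = 0\<^sub>m s k"
  shows "M = 0\<^sub>m N k"
proof -
  let ?U = "frame_mat N l s F"
  have U: "isometric N N ?U" using isometric_frame_mat[OF F orth] N by simp
  have "mat_adjoint ?U * M = 0\<^sub>m N k"
  proof (rule eq_matI)
    fix i j assume "i < dim_row (0\<^sub>m N k :: complex mat)" "j < dim_col (0\<^sub>m N k :: complex mat)"
    then have ij: "i < l * s" "j < k" using N by auto
    show "(mat_adjoint ?U * M) $$ (i, j) = 0\<^sub>m N k $$ (i, j)"
      using frame_mat_adjoint_mult_index[OF F M ij] zero div_mod_bounds[OF ij(1)] ij N by simp
  qed (use M N in \<open>auto simp: frame_mat_def\<close>)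
  then have "?U * (mat_adjoint ?U * M) = 0\<^sub>m N k" using isometricD(1)[OF U] by simp
  then show ?thesis
    using isometricD[OF U] isometric_right_inverse[OF U] M by (simp flip: mat_assoc add: mat_one_left)
qed

lemma frame_complete_vec:
  fixes F :: "nat \<Rightarrow> complex mat"
  assumes F: "\<And>p. p < l \<Longrightarrow> F p \<in> carrier_mat N s"
    and orth: "\<And>p q. p < l \<Longrightarrow> q < l \<Longrightarrow> mat_adjoint (F p) * F q = (if p = q then 1\<^sub>m s else 0\<^sub>m s s)"
    and N: "N = l * s" and v: "v \<in> carrier_vec N"
    and zero: "\<And>p. p < l \<Longrightarrow> mat_adjoint (F p) *\<^sub>v v = 0\<^sub>v s"
  shows "v = 0\<^sub>v N"
proof -
  define M where "M = mat N 1 (\<lambda>(i, j). v $ i)"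
  have M: "M \<in> carrier_mat N 1" by (simp add: M_def)
  have "mat_adjoint (F p) * M = 0\<^sub>m s 1" if p: "p < l" for p
  proof (rule eq_matI)
    fix i j assume ij: "i < dim_row (0\<^sub>m s 1 :: complex mat)" "j < dim_col (0\<^sub>m s 1 :: complex mat)"
    have "(mat_adjoint (F p) * M) $$ (i, j) = (mat_adjoint (F p) *\<^sub>v v) $ i"
      using ij mat_mult_index_sum[of "mat_adjoint (F p)" s N M 1 i j]
        mat_vec_index_sum[of "mat_adjoint (F p)" s N v i] v M F[OF p] by (simp add: M_def)
    then show "(mat_adjoint (F p) * M) $$ (i, j) = 0\<^sub>m s 1 $$ (i, j)" using zero[OF p] ij by simp
  qed (use M F[OF p] in auto)
  with F orth N M have "M = 0\<^sub>m N 1" by (rule frame_complete)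
  then have "M $$ (i, 0) = 0" if "i < N" for i using that by simp
  then show ?thesis using v by (intro eq_vecI) (auto simp: M_def simp del: One_nat_def)
qed

text \<open>A choice-free form of induction: \<open>\<sigma>\<close> occurs in the restriction of
  \<open>\<rho>\<close> on the range of \<open>E\<close>, and elements outside \<open>K\<close> move
  this range to an orthogonal one. When moreover \<open>N\<close> is the index times
  \<open>s\<close>, this makes \<open>\<rho>\<close> equivalent to the induced representation, see
  \<open>induced_rep_equiv\<close>.\<close>

definition induced_via ::
  "('a, 'b) monoid_scheme \<Rightarrow> 'a set \<Rightarrow> nat \<Rightarrow> ('a \<Rightarrow> complex mat) \<Rightarrow> nat \<Rightarrow> ('a \<Rightarrow> complex mat) \<Rightarrow>
     complex mat \<Rightarrow> bool" where
  "induced_via H K s \<sigma> N \<rho> E \<longleftrightarrow> isometric N s E \<and> (\<forall>k\<in>K. \<rho> k * E = E * \<sigma> k) \<and>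
     (\<forall>h\<in>carrier H - K. mat_adjoint E * (\<rho> h * E) = 0\<^sub>m s s)"

definition conj_rep :: "('a, 'b) monoid_scheme \<Rightarrow> 'a \<Rightarrow> ('a \<Rightarrow> complex mat) \<Rightarrow> 'a \<Rightarrow> complex mat" where
  "conj_rep H g \<sigma> = (\<lambda>n. \<sigma> (inv\<^bsub>H\<^esub> g \<otimes>\<^bsub>H\<^esub> n \<otimes>\<^bsub>H\<^esub> g))"

section \<open>Cosets of a normal subgroup and the behaviour of induction under changes of
  data\<close>

locale normal_subgroup = group G for G (structure) +
  fixes K :: "'a set"
  assumes normal: "K \<lhd> G"
begin

abbreviation "GK \<equiv> G\<lparr>carrier := K\<rparr>"

lemma K_subgroup: "subgroup K G" using normal by (simp add: normal_def)

sublocale K: group GK by (rule subgroup_imp_group[OF K_subgroup])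

lemma K_mem [simp]: "k \<in> K \<Longrightarrow> k \<in> carrier G"
  using subgroup.mem_carrier[OF K_subgroup] .

lemma K_closed [simp]: "x \<in> K \<Longrightarrow> y \<in> K \<Longrightarrow> x \<otimes> y \<in> K" "x \<in> K \<Longrightarrow> inv x \<in> K" "\<one> \<in> K"
  using subgroup.m_closed[OF K_subgroup] subgroup.m_inv_closed[OF K_subgroup] subgroup.one_closed[OF K_subgroup]
  by auto

lemma inv_cancel [simp]:
  "x \<in> carrier G \<Longrightarrow> y \<in> carrier G \<Longrightarrow> x \<otimes> (inv x \<otimes> y) = y"
  "x \<in> carrier G \<Longrightarrow> y \<in> carrier G \<Longrightarrow> inv x \<otimes> (x \<otimes> y) = y"
  by (simp_all flip: m_assoc)

lemma K_conj: "g \<in> carrier G \<Longrightarrow> k \<in> K \<Longrightarrow> g \<otimes> k \<otimes> inv g \<in> K"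
  using normal by (simp add: normal_inv_iff)

lemma K_conj': "g \<in> carrier G \<Longrightarrow> k \<in> K \<Longrightarrow> inv g \<otimes> k \<otimes> g \<in> K"
  using K_conj[of "inv g" k] by simp

lemma K_conj_iff: "g \<in> carrier G \<Longrightarrow> x \<in> carrier G \<Longrightarrow> inv g \<otimes> x \<otimes> g \<in> K \<longleftrightarrow> x \<in> K"
  using K_conj[of g "inv g \<otimes> x \<otimes> g"] K_conj'[of g x]
  by (auto simp: m_assoc)

lemma mem_coset_iff:
  assumes "r \<in> carrier G" "h \<in> carrier G"
  shows "h \<in> r <# K \<longleftrightarrow> inv r \<otimes> h \<in> K"
proof
  assume "h \<in> r <# K"
  then obtain k where "k \<in> K" "h = r \<otimes> k" by (auto simp: l_coset_def)
  then show "inv r \<otimes> h \<in> K" using assms by simp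
next
  assume "inv r \<otimes> h \<in> K"
  moreover have "h = r \<otimes> (inv r \<otimes> h)" using assms by simp
  ultimately show "h \<in> r <# K" by (auto simp: l_coset_def)
qed

lemma transversal_mem: "left_transversal G K rs \<Longrightarrow> p < length rs \<Longrightarrow> rs ! p \<in> carrier G"
  using nth_mem[of p rs] by (auto simp: left_transversal_def)

lemma transversal_ex1:
  assumes "left_transversal G K rs" "h \<in> carrier G"
  shows "\<exists>!p. p < length rs \<and> inv (rs ! p) \<otimes> h \<in> K"
proof -
  have "(p < length rs \<and> h \<in> rs ! p <# K) = (p < length rs \<and> inv (rs ! p) \<otimes> h \<in> K)" for p
    using mem_coset_iff[OF transversal_mem[OF assms(1)] assms(2)] by blast
  moreover have "\<exists>!p. p < length rs \<and> h \<in> rs ! p <# K"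
    using assms unfolding left_transversal_def by blast
  ultimately show ?thesis by simp
qed

lemma transversal_diff_iff:
  assumes rs: "left_transversal G K rs" and p: "p < length rs" and q: "q < length rs"
  shows "inv (rs ! p) \<otimes> rs ! q \<in> K \<longleftrightarrow> p = q"
proof
  have "inv (rs ! q) \<otimes> rs ! q \<in> K" using transversal_mem[OF rs q] by simp
  then show "p = q" if "inv (rs ! p) \<otimes> rs ! q \<in> K"
    using transversal_ex1[OF rs transversal_mem[OF rs q]] that p q by blast
  show "inv (rs ! p) \<otimes> rs ! q \<in> K" if "p = q" using transversal_mem[OF rs q] that by simp
qed

text \<open>Sending a representative to the position of its coset in the other list is injective.
  Used in both directions, this makes the index independent of the transversal.\<close>

lemma transversal_length_le:
  assumes rs: "left_transversal G K rs" and rs': "left_transversal G K rs'"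
  shows "length rs \<le> length rs'"
proof -
  have "\<exists>p'. p' < length rs' \<and> inv (rs' ! p') \<otimes> rs ! p \<in> K" if "p < length rs" for p
    using transversal_ex1[OF rs' transversal_mem[OF rs that]] by blast
  then obtain f where f: "\<And>p. p < length rs \<Longrightarrow> f p < length rs' \<and> inv (rs' ! f p) \<otimes> rs ! p \<in> K"
    by metis
  have "inj_on f {..<length rs}"
  proof (rule inj_onI)
    fix p q assume pq: "p \<in> {..<length rs}" "q \<in> {..<length rs}" "f p = f q"
    then have c: "rs ! p \<in> carrier G" "rs ! q \<in> carrier G" "rs' ! f p \<in> carrier G"
      using transversal_mem[OF rs] transversal_mem[OF rs'] f by auto
    have a: "inv (rs' ! f p) \<otimes> rs ! p \<in> K" "inv (rs' ! f p) \<otimes> rs ! q \<in> K"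
      using f[of p] f[of q] pq by auto
    have "inv (inv (rs' ! f p) \<otimes> rs ! p) \<otimes> (inv (rs' ! f p) \<otimes> rs ! q) \<in> K"
      by (rule K_closed(1)[OF K_closed(2)[OF a(1)] a(2)])
    also have "inv (inv (rs' ! f p) \<otimes> rs ! p) \<otimes> (inv (rs' ! f p) \<otimes> rs ! q) = inv (rs ! p) \<otimes> rs ! q"
      using c by (simp add: inv_mult_group m_assoc)
    finally show "p = q" using transversal_diff_iff[OF rs] pq by simp
  qed
  moreover have "f ` {..<length rs} \<subseteq> {..<length rs'}" using f by auto
  ultimately show ?thesis using card_inj_on_le[of f "{..<length rs}" "{..<length rs'}"] by simp
qed

lemma conj_rep_hom:
  assumes \<sigma>: "\<sigma> \<in> hom GK (unitary_group s)" and g: "g \<in> carrier G"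
  shows "conj_rep G g \<sigma> \<in> hom GK (unitary_group s)"
proof (rule homI)
  fix k assume k: "k \<in> carrier GK"
  show "conj_rep G g \<sigma> k \<in> carrier (unitary_group s)"
    using K_conj'[OF g, of k] k hom_in_carrier[OF \<sigma>, of "inv g \<otimes> k \<otimes> g"] by (simp add: conj_rep_def)
next
  fix x y assume xy: "x \<in> carrier GK" "y \<in> carrier GK"
  have "inv g \<otimes> (x \<otimes> y) \<otimes> g = (inv g \<otimes> x \<otimes> g) \<otimes> (inv g \<otimes> y \<otimes> g)"
    using xy g by (simp add: m_assoc)
  then show "conj_rep G g \<sigma> (x \<otimes>\<^bsub>GK\<^esub> y) = conj_rep G g \<sigma> x \<otimes>\<^bsub>unitary_group s\<^esub> conj_rep G g \<sigma> y"
    using hom_mult[OF \<sigma>, of "inv g \<otimes> x \<otimes> g" "inv g \<otimes> y \<otimes> g"] xy K_conj'[OF g] by (simp add: conj_rep_def)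
qed

text \<open>Moving the subspace by \<open>\<rho> g\<close> replaces \<open>\<sigma>\<close> by its
  conjugate, since \<open>\<rho> h * \<rho> g = \<rho> g * \<rho> (inv g \<otimes> h \<otimes>
  g)\<close>. Normality keeps \<open>h\<close> outside \<open>K\<close> when it is
  conjugated.\<close>

lemma induced_via_conj:
  assumes \<rho>: "\<rho> \<in> hom G (unitary_group N)" and \<sigma>: "\<sigma> \<in> hom GK (unitary_group s)"
    and ind: "induced_via G K s \<sigma> N \<rho> E" and g: "g \<in> carrier G"
  shows "induced_via G K s (conj_rep G g \<sigma>) N \<rho> (\<rho> g * E)"
  unfolding induced_via_def
proof (intro conjI ballI)
  have E: "isometric N s E" using ind by (simp add: induced_via_def)
  show "isometric N s (\<rho> g * E)" by (rule isometric_mult[OF unitary_homD(4)[OF \<rho> g] E])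
  note r = unitary_homD(1)[OF \<rho>] isometricD(1)[OF E] 
  have move: "\<rho> h * (\<rho> g * E) = \<rho> g * (\<rho> (inv g \<otimes> h \<otimes> g) * E)" if h: "h \<in> carrier G" for h
  proof -
    have "h \<otimes> g = g \<otimes> (inv g \<otimes> h \<otimes> g)" using h g by (simp add: m_assoc)
    then have "\<rho> h * \<rho> g = \<rho> g * \<rho> (inv g \<otimes> h \<otimes> g)"
      using h g unitary_homD(7)[OF \<rho> h g] unitary_homD(7)[OF \<rho> g, of "inv g \<otimes> h \<otimes> g"] by simp
    moreover have "\<rho> h * (\<rho> g * E) = \<rho> h * \<rho> g * E" using r(1)[OF h] r(1)[OF g] r(2) by (simp add: mat_assoc)
    moreover have "inv g \<otimes> h \<otimes> g \<in> carrier G" using g h by simp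
    ultimately show ?thesis using r(1)[OF g] r(1)[of "inv g \<otimes> h \<otimes> g"] r(2) by (simp add: mat_assoc)
  qed
  fix k assume k: "k \<in> K"
  have k': "inv g \<otimes> k \<otimes> g \<in> K" by (rule K_conj'[OF g k])
  have "\<rho> k * (\<rho> g * E) = \<rho> g * (E * \<sigma> (inv g \<otimes> k \<otimes> g))"
    using move[of k] k k' ind by (simp add: induced_via_def)
  then show "\<rho> k * (\<rho> g * E) = \<rho> g * E * conj_rep G g \<sigma> k"
    using r(1)[OF g] r(2) K.unitary_homD(1)[OF \<sigma>, of "inv g \<otimes> k \<otimes> g"] k' by (simp add: conj_rep_def mat_assoc)
next
  have E: "isometric N s E" using ind by (simp add: induced_via_def)
  note r = unitary_homD(1)[OF \<rho>] isometricD(1)[OF E] 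
  fix h assume h: "h \<in> carrier G - K"
  let ?x = "inv g \<otimes> h \<otimes> g"
  have x: "?x \<in> carrier G" "?x \<notin> K" using h g K_conj_iff[OF g, of h] by auto
  have "h \<otimes> g = g \<otimes> ?x" using h g by (simp add: m_assoc)
  then have hg: "\<rho> h * \<rho> g = \<rho> g * \<rho> ?x"
    using h x unitary_homD(7)[OF \<rho> _ g, of h] unitary_homD(7)[OF \<rho> g x(1)] by simp
  have "mat_adjoint (\<rho> g * E) * (\<rho> h * (\<rho> g * E)) = mat_adjoint E * mat_adjoint (\<rho> g) * (\<rho> h * \<rho> g * E)"
    using r(1)[of h] r(1)[OF g] r(2) h by (simp add: mat_assoc mat_adjoint_mult[OF r(1)[OF g] r(2)])
  also have "\<dots> = mat_adjoint E * ((mat_adjoint (\<rho> g) * \<rho> g) * (\<rho> ?x * E))"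
    unfolding hg using r(1)[OF x(1)] r(1)[OF g] r(2) by (simp add: mat_assoc)
  also have "\<dots> = mat_adjoint E * (\<rho> ?x * E)"
    using unitary_homD(6)[OF \<rho> g] r(1)[OF x(1)] r(2) by (simp add: mat_one_left)
  also have "\<dots> = 0\<^sub>m s s" using ind x by (simp add: induced_via_def)
  finally show "mat_adjoint (\<rho> g * E) * (\<rho> h * (\<rho> g * E)) = 0\<^sub>m s s" .
qed

text \<open>A change of basis on the side of \<open>K\<close> is absorbed into
  \<open>E\<close>.\<close>

lemma induced_via_equiv:
  assumes \<rho>: "\<rho> \<in> hom G (unitary_group N)" and \<sigma>: "\<sigma> \<in> hom GK (unitary_group s)"
    and ind: "induced_via G K s \<sigma> N \<rho> E" and V: "isometric s s V"
    and \<sigma>': "\<And>k. k \<in> K \<Longrightarrow> \<sigma>' k \<in> carrier_mat s s" and eq: "\<And>k. k \<in> K \<Longrightarrow> \<sigma> k * V = V * \<sigma>' k"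
  shows "induced_via G K s \<sigma>' N \<rho> (E * V)"
  unfolding induced_via_def
proof (intro conjI ballI)
  have E: "isometric N s E" using ind by (simp add: induced_via_def)
  show "isometric N s (E * V)" by (rule isometric_mult[OF E V])
  note r = unitary_homD(1)[OF \<rho>] K.unitary_homD(1)[OF \<sigma>] isometricD(1)[OF E] isometricD(1)[OF V]
  fix k assume k: "k \<in> K"
  have "\<rho> k * (E * V) = (\<rho> k * E) * V" using r(1)[of k] r(3,4) k by (simp add: mat_assoc)
  also have "\<dots> = E * (\<sigma> k * V)" using ind k r(2)[of k] r(3,4) by (simp add: induced_via_def mat_assoc)
  also have "\<dots> = E * V * \<sigma>' k" unfolding eq[OF k] using r(3,4) \<sigma>'[OF k] by (simp add: mat_assoc)
  finally show "\<rho> k * (E * V) = E * V * \<sigma>' k" .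
next
  have E: "isometric N s E" using ind by (simp add: induced_via_def)
  note r = unitary_homD(1)[OF \<rho>] isometricD(1)[OF E] isometricD(1)[OF V]
  fix h assume h: "h \<in> carrier G - K"
  have "mat_adjoint (E * V) * (\<rho> h * (E * V)) = mat_adjoint V * (mat_adjoint E * (\<rho> h * E)) * V"
    using r(1)[of h] r(2,3) h by (simp add: mat_assoc mat_adjoint_mult[OF r(2,3)])
  then show "mat_adjoint (E * V) * (\<rho> h * (E * V)) = 0\<^sub>m s s"
    using ind h r(3) by (simp add: induced_via_def)
qed

text \<open>A change of basis on the side of \<open>G\<close> is absorbed into
  \<open>E\<close>.\<close>

lemma induced_via_transport:
  assumes \<rho>: "\<rho> \<in> hom G (unitary_group N)" and \<sigma>: "\<sigma> \<in> hom GK (unitary_group s)"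
    and ind: "induced_via G K s \<sigma> N \<rho> E" and V: "isometric N N V"
    and \<rho>': "\<rho>' \<in> hom G (unitary_group N)" and eq: "\<And>h. h \<in> carrier G \<Longrightarrow> \<rho>' h * V = V * \<rho> h"
  shows "induced_via G K s \<sigma> N \<rho>' (V * E)"
  unfolding induced_via_def
proof (intro conjI ballI)
  have E: "isometric N s E" using ind by (simp add: induced_via_def)
  show "isometric N s (V * E)" by (rule isometric_mult[OF V E])
  note r = unitary_homD(1)[OF \<rho>] unitary_homD(1)[OF \<rho>'] isometricD(1)[OF E] isometricD(1)[OF V]
  have move: "\<rho>' h * (V * E) = V * (\<rho> h * E)" if h: "h \<in> carrier G" for h
  proof -
    have "\<rho>' h * (V * E) = (\<rho>' h * V) * E" using r(2)[OF h] r(3,4) by (simp add: mat_assoc)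
    then show ?thesis unfolding eq[OF h] using r(1)[OF h] r(3,4) by (simp add: mat_assoc)
  qed
  show "\<rho>' k * (V * E) = V * E * \<sigma> k" if k: "k \<in> K" for k
    using move[of k] k ind K.unitary_homD(1)[OF \<sigma>, of k] r(3,4) by (simp add: induced_via_def mat_assoc)
  fix h assume h: "h \<in> carrier G - K"
  have "mat_adjoint (V * E) * (\<rho>' h * (V * E)) = mat_adjoint E * ((mat_adjoint V * V) * (\<rho> h * E))"
    using move[of h] h r(1)[of h] r(3,4) by (simp add: mat_assoc mat_adjoint_mult[OF r(4,3)])
  also have "\<dots> = mat_adjoint E * (\<rho> h * E)"
    using isometricD(3)[OF V] r(1)[of h] r(3) h by (simp add: mat_one_left)
  finally show "mat_adjoint (V * E) * (\<rho>' h * (V * E)) = 0\<^sub>m s s" using ind h by (simp add: induced_via_def)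
qed

text \<open>The product compresses \<open>\<rho> (inv (rs ! p) \<otimes> rs ! q)\<close> by
  \<open>E\<close>, and this group element lies in \<open>K\<close> only for
  \<open>p = q\<close>.\<close>

lemma induced_via_frame:
  assumes \<rho>: "\<rho> \<in> hom G (unitary_group N)" and ind: "induced_via G K s \<sigma> N \<rho> E"
    and rs: "left_transversal G K rs" and p: "p < length rs" and q: "q < length rs"
  shows "mat_adjoint (\<rho> (rs ! p) * E) * (\<rho> (rs ! q) * E) = (if p = q then 1\<^sub>m s else 0\<^sub>m s s)"
proof -
  have E: "isometric N s E" using ind by (simp add: induced_via_def)
  note rp = transversal_mem[OF rs p] and rq = transversal_mem[OF rs q]
  note r = unitary_homD(1)[OF \<rho>] isometricD(1)[OF E]
  have "mat_adjoint (\<rho> (rs ! p) * E) * (\<rho> (rs ! q) * E) = mat_adjoint E * (\<rho> (inv (rs ! p) \<otimes> rs ! q) * E)"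
    using r(1)[OF rp] r(1)[OF rq] r(2) rp rq
    by (simp add: mat_assoc mat_adjoint_mult[OF r(1)[OF rp] r(2)] unitary_homD(7)[OF \<rho>] unitary_homD(11)[OF \<rho>])
  also have "\<dots> = (if p = q then 1\<^sub>m s else 0\<^sub>m s s)"
  proof (cases "p = q")
    case True
    then show ?thesis using rq isometricD[OF E] by (simp add: unitary_homD(8)[OF \<rho>] mat_one_left)
  next
    case False
    then have "inv (rs ! p) \<otimes> rs ! q \<in> carrier G - K" using transversal_diff_iff[OF rs p q] rp rq by auto
    then show ?thesis using False ind by (simp add: induced_via_def)
  qed
  finally show ?thesis .
qed

lemma induced_rep_carrier [simp]: "induced_rep G K rs s \<sigma> h \<in> carrier_mat (length rs * s) (length rs * s)"
  by (simp add: induced_rep_def)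

lemma sum_blocks:
  fixes f :: "nat \<Rightarrow> complex"
  shows "(\<Sum>i<l * s. f i) = (\<Sum>p<l. \<Sum>t<s. f (p * s + t))"
proof -
  have "(\<Sum>t<s. f (p * s + t)) = sum f {p * s..<p * s + s}" for p
    by (rule sum.reindex_bij_witness[of _ "\<lambda>i. i - p * s" "\<lambda>t. p * s + t"]) auto
  then show ?thesis by (simp add: sum.nat_group)
qed

text \<open>For each \<open>q\<close> there is exactly one \<open>p\<close> with
  \<open>h \<otimes> rs ! q\<close> in the coset of \<open>rs ! p\<close>, so
  \<open>\<rho> h\<close> carries block \<open>q\<close> to block \<open>p\<close> through a value
  of \<open>\<sigma>\<close>. The dimension of \<open>\<rho>\<close> is left open: in general the
  induced representation is only embedded, and the dimension count in
  \<open>free_rep_induced\<close> starts from this embedding.\<close>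

lemma induced_rep_intertwiner:
  assumes \<rho>: "\<rho> \<in> hom G (unitary_group N)" and \<sigma>: "\<sigma> \<in> hom GK (unitary_group s)"
    and ind: "induced_via G K s \<sigma> N \<rho> E" and rs: "left_transversal G K rs"
  defines "U \<equiv> frame_mat N (length rs) s (\<lambda>p. \<rho> (rs ! p) * E)"
  shows "isometric N (length rs * s) U"
    "h \<in> carrier G \<Longrightarrow> \<rho> h * U = U * induced_rep G K rs s \<sigma> h"
proof -
  let ?F = "\<lambda>p. \<rho> (rs ! p) * E"
  let ?U = "frame_mat N (length rs) s ?F"
  have E: "isometric N s E" using ind by (simp add: induced_via_def)
  note r = unitary_homD(1)[OF \<rho>] isometricD(1)[OF E]
  have F: "?F p \<in> carrier_mat N s" if "p < length rs" for p
    using mult_carrier_mat[OF r(1)[OF transversal_mem[OF rs that]] r(2)] .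
  show "isometric N (length rs * s) U"
    unfolding U_def by (rule isometric_frame_mat[OF F induced_via_frame[OF \<rho> ind rs]])
  show "\<rho> h * U = U * induced_rep G K rs s \<sigma> h" if h: "h \<in> carrier G"
    unfolding U_def
    proof (rule eq_matI)
      fix i j assume "i < dim_row (?U * induced_rep G K rs s \<sigma> h)" "j < dim_col (?U * induced_rep G K rs s \<sigma> h)"
      then have ij: "i < N" "j < length rs * s" by (auto simp: frame_mat_def induced_rep_def)
      note b = div_mod_bounds[OF ij(2)]
      let ?q = "j div s" and ?u = "j mod s"
      note rq = transversal_mem[OF rs b(1)]
      \<comment> \<open>\<open>p\<close> is the coset to which \<open>h\<close> moves coset
        \<open>?q\<close>; the sum over block rows collapses to it.\<close>
      obtain p where p: "p < length rs" "inv (rs ! p) \<otimes> (h \<otimes> rs ! ?q) \<in> K"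
        and uniq: "\<And>p'. p' < length rs \<Longrightarrow> inv (rs ! p') \<otimes> (h \<otimes> rs ! ?q) \<in> K \<Longrightarrow> p' = p"
        using transversal_ex1[OF rs m_closed[OF h rq]] by blast
      note rp = transversal_mem[OF rs p(1)]
      let ?k = "inv (rs ! p) \<otimes> h \<otimes> rs ! ?q"
      have k: "?k \<in> K" using p(2) rp rq h by (simp add: m_assoc)
      have "(?U * induced_rep G K rs s \<sigma> h) $$ (i, j) =
          (\<Sum>t<length rs * s. ?U $$ (i, t) * induced_rep G K rs s \<sigma> h $$ (t, j))"
        by (rule mat_mult_index_sum) (use ij in auto)
      also have "\<dots> = (\<Sum>p'<length rs. \<Sum>t<s. ?U $$ (i, p' * s + t) * induced_rep G K rs s \<sigma> h $$ (p' * s + t, j))"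
        by (rule sum_blocks)
      also have "\<dots> = (\<Sum>p'<length rs. if p' = p then (\<Sum>t<s. ?F p $$ (i, t) * \<sigma> ?k $$ (t, ?u)) else 0)"
      proof (rule sum.cong[OF refl])
        fix p' assume "p' \<in> {..<length rs}"
        then have p': "p' < length rs" by simp
        have lt: "p' * s + t < length rs * s" if "t < s" for t
        proof -
          have "p' * s + t < (p' + 1) * s" using that by simp
          also have "\<dots> \<le> length rs * s" using p' by (intro mult_le_mono1) simp
          finally show ?thesis .
        qed
        have "(\<Sum>t<s. ?U $$ (i, p' * s + t) * induced_rep G K rs s \<sigma> h $$ (p' * s + t, j)) =
          (\<Sum>t<s. if inv (rs ! p') \<otimes> h \<otimes> rs ! ?q \<in> K
             then ?F p' $$ (i, t) * \<sigma> (inv (rs ! p') \<otimes> h \<otimes> rs ! ?q) $$ (t, ?u) else 0)"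
        proof (rule sum.cong[OF refl])
          fix t assume "t \<in> {..<s}"
          then have t: "t < s" by simp
          have dm: "(p' * s + t) div s = p'" "(p' * s + t) mod s = t" using t by auto
          show "?U $$ (i, p' * s + t) * induced_rep G K rs s \<sigma> h $$ (p' * s + t, j) =
            (if inv (rs ! p') \<otimes> h \<otimes> rs ! ?q \<in> K
             then ?F p' $$ (i, t) * \<sigma> (inv (rs ! p') \<otimes> h \<otimes> rs ! ?q) $$ (t, ?u) else 0)"
            unfolding frame_mat_def induced_rep_def Let_def
            using lt[OF t] ij t by (simp add: dm)
        qed
        also have "\<dots> = (if p' = p then (\<Sum>t<s. ?F p $$ (i, t) * \<sigma> ?k $$ (t, ?u)) else 0)"
        proof (cases "p' = p")
          case True
          then show ?thesis using k by simp
        next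
          case False
          then have "inv (rs ! p') \<otimes> h \<otimes> rs ! ?q \<notin> K"
            using uniq[OF p'] transversal_mem[OF rs p'] rq h by (auto simp: m_assoc)
          then show ?thesis using False by simp
        qed
        finally show "(\<Sum>t<s. ?U $$ (i, p' * s + t) * induced_rep G K rs s \<sigma> h $$ (p' * s + t, j)) =
          (if p' = p then (\<Sum>t<s. ?F p $$ (i, t) * \<sigma> ?k $$ (t, ?u)) else 0)" .
      qed
      also have "\<dots> = (\<Sum>t<s. ?F p $$ (i, t) * \<sigma> ?k $$ (t, ?u))" using p(1) by simp
      also have "\<dots> = (?F p * \<sigma> ?k) $$ (i, ?u)"
        by (rule mat_mult_index_sum[symmetric, OF F[OF p(1)]])
           (use K.unitary_homD(1)[OF \<sigma>] k b ij in auto)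
      also have "?F p * \<sigma> ?k = \<rho> (rs ! p) * (\<rho> ?k * E)"
        using ind k r(1)[OF rp] r(2) K.unitary_homD(1)[OF \<sigma>, of ?k] by (simp add: induced_via_def mat_assoc)
      also have "\<dots> = \<rho> (rs ! p \<otimes> ?k) * E"
        using unitary_homD(7)[OF \<rho> rp, of ?k] r(1)[OF rp] r(1)[of ?k] r(2) k by (simp add: mat_assoc)
      also have "rs ! p \<otimes> ?k = h \<otimes> rs ! ?q" using rp rq h by (simp add: m_assoc)
      also have "\<rho> (h \<otimes> rs ! ?q) * E = \<rho> h * ?F ?q"
        using unitary_homD(7)[OF \<rho> h rq] r(1)[OF rq] r(1)[OF h] r(2) by (simp add: mat_assoc)
      finally have 1: "(?U * induced_rep G K rs s \<sigma> h) $$ (i, j) = (\<rho> h * ?F ?q) $$ (i, ?u)" .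
      have "(\<rho> h * ?U) $$ (i, j) = (\<Sum>t<N. \<rho> h $$ (i, t) * ?U $$ (t, j))"
        by (rule mat_mult_index_sum[OF r(1)[OF h] frame_mat_carrier]) (use ij in auto)
      also have "\<dots> = (\<Sum>t<N. \<rho> h $$ (i, t) * ?F ?q $$ (t, ?u))"
        by (rule sum.cong) (use ij in \<open>auto simp: frame_mat_def\<close>)
      also have "\<dots> = (\<rho> h * ?F ?q) $$ (i, ?u)"
        by (rule mat_mult_index_sum[OF r(1)[OF h] F[OF b(1)], symmetric]) (use ij b in auto)
      finally show "(\<rho> h * ?U) $$ (i, j) = (?U * induced_rep G K rs s \<sigma> h) $$ (i, j)" using 1 by simp
    qed (use r(1)[OF h] in \<open>auto simp: frame_mat_def induced_rep_def\<close>)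
qed

lemma induced_rep_equiv:
  assumes \<rho>: "\<rho> \<in> hom G (unitary_group N)" and \<sigma>: "\<sigma> \<in> hom GK (unitary_group s)"
    and ind: "induced_via G K s \<sigma> N \<rho> E"
    and rs: "left_transversal G K rs" and N: "N = length rs * s"
  shows "rep_equiv G \<rho> (induced_rep G K rs s \<sigma>)"
  by (rule rep_equivI[OF \<rho> induced_rep_intertwiner(1)[OF \<rho> \<sigma> ind rs, folded N]])
     (use N induced_rep_intertwiner(2)[OF \<rho> \<sigma> ind rs] in auto)

end

section \<open>The block matrix of the definition is a representation and is induced in the
  choice-free sense\<close>

definition block_embedding :: "nat \<Rightarrow> nat \<Rightarrow> nat \<Rightarrow> complex mat" where
  "block_embedding l s q = mat (l * s) s (\<lambda>(i, j). if i = q * s + j then 1 else 0)"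

lemma block_embedding_carrier [simp]: "block_embedding l s q \<in> carrier_mat (l * s) s"
  by (simp add: block_embedding_def)

lemma block_index_less:
  assumes "q < l" "j < s"
  shows "q * s + j < l * (s :: nat)"
proof -
  have "q * s + j < (q + 1) * s" using assms by simp
  also have "\<dots> \<le> l * s" using assms by (intro mult_le_mono1) simp
  finally show ?thesis .
qed

lemma block_index_eq_iff:
  assumes "j < s" "j' < (s :: nat)"
  shows "q * s + j = q' * s + j' \<longleftrightarrow> q = q' \<and> j = j'"
proof -
  have "(q * s + j) div s = q" "(q * s + j) mod s = j" "(q' * s + j') div s = q'" "(q' * s + j') mod s = j'"
    using assms by auto
  then show ?thesis by auto
qed

text \<open>Right multiplication by a block inclusion extracts a block column, so identities between
  matrices of induced representations can be checked one block column at a time.\<close>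

lemma mult_block_embedding_index:
  assumes "M \<in> carrier_mat n (l * s)" "q < l" "i < n" "j < s"
  shows "(M * block_embedding l s q) $$ (i, j) = M $$ (i, q * s + j)"
proof -
  have "(M * block_embedding l s q) $$ (i, j) = (\<Sum>t<l * s. M $$ (i, t) * block_embedding l s q $$ (t, j))"
    by (rule mat_mult_index_sum[OF assms(1) block_embedding_carrier assms(3,4)])
  also have "\<dots> = (\<Sum>t<l * s. if t = q * s + j then M $$ (i, t) else 0)"
    by (rule sum.cong) (use assms in \<open>auto simp: block_embedding_def\<close>)
  finally show ?thesis using block_index_less[OF assms(2,4)] by simp
qed

lemma block_embedding_mult_index:
  assumes "M \<in> carrier_mat s k" "i < l * s" "j < k"
  shows "(block_embedding l s p * M) $$ (i, j) = (if i div s = p then M $$ (i mod s, j) else 0)"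
proof -
  note b = div_mod_bounds[OF assms(2)]
  have "(block_embedding l s p * M) $$ (i, j) = (\<Sum>t<s. block_embedding l s p $$ (i, t) * M $$ (t, j))"
    by (rule mat_mult_index_sum[OF block_embedding_carrier assms])
  also have "\<dots> = (\<Sum>t<s. if t = i mod s then (if i div s = p then M $$ (i mod s, j) else 0) else 0)"
  proof (rule sum.cong[OF refl])
    fix t assume "t \<in> {..<s}"
    then have t: "t < s" by simp
    have "i = p * s + t \<longleftrightarrow> i div s = p \<and> i mod s = t"
      using block_index_eq_iff[OF b(2) t, of "i div s" p] by simp
    then show "block_embedding l s p $$ (i, t) * M $$ (t, j) =
        (if t = i mod s then (if i div s = p then M $$ (i mod s, j) else 0) else 0)"
      using t assms(2) by (auto simp: block_embedding_def)
  qed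
  finally show ?thesis using b by simp
qed

lemma block_embedding_orthogonal:
  assumes "p < l" "q < l"
  shows "mat_adjoint (block_embedding l s p) * block_embedding l s q = (if p = q then 1\<^sub>m s else 0\<^sub>m s s)"
proof (rule eq_matI)
  fix i j assume "i < dim_row (if p = q then 1\<^sub>m s else 0\<^sub>m s s :: complex mat)"
    "j < dim_col (if p = q then 1\<^sub>m s else 0\<^sub>m s s :: complex mat)"
  then have ij: "i < s" "j < s" by (auto split: if_splits)
  have "(mat_adjoint (block_embedding l s p) * block_embedding l s q) $$ (i, j) =
      mat_adjoint (block_embedding l s p) $$ (i, q * s + j)"
    by (rule mult_block_embedding_index) (use assms ij in auto)
  also have "\<dots> = cnj (block_embedding l s p $$ (q * s + j, i))"
    using block_index_less[OF assms(2) ij(2)] ij by (simp add: mat_adjoint_eq block_embedding_def)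
  also have "\<dots> = (if q = p \<and> j = i then 1 else 0)"
    using block_index_less[OF assms(2) ij(2)] ij block_index_eq_iff[OF ij(2,1), of q p]
    by (simp add: block_embedding_def)
  finally show "(mat_adjoint (block_embedding l s p) * block_embedding l s q) $$ (i, j) =
      (if p = q then 1\<^sub>m s else 0\<^sub>m s s) $$ (i, j)" using ij by auto
qed (auto simp: block_embedding_def)

lemma eq_by_block_embedding:
  assumes "A \<in> carrier_mat n (l * s)" "B \<in> carrier_mat n (l * s)"
    "\<And>q. q < l \<Longrightarrow> A * block_embedding l s q = B * block_embedding l s q"
  shows "A = B"
proof (rule eq_matI)
  fix i j assume "i < dim_row B" "j < dim_col B"
  then have ij: "i < n" "j < l * s" using assms by auto
  note b = div_mod_bounds[OF ij(2)]
  show "A $$ (i, j) = B $$ (i, j)"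
    using mult_block_embedding_index[OF assms(1) b(1) ij(1) b(2)]
      mult_block_embedding_index[OF assms(2) b(1) ij(1) b(2)] assms(3)[OF b(1)] by simp
qed (use assms in auto)

context normal_subgroup begin

lemma dim_induced_rep [simp]:
  "dim_row (induced_rep G K rs s \<sigma> h) = length rs * s" "dim_col (induced_rep G K rs s \<sigma> h) = length rs * s"
  by (simp_all add: induced_rep_def)

lemma transversal_translate:
  assumes rs: "left_transversal G K rs" and h: "h \<in> carrier G" and q: "q < length rs"
  obtains p where "p < length rs" "inv (rs ! p) \<otimes> h \<otimes> rs ! q \<in> K"
    "\<And>p'. p' < length rs \<Longrightarrow> inv (rs ! p') \<otimes> h \<otimes> rs ! q \<in> K \<Longrightarrow> p' = p"
proof -
  note rq = transversal_mem[OF rs q]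
  have "inv (rs ! p) \<otimes> (h \<otimes> rs ! q) = inv (rs ! p) \<otimes> h \<otimes> rs ! q" if "p < length rs" for p
    using transversal_mem[OF rs that] h rq by (simp add: m_assoc)
  then have "(p < length rs \<and> inv (rs ! p) \<otimes> (h \<otimes> rs ! q) \<in> K) =
      (p < length rs \<and> inv (rs ! p) \<otimes> h \<otimes> rs ! q \<in> K)" for p by auto
  then have "\<exists>!p. p < length rs \<and> inv (rs ! p) \<otimes> h \<otimes> rs ! q \<in> K"
    using transversal_ex1[OF rs m_closed[OF h rq]] by simp
  then show ?thesis using that by blast
qed

text \<open>Only one \<open>p\<close> satisfies the coset condition, so a block column has a single
  nonzero block.\<close>

lemma induced_rep_block:
  assumes rs: "left_transversal G K rs" and \<sigma>: "\<sigma> \<in> hom GK (unitary_group s)"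
    and h: "h \<in> carrier G" and q: "q < length rs" and p: "p < length rs"
    and k: "inv (rs ! p) \<otimes> h \<otimes> rs ! q \<in> K"
  shows "induced_rep G K rs s \<sigma> h * block_embedding (length rs) s q =
    block_embedding (length rs) s p * \<sigma> (inv (rs ! p) \<otimes> h \<otimes> rs ! q)"
proof (rule eq_matI)
  let ?k = "inv (rs ! p) \<otimes> h \<otimes> rs ! q"
  have \<sigma>k: "\<sigma> ?k \<in> carrier_mat s s" using K.unitary_homD(1)[OF \<sigma>] k by simp
  fix i j assume "i < dim_row (block_embedding (length rs) s p * \<sigma> ?k)"
    "j < dim_col (block_embedding (length rs) s p * \<sigma> ?k)"
  then have ij: "i < length rs * s" "j < s" using \<sigma>k by (auto simp: block_embedding_def)
  note b = div_mod_bounds[OF ij(1)]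
  have *: "inv (rs ! (i div s)) \<otimes> h \<otimes> rs ! q \<in> K \<longleftrightarrow> i div s = p"
  proof -
    obtain p0 where "\<And>p'. p' < length rs \<Longrightarrow> inv (rs ! p') \<otimes> h \<otimes> rs ! q \<in> K \<Longrightarrow> p' = p0"
      by (rule transversal_translate[OF rs h q]) blast
    then show ?thesis using b(1) p k by blast
  qed
  have qj: "(q * s + j) div s = q" "(q * s + j) mod s = j" using ij by auto
  have "(induced_rep G K rs s \<sigma> h * block_embedding (length rs) s q) $$ (i, j) =
      induced_rep G K rs s \<sigma> h $$ (i, q * s + j)"
    by (rule mult_block_embedding_index[OF induced_rep_carrier q ij])
  also have "\<dots> = (if i div s = p then \<sigma> ?k $$ (i mod s, j) else 0)"
    using ij(1) block_index_less[OF q ij(2)] * unfolding induced_rep_def Let_def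
    by (simp add: qj ij(2))
  also have "\<dots> = (block_embedding (length rs) s p * \<sigma> ?k) $$ (i, j)"
    by (rule block_embedding_mult_index[OF \<sigma>k ij, symmetric])
  finally show "(induced_rep G K rs s \<sigma> h * block_embedding (length rs) s q) $$ (i, j) =
    (block_embedding (length rs) s p * \<sigma> ?k) $$ (i, j)" .
qed (use K.unitary_homD(1)[OF \<sigma>] k in \<open>auto simp: induced_rep_def block_embedding_def\<close>)

lemma induced_rep_mult:
  assumes rs: "left_transversal G K rs" and \<sigma>: "\<sigma> \<in> hom GK (unitary_group s)"
    and x: "x \<in> carrier G" and y: "y \<in> carrier G"
  shows "induced_rep G K rs s \<sigma> (x \<otimes> y) = induced_rep G K rs s \<sigma> x * induced_rep G K rs s \<sigma> y"
proof (rule eq_by_block_embedding)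
  fix q assume q: "q < length rs"
  let ?I = "induced_rep G K rs s \<sigma>" and ?B = "block_embedding (length rs) s"
  obtain p where p: "p < length rs" "inv (rs ! p) \<otimes> y \<otimes> rs ! q \<in> K"
    by (rule transversal_translate[OF rs y q])
  obtain r where r: "r < length rs" "inv (rs ! r) \<otimes> x \<otimes> rs ! p \<in> K"
    by (rule transversal_translate[OF rs x p(1)])
  note m = transversal_mem[OF rs q] transversal_mem[OF rs p(1)] transversal_mem[OF rs r(1)]
  \<comment> \<open>The middle representative cancels, so the \<open>K\<close>-components of two
    successive moves multiply to that of the product.\<close>
  have eq: "(inv (rs ! r) \<otimes> x \<otimes> rs ! p) \<otimes> (inv (rs ! p) \<otimes> y \<otimes> rs ! q) = inv (rs ! r) \<otimes> (x \<otimes> y) \<otimes> rs ! q"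
    using m x y by (simp add: m_assoc)
  have k: "inv (rs ! r) \<otimes> (x \<otimes> y) \<otimes> rs ! q \<in> K" unfolding eq[symmetric] by (rule K_closed(1)[OF r(2) p(2)])
  note c = K.unitary_homD(1)[OF \<sigma>, simplified, OF p(2)] K.unitary_homD(1)[OF \<sigma>, simplified, OF r(2)]
  have "?I x * ?I y * ?B q = ?I x * (?B p * \<sigma> (inv (rs ! p) \<otimes> y \<otimes> rs ! q))"
    unfolding induced_rep_block[OF rs \<sigma> y q p, symmetric]
    by (rule assoc_mult_mat[OF induced_rep_carrier induced_rep_carrier block_embedding_carrier])
  also have "\<dots> = ?I x * ?B p * \<sigma> (inv (rs ! p) \<otimes> y \<otimes> rs ! q)"
    by (rule assoc_mult_mat[OF induced_rep_carrier block_embedding_carrier c(1), symmetric])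
  also have "\<dots> = ?B r * (\<sigma> (inv (rs ! r) \<otimes> x \<otimes> rs ! p) * \<sigma> (inv (rs ! p) \<otimes> y \<otimes> rs ! q))"
    unfolding induced_rep_block[OF rs \<sigma> x p(1) r]
    by (rule assoc_mult_mat[OF block_embedding_carrier c(2,1)])
  also have "\<dots> = ?B r * \<sigma> (inv (rs ! r) \<otimes> (x \<otimes> y) \<otimes> rs ! q)"
    using K.unitary_homD(7)[OF \<sigma>, simplified, OF r(2) p(2)] eq by simp
  also have "\<dots> = ?I (x \<otimes> y) * ?B q"
    by (rule induced_rep_block[OF rs \<sigma> m_closed[OF x y] q r(1) k, symmetric])
  finally show "?I (x \<otimes> y) * ?B q = ?I x * ?I y * ?B q" by simp
qed (rule induced_rep_carrier mult_carrier_mat[OF induced_rep_carrier induced_rep_carrier])+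

lemma induced_rep_one:
  assumes rs: "left_transversal G K rs" and \<sigma>: "\<sigma> \<in> hom GK (unitary_group s)"
  shows "induced_rep G K rs s \<sigma> \<one> = 1\<^sub>m (length rs * s)"
proof (rule eq_by_block_embedding)
  fix q assume q: "q < length rs"
  have "inv (rs ! q) \<otimes> \<one> \<otimes> rs ! q = \<one>" using transversal_mem[OF rs q] by simp
  then show "induced_rep G K rs s \<sigma> \<one> * block_embedding (length rs) s q =
      1\<^sub>m (length rs * s) * block_embedding (length rs) s q"
    using induced_rep_block[OF rs \<sigma> one_closed q q] K.unitary_homD(8)[OF \<sigma>]
      right_mult_one_mat[OF block_embedding_carrier] left_mult_one_mat[OF block_embedding_carrier] by simp
qed auto

lemma induced_rep_inv:
  assumes rs: "left_transversal G K rs" and \<sigma>: "\<sigma> \<in> hom GK (unitary_group s)" and h: "h \<in> carrier G"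
  shows "induced_rep G K rs s \<sigma> (inv h) = mat_adjoint (induced_rep G K rs s \<sigma> h)"
proof (rule eq_matI)
  fix i j assume "i < dim_row (mat_adjoint (induced_rep G K rs s \<sigma> h))"
    "j < dim_col (mat_adjoint (induced_rep G K rs s \<sigma> h))"
  then have ij: "i < length rs * s" "j < length rs * s" by (auto simp: induced_rep_def)
  note b = div_mod_bounds[OF ij(1)] div_mod_bounds[OF ij(2)]
  note m = transversal_mem[OF rs b(1)] transversal_mem[OF rs b(3)]
  let ?x = "inv (rs ! (j div s)) \<otimes> h \<otimes> rs ! (i div s)"
  have eq: "inv (rs ! (i div s)) \<otimes> inv h \<otimes> rs ! (j div s) = inv ?x"
    using m h by (simp add: inv_mult_group m_assoc)
  have mem: "inv ?x \<in> K \<longleftrightarrow> ?x \<in> K" using K_closed(2)[of ?x] K_closed(2)[of "inv ?x"] m h by auto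
  have "\<sigma> (inv ?x) $$ (i mod s, j mod s) = cnj (\<sigma> ?x $$ (j mod s, i mod s))" if x: "?x \<in> K"
  proof -
    have "\<sigma> (inv ?x) = mat_adjoint (\<sigma> ?x)"
      using K.unitary_homD(11)[OF \<sigma>, of ?x] x m_inv_consistent[OF K_subgroup x] by simp
    then show ?thesis using K.unitary_homD(1)[OF \<sigma>, of ?x] x b by (simp add: mat_adjoint_eq)
  qed
  then show "induced_rep G K rs s \<sigma> (inv h) $$ (i, j) = mat_adjoint (induced_rep G K rs s \<sigma> h) $$ (i, j)"
    using ij mem by (simp add: induced_rep_def mat_adjoint_eq Let_def eq)
qed (auto simp: induced_rep_def)

lemma induced_rep_hom:
  assumes rs: "left_transversal G K rs" and \<sigma>: "\<sigma> \<in> hom GK (unitary_group s)"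
  shows "induced_rep G K rs s \<sigma> \<in> hom G (unitary_group (length rs * s))"
proof (rule homI)
  fix h assume h: "h \<in> carrier G"
  have "induced_rep G K rs s \<sigma> (inv h) * induced_rep G K rs s \<sigma> h = 1\<^sub>m (length rs * s)"
    using induced_rep_mult[OF rs \<sigma> inv_closed[OF h] h] induced_rep_one[OF rs \<sigma>] h by simp
  then show "induced_rep G K rs s \<sigma> h \<in> carrier (unitary_group (length rs * s))"
    by (simp add: carrier_unitary_group isometric_def induced_rep_inv[OF rs \<sigma> h])
next
  show "induced_rep G K rs s \<sigma> (x \<otimes> y) =
      induced_rep G K rs s \<sigma> x \<otimes>\<^bsub>unitary_group (length rs * s)\<^esub> induced_rep G K rs s \<sigma> y"
    if "x \<in> carrier G" "y \<in> carrier G" for x y using induced_rep_mult[OF rs \<sigma> that] by simp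
qed

lemma restrict_hom: "\<rho> \<in> hom G (unitary_group N) \<Longrightarrow> \<rho> \<in> hom GK (unitary_group N)"
  by (auto simp: hom_def)

text \<open>The natural embedding is the block of the coset \<open>K\<close> itself; its
  representative \<open>?r\<close> need not be \<open>\<one>\<close>, and the factor
  \<open>\<sigma> (inv ?r)\<close> corrects for this.\<close>

lemma induced_rep_via:
  assumes rs: "left_transversal G K rs" and \<sigma>: "\<sigma> \<in> hom GK (unitary_group s)"
  obtains E where "induced_via G K s \<sigma> (length rs * s) (induced_rep G K rs s \<sigma>) E"
proof -
  let ?I = "induced_rep G K rs s \<sigma>" and ?B = "block_embedding (length rs) s" and ?N = "length rs * s"
  obtain p where p: "p < length rs" "inv (rs ! p) \<in> K"
    using transversal_ex1[OF rs one_closed] transversal_mem[OF rs] by auto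
  let ?r = "rs ! p"
  have rp: "?r \<in> carrier G" by (rule transversal_mem[OF rs p(1)])
  then have r: "?r \<in> K" using K_closed(2)[OF p(2)] by simp
  define E where "E = ?B p * \<sigma> (inv ?r)"
  have \<sigma>c: "\<sigma> k \<in> carrier_mat s s" if "k \<in> K" for k using K.unitary_homD(1)[OF \<sigma>] that by simp
  have \<sigma>m: "\<sigma> (x \<otimes> y) = \<sigma> x * \<sigma> y" if "x \<in> K" "y \<in> K" for x y using K.unitary_homD(7)[OF \<sigma>] that by simp
  have Bi: "isometric ?N s (?B p)" using block_embedding_orthogonal[OF p(1) p(1), where s = s] unfolding isometric_def by simp
  have \<sigma>i: "isometric s s (\<sigma> k)" if "k \<in> K" for k using K.unitary_homD(4)[OF \<sigma>] that by simp
  have Ec: "E \<in> carrier_mat ?N s" unfolding E_def by (rule mult_carrier_mat[OF block_embedding_carrier \<sigma>c[OF p(2)]])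
  have IE: "?I h * E = ?B q * \<sigma> (inv (rs ! q) \<otimes> h)"
    if h: "h \<in> carrier G" and q: "q < length rs" and k: "inv (rs ! q) \<otimes> h \<otimes> ?r \<in> K" for h q
  proof -
    have rq: "rs ! q \<in> carrier G" by (rule transversal_mem[OF rs q])
    have "?I h * E = ?I h * ?B p * \<sigma> (inv ?r)"
      unfolding E_def by (rule assoc_mult_mat[OF induced_rep_carrier block_embedding_carrier \<sigma>c[OF p(2)], symmetric])
    also have "\<dots> = ?B q * (\<sigma> (inv (rs ! q) \<otimes> h \<otimes> ?r) * \<sigma> (inv ?r))"
      unfolding induced_rep_block[OF rs \<sigma> h p(1) q k]
      by (rule assoc_mult_mat[OF block_embedding_carrier \<sigma>c[OF k] \<sigma>c[OF p(2)]])
    also have "\<dots> = ?B q * \<sigma> (inv (rs ! q) \<otimes> h)"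
      unfolding \<sigma>m[OF k p(2), symmetric] using h rq rp by (simp add: m_assoc)
    finally show ?thesis .
  qed
  have "induced_via G K s \<sigma> ?N ?I E"
    unfolding induced_via_def
  proof (intro conjI ballI)
    show "isometric ?N s E" unfolding E_def by (rule isometric_mult[OF Bi \<sigma>i[OF p(2)]])
    fix k assume k: "k \<in> K"
    have "?I k * E = ?B p * (\<sigma> (inv ?r) * \<sigma> k)"
      using IE[OF K_mem[OF k] p(1)] k r p(2) \<sigma>m[OF p(2) k] by simp
    then show "?I k * E = E * \<sigma> k"
      unfolding E_def using assoc_mult_mat[OF block_embedding_carrier \<sigma>c[OF p(2)] \<sigma>c[OF k]] by simp
  next
    fix h assume h: "h \<in> carrier G - K"
    then have hG: "h \<in> carrier G" by simp
    obtain q where q: "q < length rs" "inv (rs ! q) \<otimes> h \<otimes> ?r \<in> K"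
      by (rule transversal_translate[OF rs hG p(1)])
    have rq: "rs ! q \<in> carrier G" by (rule transversal_mem[OF rs q(1)])
    have k: "inv (rs ! q) \<otimes> h \<in> K"
      using K_closed(1)[OF q(2) p(2)] hG rq rp by (simp add: m_assoc)
    have "p \<noteq> q"
    proof
      assume "p = q"
      then have "?r \<otimes> (inv ?r \<otimes> h) \<in> K" using K_closed(1)[OF r k] by simp
      then show False using h rp by simp
    qed
    have "mat_adjoint E * (?I h * E) = mat_adjoint (\<sigma> (inv ?r)) * (mat_adjoint (?B p) * ?B q) * \<sigma> (inv (rs ! q) \<otimes> h)"
      unfolding IE[OF hG q] unfolding E_def mat_adjoint_mult[OF block_embedding_carrier \<sigma>c[OF p(2)]]
      using \<sigma>c[OF p(2)] \<sigma>c[OF k] by (simp add: mat_assoc block_embedding_def)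
    also have "\<dots> = 0\<^sub>m s s"
      using \<open>p \<noteq> q\<close> \<sigma>c[OF p(2)] \<sigma>c[OF k] by (simp add: block_embedding_orthogonal[OF p(1) q(1)])
    finally show "mat_adjoint E * (?I h * E) = 0\<^sub>m s s" .
  qed
  then show ?thesis by (rule that)
qed

section \<open>Conjugation and induction of equivalence classes\<close>

lemma dual_act_class:
  assumes \<sigma>: "\<sigma> \<in> hom GK (unitary_group s)" and g: "g \<in> carrier G"
  shows "dual_act G GK g (rep_class GK \<sigma>) = rep_class GK (conj_rep G g \<sigma>)"
proof -
  have "rep_class GK (conj_rep G g \<tau>) = rep_class GK (conj_rep G g \<sigma>)" if \<tau>: "\<tau> \<in> rep_class GK \<sigma>" for \<tau>
  proof -
    note \<tau>h = K.rep_class_mem_hom[OF \<sigma> \<tau>]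
    obtain V where V: "isometric s s V" "\<And>k. k \<in> K \<Longrightarrow> \<sigma> k * V = V * \<tau> k"
      by (rule K.rep_equivE[OF \<sigma> \<tau>h(2)]) auto
    have "rep_equiv GK (conj_rep G g \<sigma>) (conj_rep G g \<tau>)"
      by (rule K.rep_equivI[OF conj_rep_hom[OF \<sigma> g] V(1)])
         (use K.unitary_homD(1)[OF \<tau>h(1)] K_conj'[OF g] V(2) in \<open>auto simp: conj_rep_def\<close>)
    then show ?thesis using K.rep_class_eq_iff[OF conj_rep_hom[OF \<sigma> g] conj_rep_hom[OF \<tau>h(1) g]] by simp
  qed
  then show ?thesis
    using K.rep_class_self[OF \<sigma>] unfolding dual_act_def conj_rep_def by blast
qed

text \<open>Neither choice in \<open>dual_induce\<close> matters: another representative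
  \<open>\<tau>\<close> sits in the same \<open>\<rho>\<close> through \<open>E * V\<close>, and
  another transversal has the same length.\<close>

lemma dual_induce_class:
  assumes \<rho>: "\<rho> \<in> hom G (unitary_group N)" and \<sigma>: "\<sigma> \<in> hom GK (unitary_group s)"
    and ind: "induced_via G K s \<sigma> N \<rho> E"
    and rs: "left_transversal G K rs" and N: "N = length rs * s"
  shows "dual_induce G K (rep_class GK \<sigma>) = rep_class G \<rho>"
proof -
  have eq: "rep_class G (induced_rep G K rs' (rep_dim G \<tau>) \<tau>) = rep_class G \<rho>"
    if \<tau>: "\<tau> \<in> rep_class GK \<sigma>" and rs': "left_transversal G K rs'" for \<tau> rs'
  proof -
    note \<tau>h = K.rep_class_mem_hom[OF \<sigma> \<tau>]
    obtain V where V: "isometric s s V" "\<And>k. k \<in> K \<Longrightarrow> \<sigma> k * V = V * \<tau> k"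
      by (rule K.rep_equivE[OF \<sigma> \<tau>h(2)]) auto
    have ind': "induced_via G K s \<tau> N \<rho> (E * V)"
      by (rule induced_via_equiv[OF \<rho> \<sigma> ind V(1) _ V(2)]) (use K.unitary_homD(1)[OF \<tau>h(1)] in auto)
    have "length rs' = length rs"
      using transversal_length_le[OF rs rs'] transversal_length_le[OF rs' rs] by simp
    then have "rep_equiv G \<rho> (induced_rep G K rs' s \<tau>)"
      using induced_rep_equiv[OF \<rho> \<tau>h(1) ind' rs'] N by simp
    then show ?thesis
      using rep_class_eq_iff[OF \<rho> induced_rep_hom[OF rs' \<tau>h(1)]] K.unitary_homD(9)[OF \<tau>h(1)]
      by (simp add: rep_dim_def)
  qed
  show ?thesis
    unfolding dual_induce_def
  proof (rule equalityI)
    show "(\<Union>\<tau>\<in>rep_class GK \<sigma>. \<Union>rs'\<in>{rs. left_transversal G K rs}.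
        rep_class G (induced_rep G K rs' (rep_dim G \<tau>) \<tau>)) \<subseteq> rep_class G \<rho>"
      by (intro UN_least) (simp add: eq)
    show "rep_class G \<rho> \<subseteq> (\<Union>\<tau>\<in>rep_class GK \<sigma>. \<Union>rs'\<in>{rs. left_transversal G K rs}.
        rep_class G (induced_rep G K rs' (rep_dim G \<tau>) \<tau>))"
      using K.rep_class_self[OF \<sigma>] rs eq[OF K.rep_class_self[OF \<sigma>] rs] by (intro subsetI UN_I) auto
  qed
qed

text \<open>A single representation is induced from \<open>\<sigma>\<close> via \<open>E\<close> and
  from the conjugate via the translate of \<open>E\<close> by \<open>g\<close>.\<close>

lemma dual_induce_conj:
  assumes \<sigma>: "\<sigma> \<in> hom GK (unitary_group s)" and g: "g \<in> carrier G" and rs: "left_transversal G K rs"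
  shows "dual_induce G K (rep_class GK (conj_rep G g \<sigma>)) = dual_induce G K (rep_class GK \<sigma>)"
proof -
  let ?\<rho> = "induced_rep G K rs s \<sigma>"
  note \<rho> = induced_rep_hom[OF rs \<sigma>]
  obtain E where E: "induced_via G K s \<sigma> (length rs * s) ?\<rho> E" by (rule induced_rep_via[OF rs \<sigma>])
  show ?thesis
    using dual_induce_class[OF \<rho> \<sigma> E rs refl]
      dual_induce_class[OF \<rho> conj_rep_hom[OF \<sigma> g] induced_via_conj[OF \<rho> \<sigma> E g] rs refl] by simp
qed

text \<open>Both small representations are placed inside one induced space. The copy
  \<open>E'\<close> of \<open>\<sigma>'\<close> is nonzero, so it is not orthogonal to all
  translates of \<open>E\<close>; projecting it to such a translate gives a nonzero intertwiner with
  a conjugate of \<open>\<sigma>\<close>, and \<open>schur_equiv\<close> applies.\<close>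

lemma dual_induce_inj:
  assumes \<sigma>: "\<sigma> \<in> hom GK (unitary_group s)" and irr: "irreducible_rep GK \<sigma>"
    and \<sigma>': "\<sigma>' \<in> hom GK (unitary_group s')" and irr': "irreducible_rep GK \<sigma>'"
    and rs: "left_transversal G K rs"
    and eq: "dual_induce G K (rep_class GK \<sigma>) = dual_induce G K (rep_class GK \<sigma>')"
  obtains g where "g \<in> carrier G" "rep_equiv GK (conj_rep G g \<sigma>) \<sigma>'"
proof -
  let ?N = "length rs * s" and ?\<rho> = "induced_rep G K rs s \<sigma>" and ?\<rho>' = "induced_rep G K rs s' \<sigma>'"
  note \<rho> = induced_rep_hom[OF rs \<sigma>] and \<rho>' = induced_rep_hom[OF rs \<sigma>']
  obtain E where E: "induced_via G K s \<sigma> ?N ?\<rho> E" by (rule induced_rep_via[OF rs \<sigma>])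
  obtain E0 where E0: "induced_via G K s' \<sigma>' (length rs * s') ?\<rho>' E0" by (rule induced_rep_via[OF rs \<sigma>'])
  have "rep_class G ?\<rho>' = rep_class G ?\<rho>"
    using eq dual_induce_class[OF \<rho> \<sigma> E rs refl] dual_induce_class[OF \<rho>' \<sigma>' E0 rs refl] by simp
  then have "rep_equiv G ?\<rho> ?\<rho>'" using rep_class_eq_iff[OF \<rho> \<rho>'] by simp
  then obtain V where V: "isometric ?N ?N V" "\<And>h. h \<in> carrier G \<Longrightarrow> ?\<rho> h * V = V * ?\<rho>' h"
    "?\<rho>' \<in> hom G (unitary_group ?N)" by (rule rep_equivE[OF \<rho>]) blast
  \<comment> \<open>Equivalent representations have the same dimension, so both live on one space
    although \<open>s = s'\<close> is not yet known.\<close>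
  have NN: "length rs * s' = ?N" using unitary_homD(9)[OF V(3)] unitary_homD(9)[OF \<rho>'] by simp
  define E' where "E' = V * E0"
  have E': "induced_via G K s' \<sigma>' ?N ?\<rho> E'"
    unfolding E'_def by (rule induced_via_transport[OF V(3) \<sigma>' E0[unfolded NN] V(1) \<rho> V(2)])
  then have E'i: "isometric ?N s' E'" by (simp add: induced_via_def)
  let ?F = "\<lambda>p. ?\<rho> (rs ! p) * E"
  have Ei: "isometric ?N s E" using E by (simp add: induced_via_def)
  have F: "?F p \<in> carrier_mat ?N s" if "p < length rs" for p
    using mult_carrier_mat[OF unitary_homD(1)[OF \<rho> transversal_mem[OF rs that]] isometricD(1)[OF Ei]] .
  have s': "s' > 0" using irr' K.irreducible_iff[OF \<sigma>'] by blast
  have "E' \<noteq> 0\<^sub>m ?N s'"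
  proof
    assume "E' = 0\<^sub>m ?N s'"
    then have "(1\<^sub>m s' :: complex mat) = 0\<^sub>m s' s'" using isometricD[OF E'i] by simp
    from arg_cong[OF this, of "\<lambda>A. A $$ (0, 0)"] show False using s' by simp
  qed
  then obtain p where p: "p < length rs" "mat_adjoint (?F p) * E' \<noteq> 0\<^sub>m s s'"
    using frame_complete[OF F induced_via_frame[OF \<rho> E rs] refl isometricD(1)[OF E'i]] by blast
  note rp = transversal_mem[OF rs p(1)]
  note \<sigma>p = conj_rep_hom[OF \<sigma> rp] and Fp = induced_via_conj[OF \<rho> \<sigma> E rp]
  define P where "P = ?F p"
  have P: "P \<in> carrier_mat ?N s" unfolding P_def by (rule F[OF p(1)])
  let ?X = "mat_adjoint P * E'"
  have X: "?X \<in> carrier_mat s s'" using P isometricD(1)[OF E'i] by (intro mult_carrier_mat[of _ _ ?N]) auto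
  have inter: "conj_rep G (rs ! p) \<sigma> k * ?X = ?X * \<sigma>' k" if k: "k \<in> carrier GK" for k
  proof -
    have kK: "k \<in> K" and kG: "k \<in> carrier G" using k by auto
    note c = K.unitary_homD(1)[OF \<sigma>p k] K.unitary_homD(1)[OF \<sigma>' k] P isometricD(1)[OF E'i]
      unitary_homD(1)[OF \<rho> kG]
    have adj: "mat_adjoint P * ?\<rho> k = conj_rep G (rs ! p) \<sigma> k * mat_adjoint P"
      by (rule K.intertwiner_adjoint[OF restrict_hom[OF \<rho>] \<sigma>p P _ k])
         (use Fp in \<open>auto simp: induced_via_def P_def\<close>)
    have "conj_rep G (rs ! p) \<sigma> k * ?X = (conj_rep G (rs ! p) \<sigma> k * mat_adjoint P) * E'"
      using c by (simp add: mat_assoc)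
    also have "\<dots> = mat_adjoint P * (?\<rho> k * E')" unfolding adj[symmetric] using c by (simp add: mat_assoc)
    also have "?\<rho> k * E' = E' * \<sigma>' k" using E' kK by (simp add: induced_via_def)
    finally show ?thesis using c by (simp add: mat_assoc)
  qed
  \<comment> \<open>Conjugation permutes \<open>K\<close>, so the conjugate has the same invariant
    frames as \<open>\<sigma>\<close>.\<close>
  have irrp: "irreducible_rep GK (conj_rep G (rs ! p) \<sigma>)"
  proof (rule K.irreducibleI_isometric[OF \<sigma>p])
    show "s > 0" using irr K.irreducible_iff[OF \<sigma>] by blast
    fix r Q assume Q: "isometric s r Q"
      and inv: "\<forall>h\<in>carrier GK. \<exists>M\<in>carrier_mat r r. conj_rep G (rs ! p) \<sigma> h * Q = Q * M"
    show "r = 0 \<or> r = s"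
    proof (rule K.irreducible_isometric[OF \<sigma> irr Q])
      fix h assume h: "h \<in> carrier GK"
      then have "rs ! p \<otimes> h \<otimes> inv (rs ! p) \<in> K" using K_conj[OF rp] by simp
      then have "\<exists>M\<in>carrier_mat r r. conj_rep G (rs ! p) \<sigma> (rs ! p \<otimes> h \<otimes> inv (rs ! p)) * Q = Q * M"
        using inv by simp
      moreover have "inv (rs ! p) \<otimes> (rs ! p \<otimes> h \<otimes> inv (rs ! p)) \<otimes> rs ! p = h" using h rp by (simp add: m_assoc)
      ultimately show "\<exists>M\<in>carrier_mat r r. \<sigma> h * Q = Q * M" by (simp add: conj_rep_def)
    qed
  qed
  show ?thesis
    by (rule that[OF rp K.schur_equiv[OF \<sigma>p irrp \<sigma>' irr' X p(2)[folded P_def] inter]])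
qed

end

section \<open>Induction from the centralizer of an abelian normal subgroup\<close>

text \<open>Turns the existence of a fixed vector into a polynomial condition on the matrix entries,
  which \<open>fixing_measurable\<close> can handle.\<close>

lemma det_minus_one_eq_0_iff:
  assumes M: "(M :: complex mat) \<in> carrier_mat n n"
  shows "det (M - 1\<^sub>m n) = 0 \<longleftrightarrow> (\<exists>v\<in>carrier_vec n. v \<noteq> 0\<^sub>v n \<and> M *\<^sub>v v = v)"
proof -
  have "(M - 1\<^sub>m n) *\<^sub>v v = 0\<^sub>v n \<longleftrightarrow> M *\<^sub>v v = v" if v: "v \<in> carrier_vec n" for v
  proof -
    have "(M - 1\<^sub>m n) *\<^sub>v v = M *\<^sub>v v - v"
      using minus_mult_distrib_mat_vec[OF M one_carrier_mat v] v by simp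
    moreover have "w - v = 0\<^sub>v n \<longleftrightarrow> w = v" if w: "w \<in> carrier_vec n" for w
    proof
      assume eq: "w - v = 0\<^sub>v n"
      show "w = v"
      proof (rule eq_vecI)
        fix i assume "i < dim_vec v"
        then have "(w - v) $ i = w $ i - v $ i" "i < n" using v by auto
        then show "w $ i = v $ i" using eq by simp
      qed (use v w in auto)
    qed (use v in auto)
    moreover have "M *\<^sub>v v \<in> carrier_vec n" using mult_mat_vec_carrier[OF M v] .
    ultimately show ?thesis by simp
  qed
  then show ?thesis
    unfolding det_0_iff_vec_prod_zero[OF minus_carrier_mat[OF one_carrier_mat], of M] by blast
qed

text \<open>\<open>A_central\<close> and \<open>centralizer\<close> together say that
  \<open>K\<close> is the centralizer of \<open>A\<close>; since \<open>A\<close> lies in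
  \<open>K\<close>, it is abelian.\<close>

locale central_extension = normal_subgroup G K for G (structure) and K +
  fixes A :: "'a set"
  assumes A_normal: "A \<lhd> G" and A_subset: "A \<subseteq> K"
    and A_central: "a \<in> A \<Longrightarrow> k \<in> K \<Longrightarrow> a \<otimes> k = k \<otimes> a"
    and centralizer: "h \<in> carrier G \<Longrightarrow> (\<And>a. a \<in> A \<Longrightarrow> h \<otimes> a = a \<otimes> h) \<Longrightarrow> h \<in> K"
    and finite_index: "\<exists>rs. left_transversal G K rs"
begin

lemma A_K [simp]: "a \<in> A \<Longrightarrow> a \<in> K" using A_subset by blast

lemma A_subgroup: "subgroup A G" using A_normal by (simp add: normal_def)

lemma A_closed [simp]: "x \<in> A \<Longrightarrow> y \<in> A \<Longrightarrow> x \<otimes> y \<in> A" "x \<in> A \<Longrightarrow> inv x \<in> A" "\<one> \<in> A"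
  using subgroup.m_closed[OF A_subgroup] subgroup.m_inv_closed[OF A_subgroup] subgroup.one_closed[OF A_subgroup]
  by auto

lemma A_conj: "g \<in> carrier G \<Longrightarrow> a \<in> A \<Longrightarrow> inv g \<otimes> a \<otimes> g \<in> A"
  using normal_inv_iff[of A] A_normal inv_closed[of g] by (metis inv_inv)

lemma conj_eq_one_iff:
  assumes "g \<in> carrier G" "a \<in> A"
  shows "inv g \<otimes> a \<otimes> g = \<one> \<longleftrightarrow> a = \<one>"
proof
  have a: "a \<in> carrier G" using assms by simp
  assume "inv g \<otimes> a \<otimes> g = \<one>"
  then have "g \<otimes> (inv g \<otimes> a \<otimes> g) \<otimes> inv g = \<one>" using assms by simp
  then show "a = \<one>" using assms a by (simp add: m_assoc)
qed (use assms in simp)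

definition scalar_on :: "nat \<Rightarrow> ('a \<Rightarrow> complex mat) \<Rightarrow> ('a \<Rightarrow> complex) \<Rightarrow> bool" where
  "scalar_on s \<sigma> \<chi> \<longleftrightarrow> (\<forall>a\<in>A. \<sigma> a = \<chi> a \<cdot>\<^sub>m 1\<^sub>m s)"

text \<open>For a homomorphism on \<open>A\<close> this is injectivity, stated through the
  kernel.\<close>

definition free_char :: "('a \<Rightarrow> complex) \<Rightarrow> bool" where
  "free_char \<chi> \<longleftrightarrow> (\<forall>a\<in>A. a \<noteq> \<one> \<longrightarrow> \<chi> a \<noteq> 1)"

text \<open>By \<open>det_minus_one_eq_0_iff\<close>: no nontrivial element of \<open>A\<close>
  fixes a nonzero vector.\<close>

definition free_rep :: "nat \<Rightarrow> ('a \<Rightarrow> complex mat) \<Rightarrow> bool" where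
  "free_rep N \<rho> \<longleftrightarrow> (\<forall>a\<in>A. a \<noteq> \<one> \<longrightarrow> det (\<rho> a - 1\<^sub>m N) \<noteq> 0)"

lemma smult_one_eq_iff: "s > 0 \<Longrightarrow> c \<cdot>\<^sub>m 1\<^sub>m s = (c' \<cdot>\<^sub>m 1\<^sub>m s :: complex mat) \<longleftrightarrow> c = c'"
proof
  assume "s > 0" "c \<cdot>\<^sub>m 1\<^sub>m s = (c' \<cdot>\<^sub>m 1\<^sub>m s :: complex mat)"
  then have "(c \<cdot>\<^sub>m 1\<^sub>m s) $$ (0, 0) = (c' \<cdot>\<^sub>m 1\<^sub>m s :: complex mat) $$ (0, 0)" by simp
  then show "c = c'" using \<open>s > 0\<close> by simp
qed simp

lemma scalar_on_char:
  assumes \<sigma>: "\<sigma> \<in> hom GK (unitary_group s)" and s: "s > 0" and sc: "scalar_on s \<sigma> \<chi>"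
  shows "a \<in> A \<Longrightarrow> b \<in> A \<Longrightarrow> \<chi> (a \<otimes> b) = \<chi> a * \<chi> b" "\<chi> \<one> = 1" "a \<in> A \<Longrightarrow> cmod (\<chi> a) = 1"
proof -
  show "\<chi> (a \<otimes> b) = \<chi> a * \<chi> b" if "a \<in> A" "b \<in> A" for a b
  proof -
    have "\<sigma> (a \<otimes> b) = \<sigma> a * \<sigma> b" using K.unitary_homD(7)[OF \<sigma>, of a b] that by simp
    then have "\<chi> (a \<otimes> b) \<cdot>\<^sub>m 1\<^sub>m s = (\<chi> a * \<chi> b) \<cdot>\<^sub>m 1\<^sub>m s"
      using sc that
      by (simp add: scalar_on_def mat_smult_left mat_smult_right mat_smult_smult mult.commute)
    then show ?thesis using smult_one_eq_iff[OF s] by simp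
  qed
  have "\<chi> \<one> \<cdot>\<^sub>m 1\<^sub>m s = 1 \<cdot>\<^sub>m 1\<^sub>m s"
    using K.unitary_homD(8)[OF \<sigma>] sc A_closed(3) by (auto simp: scalar_on_def intro!: eq_matI)
  then show "\<chi> \<one> = 1" using smult_one_eq_iff[OF s] by simp
  show "cmod (\<chi> a) = 1" if a: "a \<in> A" for a
  proof -
    have "\<sigma> a * mat_adjoint (\<sigma> a) = 1\<^sub>m s" using K.unitary_homD(5)[OF \<sigma>, of a] a by simp
    then have "(\<chi> a * cnj (\<chi> a)) \<cdot>\<^sub>m 1\<^sub>m s = 1 \<cdot>\<^sub>m 1\<^sub>m s"
      using sc a by (simp add: scalar_on_def mat_smult_left mat_smult_right mat_smult_smult mat_adjoint_smult mult.commute)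
        (auto intro!: eq_matI)
    then have "\<chi> a * cnj (\<chi> a) = 1" using smult_one_eq_iff[OF s] by simp
    then have "complex_of_real ((cmod (\<chi> a))\<^sup>2) = 1" using complex_norm_square[of "\<chi> a"] by simp
    then have "(cmod (\<chi> a))\<^sup>2 = 1" by (simp only: of_real_eq_1_iff)
    then show ?thesis by (simp add: power2_eq_1_iff) (smt (verit) norm_ge_zero)
  qed
qed

lemma scalar_on_exists:
  assumes \<sigma>: "\<sigma> \<in> hom GK (unitary_group s)" and irr: "irreducible_rep GK \<sigma>"
  obtains \<chi> where "scalar_on s \<sigma> \<chi>"
proof -
  have "\<exists>c. \<sigma> a = c \<cdot>\<^sub>m 1\<^sub>m s" if a: "a \<in> A" for a
  proof -
    have comm: "\<sigma> k * \<sigma> a = \<sigma> a * \<sigma> k" if k: "k \<in> carrier GK" for k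
      using K.unitary_homD(7)[OF \<sigma>, of k a] K.unitary_homD(7)[OF \<sigma>, of a k] a k A_central[OF a, of k] by simp
    have "\<sigma> a \<in> carrier_mat s s" using K.unitary_homD(1)[OF \<sigma>, of a] a by simp
    from K.schur_scalar[OF \<sigma> irr this comm] show ?thesis by blast
  qed
  then show ?thesis using that unfolding scalar_on_def by metis
qed

text \<open>A character of \<open>A\<close> that is injective separates the conjugates of \<open>A\<close> under distinct cosets,
  because \<open>K\<close> is the centralizer of \<open>A\<close>.\<close>

lemma free_char_separates:
  assumes \<sigma>: "\<sigma> \<in> hom GK (unitary_group s)" and s: "s > 0" and sc: "scalar_on s \<sigma> \<chi>"
    and free: "free_char \<chi>" and x: "x \<in> carrier G" and y: "y \<in> carrier G" and xy: "inv x \<otimes> y \<notin> K"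
  obtains a where "a \<in> A" "\<chi> (inv x \<otimes> a \<otimes> x) \<noteq> \<chi> (inv y \<otimes> a \<otimes> y)"
proof (rule ccontr)
  note ch = scalar_on_char[OF \<sigma> s sc]
  assume "\<not> thesis"
  note witness = that
  have eq: "\<chi> (inv x \<otimes> a \<otimes> x) = \<chi> (inv y \<otimes> a \<otimes> y)" if "a \<in> A" for a
    using witness[OF that] \<open>\<not> thesis\<close> by blast
  have "(y \<otimes> inv x) \<otimes> a = a \<otimes> (y \<otimes> inv x)" if a: "a \<in> A" for a
  proof -
    have aG: "a \<in> carrier G" using a by simp
    let ?b = "inv x \<otimes> a \<otimes> x" and ?c = "inv y \<otimes> a \<otimes> y"
    have bc: "?b \<in> A" "?c \<in> A" using A_conj[OF x a] A_conj[OF y a] by auto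
    \<comment> \<open>Agreement of the two values puts \<open>?c \<otimes> inv ?b\<close> into the
      kernel of \<open>\<chi>\<close>, so \<open>?b = ?c\<close>; for all \<open>a\<close> this says
      that \<open>y \<otimes> inv x\<close> centralizes \<open>A\<close>.\<close>
    have "\<chi> (?c \<otimes> inv ?b) = \<chi> ?b * \<chi> (inv ?b)" using ch(1)[of ?c "inv ?b"] bc eq[OF a] by simp
    also have "\<dots> = \<chi> (?b \<otimes> inv ?b)" using ch(1)[of ?b "inv ?b"] bc(1) A_closed(2)[OF bc(1)] by simp
    also have "\<dots> = 1" using bc(1) x aG ch(2) by simp
    finally have "\<chi> (?c \<otimes> inv ?b) = 1" .
    then have "?c \<otimes> inv ?b = \<one>"
      using free A_closed(1)[OF bc(2) A_closed(2)[OF bc(1)]] unfolding free_char_def by blast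
    then have "?c \<otimes> inv ?b \<otimes> ?b = ?b" using x y aG by simp
    then have "?c = ?b" using x y aG by (simp add: m_assoc)
    then have "y \<otimes> (?c \<otimes> inv x) = y \<otimes> (?b \<otimes> inv x)" by simp
    then show ?thesis using x y aG by (simp add: m_assoc)
  qed
  then have "y \<otimes> inv x \<in> K" using x y by (intro centralizer) auto
  then have "inv x \<otimes> (y \<otimes> inv x) \<otimes> x \<in> K" by (rule K_conj'[OF x])
  then show False using xy x y by (simp add: m_assoc)
qed

text \<open>The range of \<open>\<rho> r * E\<close> carries the conjugate of
  \<open>\<sigma>\<close> by \<open>r\<close>, on which \<open>A\<close> acts by the conjugated
  character. In its adjoint form it tells how the component of a vector in that block changes under
  \<open>a\<close>.\<close>

lemma induced_frame_scalar:
  assumes \<rho>: "\<rho> \<in> hom G (unitary_group N)" and \<sigma>: "\<sigma> \<in> hom GK (unitary_group s)"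
    and ind: "induced_via G K s \<sigma> N \<rho> E" and sc: "scalar_on s \<sigma> \<chi>" and r: "r \<in> carrier G" and a: "a \<in> A"
  shows "mat_adjoint (\<rho> r * E) * \<rho> a = \<chi> (inv r \<otimes> a \<otimes> r) \<cdot>\<^sub>m mat_adjoint (\<rho> r * E)"
proof -
  have Ei: "isometric N s E" using ind by (simp add: induced_via_def)
  define P where "P = \<rho> r * E"
  have P: "P \<in> carrier_mat N s"
    unfolding P_def by (rule mult_carrier_mat[OF unitary_homD(1)[OF \<rho> r] isometricD(1)[OF Ei]])
  have "mat_adjoint P * \<rho> a = conj_rep G r \<sigma> a * mat_adjoint P"
  proof (rule K.intertwiner_adjoint[OF restrict_hom[OF \<rho>] conj_rep_hom[OF \<sigma> r] P])
    show "\<rho> k * P = P * conj_rep G r \<sigma> k" if "k \<in> carrier GK" for k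
      using induced_via_conj[OF \<rho> \<sigma> ind r] that unfolding induced_via_def P_def by simp
  qed (use a in simp)
  also have "conj_rep G r \<sigma> a = \<chi> (inv r \<otimes> a \<otimes> r) \<cdot>\<^sub>m 1\<^sub>m s"
    using sc A_conj[OF r a] by (simp add: conj_rep_def scalar_on_def)
  also have "\<dots> * mat_adjoint P = \<chi> (inv r \<otimes> a \<otimes> r) \<cdot>\<^sub>m mat_adjoint P"
    using P by (simp add: mat_smult_left mat_one_left)
  finally show ?thesis unfolding P_def .
qed

text \<open>Every block component of a vector fixed by \<open>a\<close> is multiplied by a value of
  \<open>\<chi>\<close> other than 1, so it vanishes; the components determine the vector.\<close>

lemma induced_free:
  assumes \<rho>: "\<rho> \<in> hom G (unitary_group N)" and \<sigma>: "\<sigma> \<in> hom GK (unitary_group s)"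
    and ind: "induced_via G K s \<sigma> N \<rho> E" and rs: "left_transversal G K rs" and N: "N = length rs * s"
    and sc: "scalar_on s \<sigma> \<chi>" and free: "free_char \<chi>"
  shows "free_rep N \<rho>"
  unfolding free_rep_def
proof (intro ballI impI)
  have Ei: "isometric N s E" using ind by (simp add: induced_via_def)
  fix a assume a: "a \<in> A" and a1: "a \<noteq> \<one>"
  have \<rho>a: "\<rho> a \<in> carrier_mat N N" using unitary_homD(1)[OF \<rho>, of a] a by simp
  let ?F = "\<lambda>p. \<rho> (rs ! p) * E"
  have F: "?F p \<in> carrier_mat N s" if "p < length rs" for p
    using mult_carrier_mat[OF unitary_homD(1)[OF \<rho> transversal_mem[OF rs that]] isometricD(1)[OF Ei]] .
  have "v = 0\<^sub>v N" if v: "v \<in> carrier_vec N" "\<rho> a *\<^sub>v v = v" for v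
  proof (rule frame_complete_vec[OF F induced_via_frame[OF \<rho> ind rs] N v(1)])
    fix p assume p: "p < length rs"
    note rp = transversal_mem[OF rs p]
    define P where "P = ?F p"
    have P: "P \<in> carrier_mat N s" unfolding P_def by (rule F[OF p])
    define c where "c = \<chi> (inv (rs ! p) \<otimes> a \<otimes> rs ! p)"
    have c: "c \<noteq> 1"
      using free A_conj[OF rp a] conj_eq_one_iff[OF rp a] a1 unfolding free_char_def c_def by blast
    have "mat_adjoint P *\<^sub>v v = mat_adjoint P *\<^sub>v (\<rho> a *\<^sub>v v)" using v(2) by simp
    also have "\<dots> = (mat_adjoint P * \<rho> a) *\<^sub>v v" using P \<rho>a v(1) by (simp add: mat_vec_assoc)
    also have "\<dots> = c \<cdot>\<^sub>v (mat_adjoint P *\<^sub>v v)"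
      unfolding P_def c_def induced_frame_scalar[OF \<rho> \<sigma> ind sc rp a]
      using v(1) F[OF p] by (intro smult_mat_vec) auto
    finally have eq: "mat_adjoint P *\<^sub>v v = c \<cdot>\<^sub>v (mat_adjoint P *\<^sub>v v)" .
    show "mat_adjoint (?F p) *\<^sub>v v = 0\<^sub>v s"
      unfolding P_def[symmetric]
    proof (rule eq_vecI)
      fix i assume "i < dim_vec (0\<^sub>v s :: complex vec)"
      then have "(mat_adjoint P *\<^sub>v v) $ i = c * (mat_adjoint P *\<^sub>v v) $ i"
        using arg_cong[OF eq, of "\<lambda>w. w $ i"] P by simp
      then have "(c - 1) * (mat_adjoint P *\<^sub>v v) $ i = 0" by (simp add: algebra_simps)
      then show "(mat_adjoint P *\<^sub>v v) $ i = 0\<^sub>v s $ i" using c \<open>i < dim_vec (0\<^sub>v s :: complex vec)\<close> by simp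
    qed (use P in simp)
  qed
  then show "det (\<rho> a - 1\<^sub>m N) \<noteq> 0" using det_minus_one_eq_0_iff[OF \<rho>a] by blast
qed

text \<open>A nonzero vector of an invariant subspace with components in as few blocks as possible lies in
  a single block, since the blocks carry distinct characters of \<open>A\<close>.\<close>

lemma induced_irreducible:
  assumes \<rho>: "\<rho> \<in> hom G (unitary_group N)" and \<sigma>: "\<sigma> \<in> hom GK (unitary_group s)"
    and irr: "irreducible_rep GK \<sigma>"
    and ind: "induced_via G K s \<sigma> N \<rho> E" and rs: "left_transversal G K rs" and N: "N = length rs * s"
    and sc: "scalar_on s \<sigma> \<chi>" and free: "free_char \<chi>"
  shows "irreducible_rep G \<rho>"
proof -
  have s: "s > 0" using irr K.irreducible_iff[OF \<sigma>] by blast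
  have "length rs > 0" using transversal_ex1[OF rs one_closed] by auto
  then have N0: "N > 0" using N s by simp
  have Ei: "isometric N s E" using ind by (simp add: induced_via_def)
  define F where "F p = \<rho> (rs ! p) * E" for p
  have F: "F p \<in> carrier_mat N s" if "p < length rs" for p
    unfolding F_def
    using mult_carrier_mat[OF unitary_homD(1)[OF \<rho> transversal_mem[OF rs that]] isometricD(1)[OF Ei]] .
  have orth: "mat_adjoint (F p) * F q = (if p = q then 1\<^sub>m s else 0\<^sub>m s s)" if "p < length rs" "q < length rs" for p q
    unfolding F_def by (rule induced_via_frame[OF \<rho> ind rs that])
  have complete: "v = 0\<^sub>v N"
    if "v \<in> carrier_vec N" "\<And>p. p < length rs \<Longrightarrow> mat_adjoint (F p) *\<^sub>v v = 0\<^sub>v s" for v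
    by (rule frame_complete_vec[of "length rs" F N s]) (use F orth N that in auto)
  show ?thesis
    unfolding irreducible_iff[OF \<rho>]
  proof (intro conjI N0 allI impI, elim conjE)
    fix W assume W: "lin_subspace N W" and Winv: "\<forall>h\<in>carrier G. \<forall>w\<in>W. \<rho> h *\<^sub>v w \<in> W"
    have Wc: "w \<in> carrier_vec N" if "w \<in> W" for w using lin_subspaceD(1)[OF W that] .
    show "W = {0\<^sub>v N} \<or> W = carrier_vec N"
    proof (rule disjCI)
      assume "W \<noteq> carrier_vec N"
      show "W = {0\<^sub>v N}"
      proof (rule ccontr)
        assume "W \<noteq> {0\<^sub>v N}"
        then obtain w0 where w0: "w0 \<in> W \<and> w0 \<noteq> 0\<^sub>v N" using lin_subspaceD(2)[OF W] by blast
        define supp where "supp w = {p. p < length rs \<and> mat_adjoint (F p) *\<^sub>v w \<noteq> 0\<^sub>v s}" for w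
        have fin: "finite (supp w)" for w unfolding supp_def by simp
        obtain w where w: "w \<in> W" "w \<noteq> 0\<^sub>v N"
          and min: "\<And>w'. w' \<in> W \<Longrightarrow> w' \<noteq> 0\<^sub>v N \<Longrightarrow> card (supp w) \<le> card (supp w')"
          using ex_has_least_nat[of "\<lambda>w. w \<in> W \<and> w \<noteq> 0\<^sub>v N" w0 "\<lambda>w. card (supp w)", OF w0] by blast
        note wc = Wc[OF w(1)]
        obtain p where p: "p \<in> supp w" using complete[OF wc] w(2) unfolding supp_def by blast
        then have pl: "p < length rs" by (simp add: supp_def)
        have single: "q = p" if q: "q \<in> supp w" for q
        proof (rule ccontr)
          assume "q \<noteq> p"
          have ql: "q < length rs" using q by (simp add: supp_def)
          note rp = transversal_mem[OF rs pl] and rq = transversal_mem[OF rs ql]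
          have "inv (rs ! p) \<otimes> rs ! q \<notin> K" using transversal_diff_iff[OF rs pl ql] \<open>q \<noteq> p\<close> by simp
          then obtain a where a: "a \<in> A"
            and ne: "\<chi> (inv (rs ! p) \<otimes> a \<otimes> rs ! p) \<noteq> \<chi> (inv (rs ! q) \<otimes> a \<otimes> rs ! q)"
            using free_char_separates[OF \<sigma> s sc free rp rq] by blast
          define c where "c = (\<lambda>r. \<chi> (inv (rs ! r) \<otimes> a \<otimes> rs ! r))"
          have \<rho>a: "\<rho> a \<in> carrier_mat N N" using unitary_homD(1)[OF \<rho>, of a] a by simp
          \<comment> \<open>Subtracting the value at \<open>p\<close> kills the component in block
            \<open>p\<close>, while \<open>c q \<noteq> c p\<close> keeps the one in block
            \<open>q\<close>; the result contradicts minimality.\<close>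
          define w' where "w' = \<rho> a *\<^sub>v w - c p \<cdot>\<^sub>v w"
          have w'W: "w' \<in> W"
            unfolding w'_def using Winv a w(1) lin_subspaceD(4)[OF W] by (intro lin_subspace_minus[OF W]) auto
          have comp: "mat_adjoint (F r) *\<^sub>v w' = (c r - c p) \<cdot>\<^sub>v (mat_adjoint (F r) *\<^sub>v w)" if r: "r < length rs" for r
          proof -
            note Fr = F[OF r]
            have Fa: "mat_adjoint (F r) \<in> carrier_mat s N" using Fr by simp
            have "mat_adjoint (F r) *\<^sub>v w' = mat_adjoint (F r) *\<^sub>v (\<rho> a *\<^sub>v w) - mat_adjoint (F r) *\<^sub>v (c p \<cdot>\<^sub>v w)"
              unfolding w'_def using \<rho>a wc by (intro mult_minus_distrib_mat_vec[OF Fa]) auto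
            also have "mat_adjoint (F r) *\<^sub>v (\<rho> a *\<^sub>v w) = (mat_adjoint (F r) * \<rho> a) *\<^sub>v w"
              using Fr \<rho>a wc by (simp add: mat_vec_assoc)
            also have "\<dots> = c r \<cdot>\<^sub>v (mat_adjoint (F r) *\<^sub>v w)"
              unfolding F_def c_def induced_frame_scalar[OF \<rho> \<sigma> ind sc transversal_mem[OF rs r] a]
              using wc Fr[unfolded F_def] by (intro smult_mat_vec) auto
            also have "mat_adjoint (F r) *\<^sub>v (c p \<cdot>\<^sub>v w) = c p \<cdot>\<^sub>v (mat_adjoint (F r) *\<^sub>v w)"
              by (rule mult_mat_vec[OF Fa wc])
            finally show ?thesis using Fa by (intro eq_vecI) (auto simp: algebra_simps)
          qed
          have Fwc: "mat_adjoint (F r) *\<^sub>v w \<in> carrier_vec s" if "r < length rs" for r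
            using F[OF that] wc by (intro mult_mat_vec_carrier) auto
          have sub: "supp w' \<subseteq> supp w - {p}"
          proof
            fix r assume r: "r \<in> supp w'"
            then have rl: "r < length rs" by (simp add: supp_def)
            show "r \<in> supp w - {p}"
            proof -
              have "0 \<cdot>\<^sub>v (mat_adjoint (F r) *\<^sub>v w) = 0\<^sub>v s" using F[OF rl] by (intro eq_vecI) auto
              then have "c r \<noteq> c p" using r comp[OF rl] by (auto simp: supp_def)
              moreover have "mat_adjoint (F r) *\<^sub>v w \<noteq> 0\<^sub>v s"
              proof
                assume "mat_adjoint (F r) *\<^sub>v w = 0\<^sub>v s"
                then show False using r comp[OF rl] by (auto simp: supp_def)
              qed
              ultimately show ?thesis using rl by (auto simp: supp_def)
            qed
          qed
          have "w' \<noteq> 0\<^sub>v N"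
          proof
            assume "w' = 0\<^sub>v N"
            then have "mat_adjoint (F q) *\<^sub>v w' = 0\<^sub>v s" using F[OF ql] by (intro eq_vecI) auto
            then have "(c q - c p) \<cdot>\<^sub>v (mat_adjoint (F q) *\<^sub>v w) = 0\<^sub>v s" using comp[OF ql] by simp
            then have "(c q - c p) * (mat_adjoint (F q) *\<^sub>v w) $ i = 0" if "i < s" for i
              using that Fwc[OF ql] by (metis carrier_vecD index_smult_vec(1) index_zero_vec(1))
            moreover have "c q - c p \<noteq> 0" using ne by (simp add: c_def)
            ultimately have "(mat_adjoint (F q) *\<^sub>v w) $ i = 0" if "i < s" for i using that by fastforce
            then have "mat_adjoint (F q) *\<^sub>v w = 0\<^sub>v s" using F[OF ql] by (intro eq_vecI) auto
            then show False using q by (simp add: supp_def)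
          qed
          from min[OF w'W this] have "card (supp w) \<le> card (supp w - {p})"
            using card_mono[OF _ sub] fin[of w] by fastforce
          moreover have "card (supp w - {p}) < card (supp w)" using p fin by (intro psubset_card_mono) auto
          ultimately show False by simp
        qed
        define x where "x = mat_adjoint (F p) *\<^sub>v w"
        have x: "x \<in> carrier_vec s" unfolding x_def using F[OF pl] wc by (intro mult_mat_vec_carrier) auto
        have x0: "x \<noteq> 0\<^sub>v s" using p by (simp add: supp_def x_def)
        have w_eq: "w = F p *\<^sub>v x"
        proof -
          have Fx: "F p *\<^sub>v x \<in> carrier_vec N" using mult_mat_vec_carrier[OF F[OF pl] x] .
          have "w - F p *\<^sub>v x = 0\<^sub>v N"
          proof (rule complete)
            show "w - F p *\<^sub>v x \<in> carrier_vec N" using wc Fx by simp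
            fix r assume r: "r < length rs"
            have Fa: "mat_adjoint (F r) \<in> carrier_mat s N" using F[OF r] by simp
            have "mat_adjoint (F r) *\<^sub>v (w - F p *\<^sub>v x) = mat_adjoint (F r) *\<^sub>v w - mat_adjoint (F r) *\<^sub>v (F p *\<^sub>v x)"
              by (rule mult_minus_distrib_mat_vec[OF Fa wc Fx])
            also have "mat_adjoint (F r) *\<^sub>v (F p *\<^sub>v x) = (mat_adjoint (F r) * F p) *\<^sub>v x"
              by (rule assoc_mult_mat_vec[OF Fa F[OF pl] x, symmetric])
            also have "mat_adjoint (F r) *\<^sub>v w - (mat_adjoint (F r) * F p) *\<^sub>v x = 0\<^sub>v s"
            proof (cases "r = p")
              case True
              then show ?thesis using orth[OF pl pl] x by (simp add: x_def[symmetric])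
            next
              case False
              then have "mat_adjoint (F r) *\<^sub>v w = 0\<^sub>v s" using single r unfolding supp_def by blast
              moreover have "0\<^sub>m s s *\<^sub>v x = 0\<^sub>v s" using x by (intro eq_vecI) (auto simp: scalar_prod_def)
              ultimately show ?thesis using orth[OF r pl] False by simp
            qed
            finally show "mat_adjoint (F r) *\<^sub>v (w - F p *\<^sub>v x) = 0\<^sub>v s" .
          qed
          then have "(w - F p *\<^sub>v x) $ i = 0" if "i < N" for i using that by simp
          then show ?thesis using wc Fx F[OF pl] by (intro eq_vecI) auto
        qed
        note rp = transversal_mem[OF rs pl]
        have Ec: "E \<in> carrier_mat N s" by (rule isometricD(1)[OF Ei])
        have Fv: "F q *\<^sub>v y = \<rho> (rs ! q) *\<^sub>v (E *\<^sub>v y)" if "q < length rs" "y \<in> carrier_vec s" for q y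
          unfolding F_def by (rule assoc_mult_mat_vec[OF unitary_homD(1)[OF \<rho> transversal_mem[OF rs that(1)]] Ec that(2)])
        have ExW: "E *\<^sub>v x \<in> W"
        proof -
          have Ex: "E *\<^sub>v x \<in> carrier_vec N" using mult_mat_vec_carrier[OF Ec x] .
          have "\<rho> (inv (rs ! p)) *\<^sub>v w = (\<rho> (inv (rs ! p)) * \<rho> (rs ! p)) *\<^sub>v (E *\<^sub>v x)"
            unfolding w_eq Fv[OF pl x]
            using unitary_homD(1)[OF \<rho> rp] unitary_homD(1)[OF \<rho> inv_closed[OF rp]] Ex by (simp add: mat_vec_assoc)
          also have "\<dots> = E *\<^sub>v x" using unitary_homD(6,11)[OF \<rho> rp] Ex by simp
          finally show ?thesis using Winv rp w(1) by (metis inv_closed)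
        qed
        \<comment> \<open>The part of \<open>W\<close> inside the block of \<open>E\<close>, in the
          coordinates of \<open>\<sigma>\<close>. It is invariant under \<open>K\<close> and
          contains the nonzero \<open>x\<close>, so irreducibility of \<open>\<sigma>\<close> puts
          the whole block, and then all its translates, into \<open>W\<close>.\<close>
        define W' where "W' = {y \<in> carrier_vec s. E *\<^sub>v y \<in> W}"
        have "E *\<^sub>v 0\<^sub>v s = 0\<^sub>v N" using Ec by (intro eq_vecI) (auto simp: scalar_prod_def)
        then have "lin_subspace s W'"
          using lin_subspaceD[OF W] Ec unfolding lin_subspace_def W'_def
          by (auto simp: mult_add_distrib_mat_vec[OF Ec] mult_mat_vec[OF Ec])
        moreover have "\<forall>k\<in>carrier GK. \<forall>y\<in>W'. \<sigma> k *\<^sub>v y \<in> W'"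
        proof (intro ballI)
          fix k y assume k: "k \<in> carrier GK" and y: "y \<in> W'"
          have kK: "k \<in> K" and kG: "k \<in> carrier G" using k by auto
          have yc: "y \<in> carrier_vec s" and EyW: "E *\<^sub>v y \<in> W" using y by (auto simp: W'_def)
          note c = K.unitary_homD(1)[OF \<sigma> k] unitary_homD(1)[OF \<rho> kG]
          have "E *\<^sub>v (\<sigma> k *\<^sub>v y) = (\<rho> k * E) *\<^sub>v y"
            using ind kK assoc_mult_mat_vec[OF Ec c(1) yc] by (simp add: induced_via_def)
          also have "\<dots> = \<rho> k *\<^sub>v (E *\<^sub>v y)" by (rule assoc_mult_mat_vec[OF c(2) Ec yc])
          finally have "E *\<^sub>v (\<sigma> k *\<^sub>v y) \<in> W" using Winv kG EyW by simp
          then show "\<sigma> k *\<^sub>v y \<in> W'" using mult_mat_vec_carrier[OF c(1) yc] by (simp add: W'_def)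
        qed
        ultimately have "W' = {0\<^sub>v s} \<or> W' = carrier_vec s" using irr K.irreducible_iff[OF \<sigma>] by blast
        moreover have "x \<in> W'" using x ExW by (simp add: W'_def)
        ultimately have W': "W' = carrier_vec s" using x0 by auto
        have FW: "F q *\<^sub>v y \<in> W" if q: "q < length rs" and y: "y \<in> carrier_vec s" for q y
          unfolding Fv[OF q y] using Winv transversal_mem[OF rs q] W' y by (auto simp: W'_def)
        obtain r Q where Q: "isometric N r Q" and WQ: "W = {Q *\<^sub>v y | y. y \<in> carrier_vec r}"
          by (rule lin_subspace_range_isometric[OF W])
        note Qc = isometricD[OF Q]
        have proj: "(Q * mat_adjoint Q) *\<^sub>v v = v" if v: "v \<in> W" for v
        proof -
          obtain y where y: "v = Q *\<^sub>v y" "y \<in> carrier_vec r" using v WQ by blast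
          have "(Q * mat_adjoint Q) *\<^sub>v v = Q *\<^sub>v ((mat_adjoint Q * Q) *\<^sub>v y)"
            using y Qc(1) by (simp add: mat_vec_assoc)
          then show ?thesis using y Qc(3) by simp
        qed
        \<comment> \<open>The orthogonal projection to \<open>W\<close>. It fixes all blocks, so
          \<open>v - R *\<^sub>v v\<close> has no component in any block and vanishes.\<close>
        define R where "R = Q * mat_adjoint Q"
        have R: "R \<in> carrier_mat N N" unfolding R_def by (rule mult_carrier_mat[OF Qc(1,2)])
        have Radj: "mat_adjoint R = R" unfolding R_def using mat_adjoint_mult[OF Qc(1,2)] by simp
        have RF: "R * F q = F q" if q: "q < length rs" for q
        proof (rule mat_eq_by_vec[of _ N s])
          show "R * F q *\<^sub>v y = F q *\<^sub>v y" if y: "y \<in> carrier_vec s" for y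
            using assoc_mult_mat_vec[OF R F[OF q] y] proj[OF FW[OF q y]] by (simp add: R_def)
        qed (use R F[OF q] in auto)
        have FR: "mat_adjoint (F q) * R = mat_adjoint (F q)" if q: "q < length rs" for q
          using mat_adjoint_mult[OF R F[OF q]] RF[OF q] Radj by simp
        have "v \<in> W" if v: "v \<in> carrier_vec N" for v
        proof -
          have Rv: "R *\<^sub>v v \<in> carrier_vec N" by (rule mult_mat_vec_carrier[OF R v])
          have "v - R *\<^sub>v v = 0\<^sub>v N"
          proof (rule complete)
            show "v - R *\<^sub>v v \<in> carrier_vec N" using v Rv by simp
            fix q assume q: "q < length rs"
            have Fa: "mat_adjoint (F q) \<in> carrier_mat s N" using F[OF q] by simp
            have "mat_adjoint (F q) *\<^sub>v (v - R *\<^sub>v v) = mat_adjoint (F q) *\<^sub>v v - mat_adjoint (F q) *\<^sub>v (R *\<^sub>v v)"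
              by (rule mult_minus_distrib_mat_vec[OF Fa v Rv])
            also have "mat_adjoint (F q) *\<^sub>v (R *\<^sub>v v) = mat_adjoint (F q) *\<^sub>v v"
              using assoc_mult_mat_vec[OF Fa R v] FR[OF q] by simp
            finally show "mat_adjoint (F q) *\<^sub>v (v - R *\<^sub>v v) = 0\<^sub>v s"
              using mult_mat_vec_carrier[OF Fa v] by simp
          qed
          then have 0: "(v - R *\<^sub>v v) $ i = 0" if "i < N" for i using that by simp
          have "v = R *\<^sub>v v"
          proof (rule eq_vecI)
            fix i assume "i < dim_vec (R *\<^sub>v v)"
            then have "i < N" using R by simp
            then show "v $ i = (R *\<^sub>v v) $ i" using 0[of i] v R by simp
          qed (use v R in auto)
          also have "\<dots> = Q *\<^sub>v (mat_adjoint Q *\<^sub>v v)" unfolding R_def by (rule assoc_mult_mat_vec[OF Qc(1,2) v])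
          finally show ?thesis unfolding WQ using mult_mat_vec_carrier[OF Qc(2) v] by blast
        qed
        then have "W = carrier_vec N" using Wc by blast
        then show False using \<open>W \<noteq> carrier_vec N\<close> by simp
      qed
    qed
  qed
qed

text \<open>The component \<open>\<sigma>\<close> is the action of \<open>K\<close> on an invariant subspace of least positive dimension.\<close>

lemma free_rep_induced:
  assumes \<rho>: "\<rho> \<in> hom G (unitary_group N)" and irr: "irreducible_rep G \<rho>" and free: "free_rep N \<rho>"
    and rs: "left_transversal G K rs"
  obtains s \<sigma> E \<chi> where "\<sigma> \<in> hom GK (unitary_group s)" "irreducible_rep GK \<sigma>" "induced_via G K s \<sigma> N \<rho> E"
    "N = length rs * s" "scalar_on s \<sigma> \<chi>" "free_char \<chi>"
proof -
  define inv_frame where "inv_frame s E \<longleftrightarrow> isometric N s E \<and> (\<forall>k\<in>K. \<exists>M\<in>carrier_mat s s. \<rho> k * E = E * M)" for s E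
  have N0: "N > 0" using irr irreducible_iff[OF \<rho>] by blast
  have "inv_frame N (1\<^sub>m N)"
    unfolding inv_frame_def
  proof (intro conjI ballI isometric_one)
    fix k assume "k \<in> K"
    then have "\<rho> k \<in> carrier_mat N N" using unitary_homD(1)[OF \<rho>, of k] by simp
    then show "\<exists>M\<in>carrier_mat N N. \<rho> k * 1\<^sub>m N = 1\<^sub>m N * M" by (intro bexI[of _ "\<rho> k"]) auto
  qed
  then have ex: "N > 0 \<and> (\<exists>E. inv_frame N E)" using N0 by blast
  define s where "s = (LEAST s. s > 0 \<and> (\<exists>E. inv_frame s E))"
  have "s > 0 \<and> (\<exists>E. inv_frame s E)" unfolding s_def by (rule LeastI[of "\<lambda>s. s > 0 \<and> (\<exists>E. inv_frame s E)", OF ex])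
  then obtain E where s: "s > 0" and E: "inv_frame s E" by blast
  have min: "s \<le> r" if "r > 0" "inv_frame r E'" for r E'
    unfolding s_def by (rule Least_le) (use that in blast)
  have Ei: "isometric N s E" using E by (simp add: inv_frame_def)
  note Ec = isometricD[OF Ei]
  have \<rho>c: "\<rho> h \<in> carrier_mat N N" if "h \<in> carrier G" for h by (rule unitary_homD(1)[OF \<rho> that])
  \<comment> \<open>The compression of \<open>\<rho>\<close> to the range of \<open>E\<close>;
    invariance of the range makes it a homomorphism on \<open>K\<close>.\<close>
  define \<sigma> where "\<sigma> k = mat_adjoint E * (\<rho> k * E)" for k
  have \<sigma>c: "\<sigma> k \<in> carrier_mat s s" if "k \<in> K" for k
    unfolding \<sigma>_def by (intro mult_carrier_mat[OF Ec(2)] mult_carrier_mat[OF \<rho>c Ec(1)] K_mem that)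
  have inter: "\<rho> k * E = E * \<sigma> k" if k: "k \<in> K" for k
  proof -
    obtain M where M: "M \<in> carrier_mat s s" "\<rho> k * E = E * M" using E k by (auto simp: inv_frame_def)
    have "\<sigma> k = (mat_adjoint E * E) * M" unfolding \<sigma>_def M(2) using M(1) Ec(1) by (simp add: mat_assoc)
    then show ?thesis using M Ec(3) by simp
  qed
  have \<sigma>: "\<sigma> \<in> hom GK (unitary_group s)"
  proof (rule homI)
    fix k assume k: "k \<in> carrier GK"
    then have kK: "k \<in> K" by simp
    have "isometric N s (E * \<sigma> k)"
      unfolding inter[OF kK, symmetric] by (rule isometric_mult[OF unitary_homD(4)[OF \<rho> K_mem[OF kK]] Ei])
    then have "mat_adjoint (E * \<sigma> k) * (E * \<sigma> k) = 1\<^sub>m s" by (simp add: isometric_def)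
    moreover have "mat_adjoint (E * \<sigma> k) * (E * \<sigma> k) = mat_adjoint (\<sigma> k) * ((mat_adjoint E * E) * \<sigma> k)"
      using Ec(1) \<sigma>c[OF kK] by (simp add: mat_assoc mat_adjoint_mult[OF Ec(1) \<sigma>c[OF kK]])
    ultimately have "mat_adjoint (\<sigma> k) * \<sigma> k = 1\<^sub>m s" using Ec(3) \<sigma>c[OF kK] by simp
    then show "\<sigma> k \<in> carrier (unitary_group s)" using \<sigma>c[OF kK] by (simp add: carrier_unitary_group isometric_def)
  next
    fix x y assume "x \<in> carrier GK" "y \<in> carrier GK"
    then have xy: "x \<in> K" "y \<in> K" by auto
    have "\<rho> (x \<otimes> y) * E = \<rho> x * (\<rho> y * E)"
      using unitary_homD(7)[OF \<rho>, of x y] xy \<rho>c[of x] \<rho>c[of y] Ec(1) by (simp add: mat_assoc)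
    also have "\<dots> = (\<rho> x * E) * \<sigma> y" unfolding inter[OF xy(2)] using xy \<rho>c[of x] Ec(1) \<sigma>c[OF xy(2)] by (simp add: mat_assoc)
    also have "\<dots> = E * (\<sigma> x * \<sigma> y)" unfolding inter[OF xy(1)] using Ec(1) \<sigma>c[OF xy(1)] \<sigma>c[OF xy(2)] by (simp add: mat_assoc)
    finally have "\<sigma> (x \<otimes> y) = mat_adjoint E * E * (\<sigma> x * \<sigma> y)"
      unfolding \<sigma>_def[of "x \<otimes> y"] using Ec(1) \<sigma>c[OF xy(1)] \<sigma>c[OF xy(2)] by (simp add: mat_assoc)
    then show "\<sigma> (x \<otimes>\<^bsub>GK\<^esub> y) = \<sigma> x \<otimes>\<^bsub>unitary_group s\<^esub> \<sigma> y"
      using Ec(3) \<sigma>c[OF xy(1)] \<sigma>c[OF xy(2)] by (simp add: mat_one_left)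
  qed
  have irr\<sigma>: "irreducible_rep GK \<sigma>"
  proof (rule K.irreducibleI_isometric[OF \<sigma> s])
    fix r Q assume Q: "isometric s r Q" and inv: "\<forall>h\<in>carrier GK. \<exists>M\<in>carrier_mat r r. \<sigma> h * Q = Q * M"
    have "inv_frame r (E * Q)"
      unfolding inv_frame_def
    proof (intro conjI ballI isometric_mult[OF Ei Q])
      fix k assume k: "k \<in> K"
      obtain M where M: "M \<in> carrier_mat r r" "\<sigma> k * Q = Q * M" using inv k by auto
      note c = \<rho>c[OF K_mem[OF k]] Ec(1) \<sigma>c[OF k] isometricD(1)[OF Q] M(1)
      have "\<rho> k * (E * Q) = (\<rho> k * E) * Q" using c by (simp add: mat_assoc)
      also have "\<dots> = E * (\<sigma> k * Q)" unfolding inter[OF k] using c by (simp add: mat_assoc)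
      also have "\<dots> = E * Q * M" unfolding M(2) using c by (simp add: mat_assoc)
      finally show "\<exists>M\<in>carrier_mat r r. \<rho> k * (E * Q) = E * Q * M" using M(1) by blast
    qed
    then have "r = 0 \<or> s \<le> r" using min by blast
    then show "r = 0 \<or> r = s" using isometric_le[OF Q] by auto
  qed
  obtain \<chi> where \<chi>: "scalar_on s \<sigma> \<chi>" by (rule scalar_on_exists[OF \<sigma> irr\<sigma>])
  have \<sigma>a: "\<sigma> a = \<chi> a \<cdot>\<^sub>m 1\<^sub>m s" if "a \<in> A" for a using \<chi> that by (simp add: scalar_on_def)
  have fc: "free_char \<chi>"
    unfolding free_char_def
  proof (intro ballI impI notI)
    \<comment> \<open>Were \<open>\<chi> a = 1\<close>, every vector in the range of
      \<open>E\<close> would be fixed by \<open>a\<close>; the first column of \<open>E\<close> is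
      the witness against \<open>free\<close>.\<close>
    fix a assume a: "a \<in> A" "a \<noteq> \<one>" "\<chi> a = 1"
    have aG: "a \<in> carrier G" using a by simp
    define v where "v = E *\<^sub>v unit_vec s 0"
    have v: "v \<in> carrier_vec N" unfolding v_def by (rule mult_mat_vec_carrier[OF Ec(1)]) simp
    have v0: "v \<noteq> 0\<^sub>v N"
    proof
      assume "v = 0\<^sub>v N"
      then have "mat_adjoint E *\<^sub>v v = 0\<^sub>v s" using Ec(2) by (intro eq_vecI) (auto simp: scalar_prod_def)
      moreover have "mat_adjoint E *\<^sub>v v = unit_vec s 0"
        using Ec unfolding v_def by (subst assoc_mult_mat_vec[symmetric, of _ s N _ s]) auto
      ultimately have "unit_vec s 0 $ 0 = (0\<^sub>v s :: complex vec) $ 0" by simp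
      then show False using s by simp
    qed
    have "\<rho> a *\<^sub>v v = (\<rho> a * E) *\<^sub>v unit_vec s 0"
      unfolding v_def by (rule assoc_mult_mat_vec[OF \<rho>c[OF aG] Ec(1), symmetric]) simp
    also have "\<rho> a * E = E" using inter[of a] a \<sigma>a[OF a(1)] Ec(1)
      by (simp add: mat_smult_right mat_one_right) (auto intro!: eq_matI)
    finally have "\<rho> a *\<^sub>v v = v" by (simp add: v_def)
    then have "det (\<rho> a - 1\<^sub>m N) = 0" using det_minus_one_eq_0_iff[OF \<rho>c[OF aG]] v v0 by blast
    then show False using free a by (simp add: free_rep_def)
  qed
  have ind: "induced_via G K s \<sigma> N \<rho> E"
    unfolding induced_via_def
  proof (intro conjI ballI Ei inter)
    fix h assume h: "h \<in> carrier G - K"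
    then have hG: "h \<in> carrier G" by simp
    have "inv \<one> \<otimes> h \<notin> K" using h by simp
    then obtain a where a: "a \<in> A" and ne: "\<chi> (inv \<one> \<otimes> a \<otimes> \<one>) \<noteq> \<chi> (inv h \<otimes> a \<otimes> h)"
      by (rule free_char_separates[OF \<sigma> s \<chi> fc one_closed hG])
    let ?b = "inv h \<otimes> a \<otimes> h"
    have aG: "a \<in> carrier G" using a by simp
    have b: "?b \<in> A" by (rule A_conj[OF hG a])
    have bG: "?b \<in> carrier G" using b by simp
    \<comment> \<open>The compression of \<open>\<rho> h\<close> intertwines the scalars
      \<open>\<chi> a\<close> and \<open>\<chi> ?b\<close>, and these differ by the choice of
      \<open>a\<close>.\<close>
    define Y where "Y = mat_adjoint E * (\<rho> h * E)"
    have Y: "Y \<in> carrier_mat s s"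
      unfolding Y_def by (intro mult_carrier_mat[OF Ec(2)] mult_carrier_mat[OF \<rho>c[OF hG] Ec(1)])
    have Ea: "mat_adjoint E * \<rho> a = \<sigma> a * mat_adjoint E"
      by (rule K.intertwiner_adjoint[OF restrict_hom[OF \<rho>] \<sigma> Ec(1)]) (use inter a in auto)
    have "a \<otimes> h = h \<otimes> ?b" using hG aG by (simp add: m_assoc)
    then have \<rho>ah: "\<rho> a * \<rho> h = \<rho> h * \<rho> ?b"
      using unitary_homD(7)[OF \<rho> aG hG] unitary_homD(7)[OF \<rho> hG bG] by simp
    have "\<sigma> a * Y = (\<sigma> a * mat_adjoint E) * (\<rho> h * E)"
      unfolding Y_def using \<sigma>c[of a] a Ec(1) \<rho>c[OF hG] by (simp add: mat_assoc)
    also have "\<dots> = mat_adjoint E * ((\<rho> a * \<rho> h) * E)"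
      unfolding Ea[symmetric] using Ec(1) \<rho>c[OF hG] \<rho>c[OF aG] by (simp add: mat_assoc)
    also have "\<dots> = mat_adjoint E * (\<rho> h * (\<rho> ?b * E))"
      unfolding \<rho>ah using Ec(1) \<rho>c[OF hG] \<rho>c[OF bG] by (simp add: mat_assoc)
    also have "\<dots> = Y * \<sigma> ?b"
      unfolding Y_def inter[OF A_K[OF b]] using Ec(1) \<rho>c[OF hG] \<sigma>c[OF A_K[OF b]] by (simp add: mat_assoc)
    finally have "\<chi> a \<cdot>\<^sub>m Y = \<chi> ?b \<cdot>\<^sub>m Y"
      unfolding \<sigma>a[OF a] \<sigma>a[OF b] using Y by (simp add: mat_smult_left mat_smult_right mat_one_left mat_one_right)
    have "Y = 0\<^sub>m s s"
    proof (rule eq_matI)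
      fix i j assume ij: "i < dim_row (0\<^sub>m s s :: complex mat)" "j < dim_col (0\<^sub>m s s :: complex mat)"
      then have "\<chi> a * Y $$ (i, j) = \<chi> ?b * Y $$ (i, j)"
        using arg_cong[OF \<open>\<chi> a \<cdot>\<^sub>m Y = \<chi> ?b \<cdot>\<^sub>m Y\<close>, of "\<lambda>M. M $$ (i, j)"] Y by simp
      then show "Y $$ (i, j) = 0\<^sub>m s s $$ (i, j)" using ne aG ij by simp
    qed (use Y in auto)
    then show "mat_adjoint E * (\<rho> h * E) = 0\<^sub>m s s" by (simp add: Y_def)
  qed
  \<comment> \<open>The induced representation embeds in \<open>\<rho>\<close> with invariant range;
    irreducibility of \<open>\<rho>\<close> leaves only equality of dimensions.\<close>
  note U = induced_rep_intertwiner[OF \<rho> \<sigma> ind rs]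
  have "length rs * s = 0 \<or> length rs * s = N"
    by (rule irreducible_isometric[OF \<rho> irr U(1)]) (use U(2) in auto)
  moreover have "length rs > 0" using transversal_ex1[OF rs one_closed] by auto
  ultimately have "N = length rs * s" using s by simp
  then show ?thesis using that[OF \<sigma> irr\<sigma> ind _ \<chi> fc] by blast
qed

end

section \<open>Null sets of the Plancherel measure\<close>

text \<open>The trace is the squared Frobenius norm of \<open>T\<close>, which dominates the squared
  operator norm by Cauchy-Schwarz; a nonzero fixed vector makes the operator norm at least
  1.\<close>

lemma frobenius_ge_1:
  assumes T: "T \<in> carrier_mat n n" and v: "v \<in> carrier_vec n" "v \<noteq> 0\<^sub>v n" and fixed: "T *\<^sub>v v = v"
  shows "Re (mat_trace (mat_adjoint T * T)) \<ge> 1"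
proof -
  define S where "S = (\<Sum>j<n. (cmod (v $ j))\<^sup>2)"
  define Fr where "Fr = (\<Sum>i<n. \<Sum>j<n. (cmod (T $$ (i, j)))\<^sup>2)"
  obtain t where "t < n" "v $ t \<noteq> 0" using v by (metis carrier_vecD eq_vecI index_zero_vec)
  then have S: "S > 0" unfolding S_def by (intro sum_pos2[of _ t]) auto
  have "(cmod (v $ i))\<^sup>2 \<le> (\<Sum>j<n. (cmod (T $$ (i, j)))\<^sup>2) * S" if i: "i < n" for i
  proof -
    have "v $ i = (\<Sum>j<n. T $$ (i, j) * v $ j)" using mat_vec_index_sum[OF T v(1) i] fixed by simp
    then have "cmod (v $ i) \<le> (\<Sum>j<n. cmod (T $$ (i, j)) * cmod (v $ j))"
      using norm_sum[of "\<lambda>j. T $$ (i, j) * v $ j" "{..<n}"] by (simp add: norm_mult)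
    then have "(cmod (v $ i))\<^sup>2 \<le> (\<Sum>j<n. cmod (T $$ (i, j)) * cmod (v $ j))\<^sup>2" by (intro power_mono) auto
    also have "\<dots> \<le> (\<Sum>j<n. (cmod (T $$ (i, j)))\<^sup>2) * S" unfolding S_def by (rule Cauchy_Schwarz_ineq_sum)
    finally show ?thesis .
  qed
  then have "S \<le> Fr * S"
    unfolding S_def[of] Fr_def sum_distrib_right by (intro sum_mono) (auto simp: S_def)
  then have "Fr \<ge> 1" using S by simp
  moreover have "Re (mat_trace (mat_adjoint T * T)) = Fr"
  proof -
    have "mat_trace (mat_adjoint T * T) = (\<Sum>j<n. \<Sum>i<n. cnj (T $$ (i, j)) * T $$ (i, j))"
      unfolding mat_trace_def
    proof (rule sum.cong)
      show "(mat_adjoint T * T) $$ (j, j) = (\<Sum>i<n. cnj (T $$ (i, j)) * T $$ (i, j))" if "j \<in> {..<n}" for j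
        by (rule mat_adjoint_mult_index[OF T T]) (use that in auto)
    qed (use T in auto)
    also have "\<dots> = (\<Sum>j<n. \<Sum>i<n. complex_of_real ((cmod (T $$ (i, j)))\<^sup>2))"
      by (intro sum.cong refl) (use complex_norm_square in \<open>auto simp: mult.commute\<close>)
    also have "\<dots> = complex_of_real (\<Sum>j<n. \<Sum>i<n. (cmod (T $$ (i, j)))\<^sup>2)" by simp
    also have "(\<Sum>j<n. \<Sum>i<n. (cmod (T $$ (i, j)))\<^sup>2) = Fr" unfolding Fr_def by (rule sum.swap)
    finally show ?thesis by simp
  qed
  ultimately show ?thesis by simp
qed

section \<open>Classes of representations in which a given element fixes a vector\<close>

context group begin

lemma unitary_hom_fixed_equiv:
  assumes \<rho>: "\<rho> \<in> hom G (unitary_group n)" and eq: "rep_equiv G \<rho> \<sigma>" and a: "a \<in> carrier G"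
  shows "det (\<sigma> a - 1\<^sub>m n) = 0 \<longleftrightarrow> det (\<rho> a - 1\<^sub>m n) = 0"
proof -
  have imp: "det (\<rho> a - 1\<^sub>m n) = 0"
    if \<rho>: "\<rho> \<in> hom G (unitary_group n)" and eq: "rep_equiv G \<rho> \<sigma>" and 0: "det (\<sigma> a - 1\<^sub>m n) = 0" for \<rho> \<sigma>
  proof -
    obtain V where V: "isometric n n V" "\<And>h. h \<in> carrier G \<Longrightarrow> \<rho> h * V = V * \<sigma> h"
      "\<sigma> \<in> hom G (unitary_group n)" by (rule rep_equivE[OF \<rho> eq]) blast
    note c = unitary_homD(1)[OF \<rho> a] unitary_homD(1)[OF V(3) a] isometricD[OF V(1)]
    obtain v where v: "v \<in> carrier_vec n" "v \<noteq> 0\<^sub>v n" "\<sigma> a *\<^sub>v v = v"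
      using 0 det_minus_one_eq_0_iff[OF c(2)] by blast
    have "\<rho> a *\<^sub>v (V *\<^sub>v v) = (\<rho> a * V) *\<^sub>v v" by (rule assoc_mult_mat_vec[OF c(1,3) v(1), symmetric])
    also have "\<dots> = V *\<^sub>v v" unfolding V(2)[OF a] using assoc_mult_mat_vec[OF c(3,2) v(1)] v(3) by simp
    finally have "\<rho> a *\<^sub>v (V *\<^sub>v v) = V *\<^sub>v v" .
    moreover have "V *\<^sub>v v \<noteq> 0\<^sub>v n"
    proof
      assume "V *\<^sub>v v = 0\<^sub>v n"
      then have "mat_adjoint V *\<^sub>v (V *\<^sub>v v) = 0\<^sub>v n" using c(4) by (intro eq_vecI) (auto simp: scalar_prod_def)
      then show False using assoc_mult_mat_vec[OF c(4,3) v(1)] c(5) v by simp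
    qed
    ultimately show ?thesis using det_minus_one_eq_0_iff[OF c(1)] mult_mat_vec_carrier[OF c(3) v(1)] by blast
  qed
  obtain \<sigma>h: "\<sigma> \<in> hom G (unitary_group n)" by (rule rep_equivE[OF \<rho> eq])
  show ?thesis using imp[OF \<rho> eq] imp[OF \<sigma>h rep_equiv_sym[OF \<rho> eq]] by blast
qed

text \<open>One representative decides for the whole class, because the condition is invariant under
  equivalence by \<open>unitary_hom_fixed_equiv\<close>.\<close>

definition fixing_classes :: "'a \<Rightarrow> ('a \<Rightarrow> complex mat) set set" where
  "fixing_classes a = {c \<in> dual G. \<exists>\<rho>\<in>c. det (\<rho> a - 1\<^sub>m (rep_dim G \<rho>)) = 0}"

lemma irreps_hom: "\<rho> \<in> irreps G n \<Longrightarrow> \<rho> \<in> hom G (unitary_group n)"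
  using unitary_rep_hom by (auto simp: irreps_def irreducible_rep_def)

lemma rep_class_mem_fixing_classes:
  assumes \<rho>: "\<rho> \<in> irreps G n" and a: "a \<in> carrier G"
  shows "rep_class G \<rho> \<in> fixing_classes a \<longleftrightarrow> det (\<rho> a - 1\<^sub>m n) = 0"
proof -
  note h = irreps_hom[OF \<rho>]
  have "det (\<sigma> a - 1\<^sub>m (rep_dim G \<sigma>)) = 0 \<longleftrightarrow> det (\<rho> a - 1\<^sub>m n) = 0" if "\<sigma> \<in> rep_class G \<rho>" for \<sigma>
    using rep_class_mem_hom[OF h that] unitary_hom_fixed_equiv[OF h _ a] unitary_homD(9) by metis
  moreover have "rep_class G \<rho> \<in> dual G" using \<rho> by (auto simp: dual_def irreps_def)
  ultimately show ?thesis using rep_class_self[OF h] unfolding fixing_classes_def by blast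
qed

lemma space_irreps_borel: "space (irreps_borel G n) = irreps G n"
  unfolding irreps_borel_def by (rule space_measure_of) auto

lemma coefficient_measurable:
  assumes "a \<in> carrier G" "i < n" "j < n"
  shows "(\<lambda>\<rho>. \<rho> a $$ (i, j)) \<in> borel_measurable (irreps_borel G n)"
proof (rule measurableI)
  fix B :: "complex set" assume B: "B \<in> sets borel"
  have "(\<lambda>\<rho>. \<rho> a $$ (i, j)) -` B \<inter> space (irreps_borel G n) = {\<rho> \<in> irreps G n. \<rho> a $$ (i, j) \<in> B}"
    by (auto simp: space_irreps_borel)
  also have "\<dots> \<in> sets (irreps_borel G n)"
    unfolding irreps_borel_def
    by (subst sets_measure_of) (use assms B in \<open>auto intro!: sigma_sets.Basic\<close>)
  finally show "(\<lambda>\<rho>. \<rho> a $$ (i, j)) -` B \<inter> space (irreps_borel G n) \<in> sets (irreps_borel G n)" .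
qed simp

text \<open>The Leibniz formula makes the determinant a polynomial in the matrix coefficients, and
  these generate the sigma-algebra.\<close>

lemma fixing_measurable:
  assumes a: "a \<in> carrier G"
  shows "{\<rho> \<in> irreps G n. det (\<rho> a - 1\<^sub>m n) = 0} \<in> sets (irreps_borel G n)"
proof -
  let ?M = "irreps_borel G n"
  have "(\<lambda>\<rho>. det (\<rho> a - 1\<^sub>m n)) \<in> borel_measurable ?M"
  proof (subst measurable_cong)
    fix \<rho> assume "\<rho> \<in> space ?M"
    then have "\<rho> a \<in> carrier_mat n n"
      using unitary_homD(1)[OF irreps_hom a] by (simp add: space_irreps_borel)
    then have "\<rho> a - 1\<^sub>m n \<in> carrier_mat n n" "dim_row (\<rho> a) = n" "dim_col (\<rho> a) = n" by auto
    then show "det (\<rho> a - 1\<^sub>m n) = (\<Sum>p | p permutes {0..<n}. signof p *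
        (\<Prod>i = 0..<n. \<rho> a $$ (i, p i) - (if i = p i then 1 else 0)))"
      by (subst det_def') (auto intro!: sum.cong prod.cong arg_cong2[of _ _ _ _ "(*)"] simp: permutes_in_image)
  next
    have "(\<lambda>\<rho>. \<rho> a $$ (i, p i) - (if i = p i then 1 else 0)) \<in> borel_measurable ?M"
      if "p permutes {0..<n}" "i < n" for p i
    proof -
      have "p i < n" using permutes_in_image[OF that(1), of i] that(2) by simp
      then show ?thesis by (intro borel_measurable_diff coefficient_measurable[OF a that(2)]) auto
    qed
    then show "(\<lambda>\<rho>. \<Sum>p | p permutes {0..<n}. signof p *
        (\<Prod>i = 0..<n. \<rho> a $$ (i, p i) - (if i = p i then 1 else 0))) \<in> borel_measurable ?M"
      by (intro borel_measurable_sum borel_measurable_times borel_measurable_prod borel_measurable_const) auto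
  qed
  then have "(\<lambda>\<rho>. det (\<rho> a - 1\<^sub>m n)) -` {0} \<inter> space ?M \<in> sets ?M" by (rule measurable_sets) simp
  also have "(\<lambda>\<rho>. det (\<rho> a - 1\<^sub>m n)) -` {0} \<inter> space ?M = {\<rho> \<in> irreps G n. det (\<rho> a - 1\<^sub>m n) = 0}"
    by (auto simp: space_irreps_borel)
  finally show ?thesis .
qed

lemma fixing_classes_sets:
  assumes a: "a \<in> carrier G"
  shows "fixing_classes a \<in> sets (dual_borel G)"
proof -
  have "{\<rho> \<in> irreps G n. rep_class G \<rho> \<in> fixing_classes a} \<in> sets (irreps_borel G n)" for n
  proof -
    have "{\<rho> \<in> irreps G n. rep_class G \<rho> \<in> fixing_classes a} = {\<rho> \<in> irreps G n. det (\<rho> a - 1\<^sub>m n) = 0}"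
      using rep_class_mem_fixing_classes[OF _ a] by blast
    then show ?thesis using fixing_measurable[OF a] by simp
  qed
  moreover have "fixing_classes a \<subseteq> dual G" by (auto simp: fixing_classes_def)
  ultimately show ?thesis
    unfolding dual_borel_def by (subst sets_measure_of) (auto intro!: sigma_sets.Basic)
qed

lemma rep_sum_finite:
  assumes S: "finite S" "S \<subseteq> carrier G" and f: "\<And>h. h \<notin> S \<Longrightarrow> f h = 0"
  shows "rep_sum G \<rho> f = mat (rep_dim G \<rho>) (rep_dim G \<rho>) (\<lambda>(i, j). \<Sum>h\<in>S. f h * \<rho> h $$ (i, j))"
proof -
  have "(\<Sum>\<^sub>\<infinity>h\<in>carrier G. f h * \<rho> h $$ (i, j)) = (\<Sum>h\<in>S. f h * \<rho> h $$ (i, j))" for i j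
  proof -
    have "(\<Sum>\<^sub>\<infinity>h\<in>carrier G. f h * \<rho> h $$ (i, j)) = (\<Sum>\<^sub>\<infinity>h\<in>S. f h * \<rho> h $$ (i, j))"
      by (rule infsum_cong_neutral) (use S f in auto)
    then show ?thesis using S(1) by simp
  qed
  then show ?thesis by (simp add: rep_sum_def)
qed

text \<open>Testing the Plancherel formula on the average of \<open>1, a, \<dots>, a\<^bsup>m-1\<^esup>\<close>: at a representation in which \<open>a\<close>
  fixes a vector the integrand is at least \<open>1\<close>, while the left-hand side is \<open>1 / m\<close>.\<close>

lemma plancherel_fixing_null:
  assumes pl: "plancherel_measure G \<mu>" and a: "a \<in> carrier G" and inj: "inj (\<lambda>j::nat. a [^] j)"
  shows "fixing_classes a \<in> null_sets \<mu>"
proof -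
  have sets: "fixing_classes a \<in> sets \<mu>"
    using fixing_classes_sets[OF a] pl by (simp add: plancherel_measure_def)
  have bound: "emeasure \<mu> (fixing_classes a) \<le> ennreal (1 / real m)" if m: "m > 0" for m :: nat
  proof -
    define S where "S = (\<lambda>j. a [^] j) ` {..<m}"
    have S: "finite S" "S \<subseteq> carrier G" using a by (auto simp: S_def)
    \<comment> \<open>By \<open>inj\<close> the \<open>m\<close> powers are distinct, so the squared
      norm of the average is \<open>m\<close> times the square of \<open>1 / m\<close>.\<close>
    have cS: "card S = m" unfolding S_def using inj by (subst card_image) (auto intro: inj_on_subset)
    define f where "f h = (if h \<in> S then complex_of_real (1 / real m) else 0)" for h
    have "(\<lambda>h. norm (f h)) summable_on carrier G"
      by (rule summable_on_cong_neutral[THEN iffD1, OF _ _ _ summable_on_finite[OF S(1)]])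
         (use S in \<open>auto simp: f_def\<close>)
    then have eq: "ennreal (\<Sum>\<^sub>\<infinity>h\<in>carrier G. (norm (f h))\<^sup>2) =
        (\<integral>\<^sup>+ c. (let \<rho> = (SOME \<rho>. \<rho> \<in> c)
                in ennreal (Re (mat_trace (mat_adjoint (rep_sum G \<rho> f) * rep_sum G \<rho> f)))) \<partial>\<mu>)"
      using pl by (simp add: plancherel_measure_def)
    have "(\<Sum>\<^sub>\<infinity>h\<in>carrier G. (norm (f h))\<^sup>2) = (\<Sum>\<^sub>\<infinity>h\<in>S. (norm (f h))\<^sup>2)"
      by (rule infsum_cong_neutral) (use S in \<open>auto simp: f_def\<close>)
    also have "\<dots> = (\<Sum>h\<in>S. (1 / real m)\<^sup>2)" using S(1) by (simp add: f_def norm_divide)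
    also have "\<dots> = 1 / real m" using cS m by (simp add: power2_eq_square)
    finally have lhs: "(\<Sum>\<^sub>\<infinity>h\<in>carrier G. (norm (f h))\<^sup>2) = 1 / real m" .
    have "emeasure \<mu> (fixing_classes a) = (\<integral>\<^sup>+ c. indicator (fixing_classes a) c \<partial>\<mu>)" using sets by simp
    also have "\<dots> \<le> (\<integral>\<^sup>+ c. (let \<rho> = (SOME \<rho>. \<rho> \<in> c)
                in ennreal (Re (mat_trace (mat_adjoint (rep_sum G \<rho> f) * rep_sum G \<rho> f)))) \<partial>\<mu>)"
    proof (rule nn_integral_mono)
      fix c
      show "indicator (fixing_classes a) c \<le> (let \<rho> = (SOME \<rho>. \<rho> \<in> c)
                in ennreal (Re (mat_trace (mat_adjoint (rep_sum G \<rho> f) * rep_sum G \<rho> f))))"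
      proof (cases "c \<in> fixing_classes a")
        case True
        then obtain \<rho>0 where \<rho>0: "irreducible_rep G \<rho>0" and c: "c = rep_class G \<rho>0"
          by (auto simp: fixing_classes_def dual_def)
        define n where "n = rep_dim G \<rho>0"
        have irr: "\<rho>0 \<in> irreps G n" using \<rho>0 by (simp add: irreps_def n_def)
        note h0 = irreps_hom[OF irr]
        have 0: "det (\<rho>0 a - 1\<^sub>m n) = 0" using True c rep_class_mem_fixing_classes[OF irr a] by simp
        \<comment> \<open>The integrand is evaluated at an arbitrary representative of the class,
          which inherits a fixed vector from \<open>\<rho>0\<close>.\<close>
        define \<rho> where "\<rho> = (SOME \<rho>. \<rho> \<in> c)"
        have \<rho>c: "\<rho> \<in> c" unfolding \<rho>_def c by (rule someI[of _ \<rho>0]) (rule rep_class_self[OF h0])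
        note \<rho> = rep_class_mem_hom[OF h0 \<rho>c[unfolded c]]
        have dim: "rep_dim G \<rho> = n" by (rule unitary_homD(9)[OF \<rho>(1)])
        have "det (\<rho> a - 1\<^sub>m n) = 0" using unitary_hom_fixed_equiv[OF h0 \<rho>(2) a] 0 by simp
        then obtain v where v: "v \<in> carrier_vec n" "v \<noteq> 0\<^sub>v n" "\<rho> a *\<^sub>v v = v"
          using det_minus_one_eq_0_iff[OF unitary_homD(1)[OF \<rho>(1) a]] by blast
        have pow: "\<rho> (a [^] j) *\<^sub>v v = v" for j :: nat
        proof (induction j)
          case 0
          then show ?case using unitary_homD(8)[OF \<rho>(1)] v(1) by simp
        next
          case (Suc j)
          have "\<rho> (a [^] Suc j) *\<^sub>v v = (\<rho> (a [^] j) * \<rho> a) *\<^sub>v v"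
            using unitary_homD(7)[OF \<rho>(1), of "a [^] j" a] a by simp
          also have "\<dots> = \<rho> (a [^] j) *\<^sub>v (\<rho> a *\<^sub>v v)"
            by (rule assoc_mult_mat_vec[OF unitary_homD(1)[OF \<rho>(1)] unitary_homD(1)[OF \<rho>(1)] v(1)]) (use a in auto)
          finally show ?case using Suc v(3) by simp
        qed
        define T where "T = rep_sum G \<rho> f"
        have T_eq: "T = mat n n (\<lambda>(i, j). \<Sum>h\<in>S. f h * \<rho> h $$ (i, j))"
          unfolding T_def dim[symmetric] by (rule rep_sum_finite[OF S]) (simp add: f_def)
        have T: "T \<in> carrier_mat n n" by (simp add: T_eq)
        \<comment> \<open>Each power of \<open>a\<close> fixes \<open>v\<close>, hence so does the
          average, and \<open>frobenius_ge_1\<close> bounds the integrand from below.\<close>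
        have "T *\<^sub>v v = v"
        proof (rule eq_vecI)
          fix i assume "i < dim_vec v"
          then have i: "i < n" using v(1) by simp
          have "(T *\<^sub>v v) $ i = (\<Sum>j<n. (\<Sum>h\<in>S. f h * \<rho> h $$ (i, j)) * v $ j)"
            unfolding mat_vec_index_sum[OF T v(1) i] by (rule sum.cong) (use i in \<open>auto simp: T_eq\<close>)
          also have "\<dots> = (\<Sum>h\<in>S. \<Sum>j<n. f h * \<rho> h $$ (i, j) * v $ j)"
            unfolding sum_distrib_right by (rule sum.swap)
          also have "\<dots> = (\<Sum>h\<in>S. complex_of_real (1 / real m) * v $ i)"
          proof (rule sum.cong[OF refl])
            fix h assume h: "h \<in> S"
            then have hG: "h \<in> carrier G" using S by blast
            have "(\<Sum>j<n. \<rho> h $$ (i, j) * v $ j) = (\<rho> h *\<^sub>v v) $ i"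
              by (rule mat_vec_index_sum[OF unitary_homD(1)[OF \<rho>(1) hG] v(1) i, symmetric])
            also have "\<dots> = v $ i" using pow h by (auto simp: S_def)
            finally have "(\<Sum>j<n. \<rho> h $$ (i, j) * v $ j) = v $ i" .
            then show "(\<Sum>j<n. f h * \<rho> h $$ (i, j) * v $ j) = complex_of_real (1 / real m) * v $ i"
              using h by (simp add: f_def flip: sum_divide_distrib)
          qed
          also have "\<dots> = v $ i" using cS m by simp
          finally show "(T *\<^sub>v v) $ i = v $ i" .
        qed (use T v(1) in auto)
        then have "Re (mat_trace (mat_adjoint T * T)) \<ge> 1" by (rule frobenius_ge_1[OF T v(1,2)])
        then have "ennreal 1 \<le> ennreal (Re (mat_trace (mat_adjoint T * T)))" by (rule ennreal_leI)
        then show ?thesis using True by (simp add: Let_def flip: \<rho>_def T_def)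
      qed simp
    qed
    finally show ?thesis using eq lhs by simp
  qed
  \<comment> \<open>The bound \<open>1 / m\<close> holds for every positive
    \<open>m\<close>.\<close>
  have "emeasure \<mu> (fixing_classes a) = 0"
  proof (rule ccontr)
    assume "emeasure \<mu> (fixing_classes a) \<noteq> 0"
    then have pos: "0 < emeasure \<mu> (fixing_classes a)" by (simp add: zero_less_iff_neq_zero)
    have fin: "emeasure \<mu> (fixing_classes a) \<noteq> \<infinity>" using bound[of 1] by (auto simp: top_unique)
    define e where "e = enn2real (emeasure \<mu> (fixing_classes a))"
    have e: "emeasure \<mu> (fixing_classes a) = ennreal e" using fin by (simp add: e_def less_top)
    then have "e > 0" using pos by simp
    then obtain m :: nat where "m > 0" "1 / real m < e" using ex_inverse_of_nat_less by (auto simp: inverse_eq_divide)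
    then show False using bound[of m] e \<open>e > 0\<close> by (simp add: ennreal_le_iff)
  qed
  then show ?thesis using sets by (simp add: null_sets_def)
qed

end

section \<open>Null sets of Lebesgue measure and of orbit spaces\<close>

text \<open>\<open>vec n\<close> sees only the coordinates below \<open>n\<close>; functions in the
  product space are extensional, so nothing else distinguishes them.\<close>

lemma inj_on_vec_PiM: "inj_on (vec n) (space (\<Pi>\<^sub>M i\<in>{..<n}. (lborel :: real measure)))"
proof (rule inj_onI)
  fix x y :: "nat \<Rightarrow> real"
  assume xy: "x \<in> space (\<Pi>\<^sub>M i\<in>{..<n}. lborel)" "y \<in> space (\<Pi>\<^sub>M i\<in>{..<n}. lborel)" and eq: "vec n x = vec n y"
  have "x i = y i" if "i < n" for i using arg_cong[OF eq, of "\<lambda>v. v $ i"] that by simp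
  then show "x = y" using xy by (intro PiE_ext[of x "{..<n}" "\<lambda>_. UNIV"]) (auto simp: space_PiM)
qed

lemma space_lborel_vec: "space (lborel_vec n) = carrier_vec n"
proof
  show "carrier_vec n \<subseteq> space (lborel_vec n)"
  proof
    fix v :: "real vec" assume v: "v \<in> carrier_vec n"
    then have "v = vec n (\<lambda>i\<in>{..<n}. v $ i)" by (intro eq_vecI) auto
    moreover have "(\<lambda>i\<in>{..<n}. v $ i) \<in> space (\<Pi>\<^sub>M i\<in>{..<n}. lborel)" by (simp add: space_PiM)
    ultimately show "v \<in> space (lborel_vec n)" unfolding lborel_vec_def space_embed_measure by blast
  qed
qed (auto simp: lborel_vec_def space_embed_measure)

text \<open>Fubini in the coordinate \<open>i0\<close>, whose coefficient is nonzero: every line in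
  this direction meets the hyperplane in at most one point.\<close>

lemma hyperplane_null_PiM:
  fixes w :: "nat \<Rightarrow> real"
  assumes i0: "i0 < n" "w i0 \<noteq> 0"
  shows "{x \<in> space (\<Pi>\<^sub>M i\<in>{..<n}. lborel). (\<Sum>i<n. x i * w i) = c} \<in> null_sets (\<Pi>\<^sub>M i\<in>{..<n}. lborel)"
proof -
  interpret product_sigma_finite "\<lambda>_. lborel :: real measure" by unfold_locales
  let ?P = "\<Pi>\<^sub>M i\<in>{..<n}. (lborel :: real measure)"
  define X where "X = {x \<in> space ?P. (\<Sum>i<n. x i * w i) = c}"
  define I where "I = {..<n} - {i0}"
  have ins: "{..<n} = insert i0 I" using i0 by (auto simp: I_def)
  have I: "finite I" "i0 \<notin> I" by (auto simp: I_def)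
  have "(\<lambda>x. \<Sum>i<n. x i * w i) \<in> borel_measurable ?P"
    by (intro borel_measurable_sum borel_measurable_times borel_measurable_const)
       (use measurable_component_singleton[of _ "{..<n}" "\<lambda>_. lborel :: real measure"] in auto)
  then have X: "X \<in> sets ?P"
    unfolding X_def by (intro borel_measurable_eq) auto
  have "emeasure ?P X = (\<integral>\<^sup>+ x. indicator X x \<partial>?P)" using X by simp
  also have "\<dots> = (\<integral>\<^sup>+ x. \<integral>\<^sup>+ y. indicator X (x(i0 := y)) \<partial>lborel \<partial>(\<Pi>\<^sub>M i\<in>I. lborel))"
    unfolding ins by (rule product_nn_integral_insert[OF I]) (use X in \<open>simp add: ins\<close>)
  also have "\<dots> = (\<integral>\<^sup>+ x. 0 \<partial>(\<Pi>\<^sub>M i\<in>I. (lborel :: real measure)))"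
  proof (rule nn_integral_cong)
    fix x assume "x \<in> space (\<Pi>\<^sub>M i\<in>I. (lborel :: real measure))"
    define y0 where "y0 = (c - (\<Sum>i\<in>I. x i * w i)) / w i0"
    have "indicator X (x(i0 := y)) \<le> (indicator {y0} y :: ennreal)" for y
    proof (cases "x(i0 := y) \<in> X")
      case True
      then have "(\<Sum>i\<in>insert i0 I. (x(i0 := y)) i * w i) = c" unfolding X_def ins by simp
      also have "(\<Sum>i\<in>insert i0 I. (x(i0 := y)) i * w i) = y * w i0 + (\<Sum>i\<in>I. (x(i0 := y)) i * w i)"
        using I by simp
      also have "(\<Sum>i\<in>I. (x(i0 := y)) i * w i) = (\<Sum>i\<in>I. x i * w i)" by (rule sum.cong) (use I in auto)
      finally have "y = y0" using i0 by (simp add: y0_def field_simps)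
      then show ?thesis by (simp add: indicator_def)
    qed simp
    then have "(\<integral>\<^sup>+ y. indicator X (x(i0 := y)) \<partial>lborel) \<le> (\<integral>\<^sup>+ y. indicator {y0} y \<partial>lborel)"
      by (intro nn_integral_mono)
    also have "\<dots> = 0" by simp
    finally show "(\<integral>\<^sup>+ y. indicator X (x(i0 := y)) \<partial>lborel) = 0" by simp
  qed
  finally show ?thesis using X unfolding X_def by (simp add: null_sets_def)
qed

lemma hyperplane_null:
  assumes w: "w \<in> carrier_vec n" "w \<noteq> 0\<^sub>v n"
  shows "{k \<in> carrier_vec n. k \<bullet> w = c} \<in> null_sets (lborel_vec n)"
proof -
  obtain i0 where i0: "i0 < n" "w $ i0 \<noteq> 0" using w by (metis carrier_vecD eq_vecI index_zero_vec)
  let ?P = "\<Pi>\<^sub>M i\<in>{..<n}. (lborel :: real measure)"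
  let ?H = "{k \<in> carrier_vec n. k \<bullet> w = c}"
  define X where "X = {x \<in> space ?P. (\<Sum>i<n. x i * w $ i) = c}"
  have X: "X \<in> null_sets ?P" unfolding X_def by (rule hyperplane_null_PiM[where w = "\<lambda>i. w $ i", OF i0])
  have eq: "vec n x \<bullet> w = (\<Sum>i<n. x i * w $ i)" for x
    using w by (simp add: scalar_prod_def atLeast0LessThan)
  have HX: "?H = vec n ` X"
  proof
    show "vec n ` X \<subseteq> ?H" by (auto simp: X_def eq)
    show "?H \<subseteq> vec n ` X"
    proof
      fix k assume k: "k \<in> ?H"
      then have "k \<in> vec n ` space ?P"
        using space_lborel_vec[of n] unfolding lborel_vec_def space_embed_measure by auto
      then obtain x where "x \<in> space ?P" "k = vec n x" by blast
      then show "k \<in> vec n ` X" using k eq[of x] by (auto simp: X_def)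
    qed
  qed
  have sets: "?H \<in> sets (lborel_vec n)"
    unfolding HX lborel_vec_def sets_embed_measure'[OF inj_on_vec_PiM] using X by auto
  have "vec n -` ?H \<inter> space ?P = X"
    by (auto simp: X_def eq)
  then have "emeasure (lborel_vec n) ?H = emeasure ?P X"
    using sets unfolding lborel_vec_def by (subst emeasure_embed_measure'[OF inj_on_vec_PiM]) auto
  then show ?thesis using X sets by (simp add: null_sets_def)
qed

text \<open>The hypothesis \<open>sat\<close> makes \<open>B\<close> saturated for the quotient map,
  so \<open>B\<close> is the full preimage of its image. This yields measurability of the image, and
  for a fundamental domain \<open>D\<close> its measure is that of the intersection of
  \<open>B\<close> and \<open>D\<close>.\<close>

lemma orbit_null_set_image:
  assumes B: "B \<in> null_sets (lborel_vec n)"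
    and sat: "\<And>k. k \<in> carrier_vec n \<Longrightarrow> orbit_of H k \<in> orbit_of H ` B \<Longrightarrow> k \<in> B"
  shows "orbit_null_set n H (orbit_of H ` B)"
proof -
  let ?L = "lborel_vec n" and ?O = "orbit_borel n H" and ?N = "orbit_of H ` B"
  let ?G = "{E. E \<subseteq> orbit_space n H \<and> {k \<in> carrier_vec n. orbit_of H k \<in> E} \<in> sets ?L}"
  have Bc: "B \<subseteq> carrier_vec n" using sets.sets_into_space[of B ?L] B space_lborel_vec by auto
  have pre: "{k \<in> carrier_vec n. orbit_of H k \<in> ?N} = B" using sat Bc by auto
  have "?N \<subseteq> orbit_space n H" using Bc by (auto simp: orbit_space_def)
  then have "?N \<in> ?G" using pre B by auto
  then have N: "?N \<in> sets ?O"
    unfolding orbit_borel_def by (subst sets_measure_of) (auto intro: sigma_sets.Basic)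
  have meas: "orbit_of H \<in> measurable ?L ?O"
    unfolding orbit_borel_def
  proof (rule measurable_measure_of)
    show "?G \<subseteq> Pow (orbit_space n H)" by auto
    show "orbit_of H \<in> space ?L \<rightarrow> orbit_space n H" by (auto simp: space_lborel_vec orbit_space_def)
    fix E assume "E \<in> ?G"
    moreover have "orbit_of H -` E \<inter> space ?L = {k \<in> carrier_vec n. orbit_of H k \<in> E}"
      by (auto simp: space_lborel_vec)
    ultimately show "orbit_of H -` E \<inter> space ?L \<in> sets ?L" by simp
  qed
  have "?N \<in> null_sets (orbit_measure n H D)" if D: "fundamental_domain n H D" for D
  proof -
    have Ds: "D \<in> sets ?L" using D by (simp add: fundamental_domain_def)
    have Dc: "D \<subseteq> carrier_vec n" using sets.sets_into_space[OF Ds] space_lborel_vec by auto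
    have m: "orbit_of H \<in> measurable (restrict_space ?L D) ?O"
      by (rule measurable_restrict_space1[OF meas])
    have sp: "orbit_of H -` ?N \<inter> space (restrict_space ?L D) = B \<inter> D"
      using pre Dc by (auto simp: space_restrict_space space_lborel_vec)
    have "emeasure (orbit_measure n H D) ?N = emeasure (restrict_space ?L D) (B \<inter> D)"
      unfolding orbit_measure_def emeasure_distr[OF m N] sp ..
    also have "\<dots> = emeasure ?L (B \<inter> D)"
      by (rule emeasure_restrict_space) (use Ds in auto)
    also have "\<dots> = 0" using null_set_Int1[OF B Ds] by (auto simp: Int_commute)
    finally show ?thesis using N by (simp add: null_sets_def orbit_measure_def)
  qed
  then show ?thesis using N by (simp add: orbit_null_set_def)
qed

section \<open>Lattices\<close>

lemma nonsingular_right_inverse: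
  assumes A: "(A :: 'a :: field mat) \<in> carrier_mat n n" and det: "det A \<noteq> 0"
  obtains B where "B \<in> carrier_mat n n" "A * B = 1\<^sub>m n" "B * A = 1\<^sub>m n"
  using det_non_zero_imp_unit[OF A det, of "()"] that
  by (auto simp: Units_def ring_mat_def)

lemma mat_vec_col_sum:
  assumes "M \<in> carrier_mat n n" "k < n" "v \<in> carrier_vec n"
    and v: "\<And>i. i < n \<Longrightarrow> v $ i = u $ i + (if i = k then c else 0)" and u: "u \<in> carrier_vec n"
  shows "M *\<^sub>v v = M *\<^sub>v u + (c :: real) \<cdot>\<^sub>v col M k"
proof (rule eq_vecI)
  fix i assume "i < dim_vec (M *\<^sub>v u + c \<cdot>\<^sub>v col M k)"
  then have i: "i < n" using assms by simp
  have "(M *\<^sub>v v) $ i = (\<Sum>t<n. M $$ (i, t) * v $ t)" by (rule mat_vec_index_sum[OF assms(1,3) i])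
  also have "\<dots> = (\<Sum>t<n. M $$ (i, t) * u $ t + (if t = k then c * M $$ (i, t) else 0))"
    by (rule sum.cong) (auto simp: v algebra_simps)
  also have "\<dots> = (M *\<^sub>v u) $ i + c * M $$ (i, k)"
    unfolding sum.distrib mat_vec_index_sum[OF assms(1) u i] using assms(2) by simp
  finally show "(M *\<^sub>v v) $ i = (M *\<^sub>v u + c \<cdot>\<^sub>v col M k) $ i" using i assms by simp
qed (use assms in auto)

lemma real_vec_norm_index_le:
  assumes x: "(x :: real vec) \<in> carrier_vec n" and i: "i < n"
  shows "\<bar>x $ i\<bar> \<le> sqrt (x \<bullet> x)"
proof -
  have "(x $ i)\<^sup>2 \<le> (\<Sum>j<n. (x $ j)\<^sup>2)"
    using i by (intro member_le_sum) auto
  also have "\<dots> = x \<bullet> x" using x by (simp add: scalar_prod_def atLeast0LessThan power2_eq_square)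
  finally show ?thesis using real_le_rsqrt by simp
qed

section \<open>Additive groups of real vectors, and full lattices\<close>

definition add_subgroup :: "nat \<Rightarrow> real vec set \<Rightarrow> bool" where
  "add_subgroup n X \<longleftrightarrow> X \<subseteq> carrier_vec n \<and> 0\<^sub>v n \<in> X \<and> (\<forall>x\<in>X. \<forall>y\<in>X. x + y \<in> X) \<and> (\<forall>x\<in>X. - x \<in> X)"

lemma add_subgroupD:
  assumes "add_subgroup n X"
  shows "x \<in> X \<Longrightarrow> x \<in> carrier_vec n" "0\<^sub>v n \<in> X" "x \<in> X \<Longrightarrow> y \<in> X \<Longrightarrow> x + y \<in> X" "x \<in> X \<Longrightarrow> - x \<in> X"
  using assms by (auto simp: add_subgroup_def)

lemma add_subgroup_minus:
  assumes X: "add_subgroup n X" and x: "x \<in> X" and y: "y \<in> X"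
  shows "x - y \<in> X"
proof -
  have "x - y = x + - y" using add_subgroupD(1)[OF X] x y by (intro eq_vecI) auto
  then show ?thesis using add_subgroupD(3,4)[OF X] x y by simp
qed

lemma add_subgroup_int_smult:
  assumes X: "add_subgroup n X" and x: "x \<in> X"
  shows "real_of_int z \<cdot>\<^sub>v x \<in> X"
proof -
  note xc = add_subgroupD(1)[OF X x]
  have nat: "real k \<cdot>\<^sub>v x \<in> X" for k :: nat
  proof (induction k)
    case 0
    have "0 \<cdot>\<^sub>v x = 0\<^sub>v n" using xc by (intro eq_vecI) auto
    then show ?case using add_subgroupD(2)[OF X] by simp
  next
    case (Suc k)
    have "real (Suc k) \<cdot>\<^sub>v x = real k \<cdot>\<^sub>v x + x" using xc by (intro eq_vecI) (auto simp: algebra_simps)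
    then show ?case using add_subgroupD(3)[OF X Suc x] by simp
  qed
  show ?thesis
  proof (cases "z \<ge> 0")
    case True
    then show ?thesis using nat[of "nat z"] by simp
  next
    case False
    have "real_of_int z \<cdot>\<^sub>v x = - (real (nat (- z)) \<cdot>\<^sub>v x)" using False xc by (intro eq_vecI) auto
    then show ?thesis using add_subgroupD(4)[OF X nat[of "nat (- z)"]] by simp
  qed
qed

lemma add_subgroup_combination:
  assumes X: "add_subgroup n X" and M: "M \<in> carrier_mat n n" and cols: "\<And>j. j < n \<Longrightarrow> col M j \<in> X"
  shows "M *\<^sub>v vec n (\<lambda>i. real_of_int (z i)) \<in> X"
proof -
  \<comment> \<open>Truncation to the first \<open>k\<close> coefficients; induction on
    \<open>k\<close> adds one column at a time.\<close>
  define p where "p k = vec n (\<lambda>i. if i < k then real_of_int (z i) else 0)" for k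
  have "k \<le> n \<Longrightarrow> M *\<^sub>v p k \<in> X" for k
  proof (induction k)
    case 0
    have "M *\<^sub>v p 0 = 0\<^sub>v n" using M by (intro eq_vecI) (auto simp: p_def scalar_prod_def)
    then show ?case using add_subgroupD(2)[OF X] by simp
  next
    case (Suc k)
    have "M *\<^sub>v p (Suc k) = M *\<^sub>v p k + real_of_int (z k) \<cdot>\<^sub>v col M k"
      by (rule mat_vec_col_sum[OF M]) (use Suc.prems in \<open>auto simp: p_def\<close>)
    then show ?case
      using Suc add_subgroupD(3)[OF X] add_subgroup_int_smult[OF X cols] by simp
  qed
  from this[of n] have "M *\<^sub>v p n \<in> X" by simp
  also have "p n = vec n (\<lambda>i. real_of_int (z i))" by (intro eq_vecI) (auto simp: p_def)
  finally show ?thesis .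
qed

text \<open>Isolation of the zero vector suffices for discreteness, since differences stay in the
  group. Full rank is expressed by a nonsingular matrix of lattice vectors, which also covers
  \<open>n = 0\<close> because the empty determinant is 1.\<close>

locale vec_lattice =
  fixes n :: nat and \<Lambda> :: "real vec set"
  assumes subgroup: "add_subgroup n \<Lambda>"
    and discrete: "\<exists>\<epsilon>>0. \<forall>x\<in>\<Lambda>. (\<forall>i<n. \<bar>x $ i\<bar> < \<epsilon>) \<longrightarrow> x = 0\<^sub>v n"
    and full: "\<exists>M\<in>carrier_mat n n. det M \<noteq> 0 \<and> (\<forall>j<n. col M j \<in> \<Lambda>)"
begin

lemmas \<Lambda> = add_subgroupD[OF subgroup] add_subgroup_minus[OF subgroup]

text \<open>Vectors are sorted into boxes of side \<open>\<epsilon>\<close>. Two lattice vectors in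
  the same box have a difference with coordinates below \<open>\<epsilon>\<close>, so they are
  equal, and a bounded region meets only finitely many boxes.\<close>

lemma finite_bounded: "finite {x \<in> \<Lambda>. \<forall>i<n. \<bar>x $ i\<bar> \<le> C}"
proof -
  obtain \<epsilon> where \<epsilon>: "\<epsilon> > 0" "\<And>x. x \<in> \<Lambda> \<Longrightarrow> (\<And>i. i < n \<Longrightarrow> \<bar>x $ i\<bar> < \<epsilon>) \<Longrightarrow> x = 0\<^sub>v n"
    using discrete by blast
  define f where "f x = (\<lambda>i\<in>{..<n}. \<lfloor>x $ i / \<epsilon>\<rfloor>)" for x :: "real vec"
  let ?X = "{x \<in> \<Lambda>. \<forall>i<n. \<bar>x $ i\<bar> \<le> C}"
  have "f ` ?X \<subseteq> PiE {..<n} (\<lambda>_. {\<lfloor>- C / \<epsilon>\<rfloor>..\<lfloor>C / \<epsilon>\<rfloor>})"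
  proof (intro image_subsetI PiE_I)
    fix x i assume x: "x \<in> ?X" and i: "i \<in> {..<n}"
    then have "- C \<le> x $ i" "x $ i \<le> C" by (auto simp: abs_le_iff dest!: spec[of _ i])
    then have "- C / \<epsilon> \<le> x $ i / \<epsilon>" "x $ i / \<epsilon> \<le> C / \<epsilon>" 
      using \<epsilon>(1) divide_right_mono[of "- C" "x $ i" \<epsilon>] divide_right_mono[of "x $ i" C \<epsilon>] by auto
    then show "f x i \<in> {\<lfloor>- C / \<epsilon>\<rfloor>..\<lfloor>C / \<epsilon>\<rfloor>}" using i unfolding f_def by (auto intro: floor_mono)
  qed (auto simp: f_def)
  then have "finite (f ` ?X)" by (rule finite_subset) (intro finite_PiE, auto)
  moreover have "inj_on f ?X"
  proof (rule inj_onI)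
    fix x y assume x: "x \<in> ?X" and y: "y \<in> ?X" and eq: "f x = f y"
    have xy: "x - y \<in> \<Lambda>" using x y \<Lambda>(5) by simp
    have xc: "x \<in> carrier_vec n" and yc: "y \<in> carrier_vec n" using x y \<Lambda>(1) by auto
    have "x - y = 0\<^sub>v n"
    proof (rule \<epsilon>(2)[OF xy])
      fix i assume i: "i < n"
      have "\<lfloor>x $ i / \<epsilon>\<rfloor> = \<lfloor>y $ i / \<epsilon>\<rfloor>" using fun_cong[OF eq, of i] i by (simp add: f_def)
      then have "\<bar>x $ i / \<epsilon> - y $ i / \<epsilon>\<bar> < 1" by linarith
      then have "\<bar>(x $ i - y $ i) / \<epsilon>\<bar> < 1" by (simp add: diff_divide_distrib)
      then have "\<bar>x $ i - y $ i\<bar> < \<epsilon>" using \<epsilon>(1) by (simp add: abs_divide)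
      then show "\<bar>(x - y) $ i\<bar> < \<epsilon>" using i xc yc by simp
    qed
    then have "(x - y) $ i = 0" if "i < n" for i using that by simp
    then show "x = y" using xc yc by (intro eq_vecI) auto
  qed
  ultimately show ?thesis by (rule finite_imageD)
qed

lemma countable_lattice: "countable \<Lambda>"
proof -
  have "\<Lambda> = (\<Union>C::nat. {x \<in> \<Lambda>. \<forall>i<n. \<bar>x $ i\<bar> \<le> real C})"
  proof (intro equalityI subsetI)
    fix x assume x: "x \<in> \<Lambda>"
    define C where "C = nat \<lceil>\<Sum>i<n. \<bar>x $ i\<bar>\<rceil>"
    have "\<bar>x $ i\<bar> \<le> real C" if "i < n" for i
      using member_le_sum[of i "{..<n}" "\<lambda>i. \<bar>x $ i\<bar>"] that unfolding C_def
      by (metis (no_types, lifting) finite_lessThan abs_ge_zero lessThan_iff of_nat_ceiling order_trans)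
    then show "x \<in> (\<Union>C::nat. {x \<in> \<Lambda>. \<forall>i<n. \<bar>x $ i\<bar> \<le> real C})" using x by blast
  qed auto
  moreover have "countable (\<Union>C::nat. {x \<in> \<Lambda>. \<forall>i<n. \<bar>x $ i\<bar> \<le> real C})"
    by (rule countable_UN) (simp, rule countable_finite[OF finite_bounded])
  ultimately show ?thesis by simp
qed

text \<open>A common denominator for the coordinates of lattice vectors with respect to a sublattice,
  by the pigeonhole principle in a fundamental parallelepiped.\<close>

lemma common_denominator:
  assumes M: "M \<in> carrier_mat n n" and det: "det M \<noteq> 0" and cols: "\<And>j. j < n \<Longrightarrow> col M j \<in> \<Lambda>"
  obtains q :: nat where "q > 0"
    "\<forall>x\<in>\<Lambda>. \<exists>z. real q \<cdot>\<^sub>v x = M *\<^sub>v vec n (\<lambda>i. real_of_int (z i))"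
proof -
  obtain B where B: "B \<in> carrier_mat n n" "M * B = 1\<^sub>m n" "B * M = 1\<^sub>m n"
    by (rule nonsingular_right_inverse[OF M det])
  \<comment> \<open>A bound for the coordinates of \<open>M *\<^sub>v u\<close> when those of
    \<open>u\<close> have absolute value at most 1, so \<open>F\<close> contains every lattice
    vector of the fundamental parallelepiped. Neither \<open>C\<close> nor \<open>F\<close> depends
    on the vector \<open>x\<close> below.\<close>
  define C where "C = (\<Sum>i<n. \<Sum>j<n. \<bar>M $$ (i, j)\<bar>)"
  define F where "F = {x \<in> \<Lambda>. \<forall>i<n. \<bar>x $ i\<bar> \<le> C}"
  have F: "finite F" unfolding F_def by (rule finite_bounded)
  have "\<exists>z. real (fact (card F)) \<cdot>\<^sub>v x = M *\<^sub>v vec n (\<lambda>i. real_of_int (z i))" if x: "x \<in> \<Lambda>" for x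
  proof -
    note xc = \<Lambda>(1)[OF x]
    define c where "c = B *\<^sub>v x"
    have c: "c \<in> carrier_vec n" unfolding c_def by (rule mult_mat_vec_carrier[OF B(1) xc])
    have Mc: "M *\<^sub>v c = x" unfolding c_def using assoc_mult_mat_vec[OF M B(1) xc] B(2) xc by simp
    define fl where "fl j = vec n (\<lambda>i. real_of_int \<lfloor>real j * c $ i\<rfloor>)" for j :: nat
    \<comment> \<open>\<open>real j \<cdot>\<^sub>v x\<close> reduced modulo the sublattice spanned
      by the columns of \<open>M\<close>.\<close>
    define \<phi> where "\<phi> j = real j \<cdot>\<^sub>v x - M *\<^sub>v fl j" for j :: nat
    have flc: "fl j \<in> carrier_vec n" for j by (simp add: fl_def)
    have Mfl: "M *\<^sub>v fl j \<in> \<Lambda>" for j unfolding fl_def by (rule add_subgroup_combination[OF subgroup M cols])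
    have jx: "real j \<cdot>\<^sub>v x \<in> \<Lambda>" for j using add_subgroup_int_smult[OF subgroup x, of "int j"] by simp
    have \<phi>F: "\<phi> j \<in> F" for j
    proof -
      have "\<phi> j \<in> \<Lambda>" unfolding \<phi>_def by (rule \<Lambda>(5)[OF jx Mfl])
      moreover have "\<bar>\<phi> j $ i\<bar> \<le> C" if i: "i < n" for i
      proof -
        have "\<phi> j $ i = real j * (M *\<^sub>v c) $ i - (M *\<^sub>v fl j) $ i"
          using i xc M Mc by (simp add: \<phi>_def)
        also have "\<dots> = (\<Sum>t<n. M $$ (i, t) * (real j * c $ t - fl j $ t))"
          unfolding mat_vec_index_sum[OF M c i] mat_vec_index_sum[OF M flc i]
          by (simp add: sum_distrib_left sum_subtractf algebra_simps)
        finally have "\<bar>\<phi> j $ i\<bar> \<le> (\<Sum>t<n. \<bar>M $$ (i, t) * (real j * c $ t - fl j $ t)\<bar>)"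
          using sum_abs[of "\<lambda>t. M $$ (i, t) * (real j * c $ t - fl j $ t)" "{..<n}"] by simp
        also have "\<dots> \<le> (\<Sum>t<n. \<bar>M $$ (i, t)\<bar>)"
        proof (rule sum_mono)
          fix t assume "t \<in> {..<n}"
          then have "\<bar>real j * c $ t - fl j $ t\<bar> \<le> 1" unfolding fl_def by simp linarith
          then show "\<bar>M $$ (i, t) * (real j * c $ t - fl j $ t)\<bar> \<le> \<bar>M $$ (i, t)\<bar>"
            unfolding abs_mult by (intro mult_left_le) auto
        qed
        also have "\<dots> \<le> C" unfolding C_def
          by (rule member_le_sum[of i "{..<n}" "\<lambda>i. \<Sum>t<n. \<bar>M $$ (i, t)\<bar>"]) (use i in \<open>auto intro: sum_nonneg\<close>)
        finally show ?thesis .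
      qed
      ultimately show ?thesis by (simp add: F_def)
    qed
    \<comment> \<open>\<open>card F + 1\<close> multiples of \<open>x\<close> share at most
      \<open>card F\<close> residues. The distance \<open>d\<close> of two with equal residue is at
      most \<open>card F\<close>, hence divides \<open>fact (card F)\<close>, which thereby serves
      all \<open>x\<close> at once.\<close>
    have "\<not> inj_on \<phi> {..card F}"
    proof
      assume "inj_on \<phi> {..card F}"
      then have "card {..card F} \<le> card F" using \<phi>F F by (intro card_inj_on_le[of \<phi>]) auto
      then show False by simp
    qed
    then obtain j j' where jj: "j < j'" "j' \<le> card F" "\<phi> j = \<phi> j'"
      unfolding inj_on_def by (metis atMost_iff nat_neq_iff)
    define d where "d = j' - j"
    have d: "d > 0" "d \<le> card F" using jj by (auto simp: d_def)
    obtain e where e: "fact (card F) = d * e" using dvd_fact[of d "card F"] d by (auto simp: dvd_def)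
    define z where "z i = int e * (\<lfloor>real j' * c $ i\<rfloor> - \<lfloor>real j * c $ i\<rfloor>)" for i
    have zc: "vec n (\<lambda>i. real_of_int (z i)) \<in> carrier_vec n" by simp
    have "real (fact (card F)) \<cdot>\<^sub>v x = M *\<^sub>v vec n (\<lambda>i. real_of_int (z i))"
    proof (rule eq_vecI)
      fix i assume "i < dim_vec (M *\<^sub>v vec n (\<lambda>i. real_of_int (z i)))"
      then have i: "i < n" using M by simp
      have "\<phi> j $ i = real j * x $ i - (M *\<^sub>v fl j) $ i" for j using i xc M by (simp add: \<phi>_def)
      then have "real j' * x $ i - real j * x $ i = (M *\<^sub>v fl j') $ i - (M *\<^sub>v fl j) $ i"
        using arg_cong[OF jj(3), of "\<lambda>v. v $ i"] by simp
      then have dx: "real d * x $ i = (M *\<^sub>v fl j') $ i - (M *\<^sub>v fl j) $ i"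
        using jj(1) by (simp add: d_def of_nat_diff algebra_simps)
      have "(M *\<^sub>v vec n (\<lambda>i. real_of_int (z i))) $ i = (\<Sum>t<n. M $$ (i, t) * real_of_int (z t))"
        using mat_vec_index_sum[OF M zc i] by simp
      also have "\<dots> = real e * ((M *\<^sub>v fl j') $ i - (M *\<^sub>v fl j) $ i)"
        unfolding mat_vec_index_sum[OF M flc i]
        by (simp add: z_def fl_def sum_distrib_left sum_subtractf[symmetric] algebra_simps)
      also have "\<dots> = real (fact (card F)) * x $ i" unfolding dx[symmetric] e by simp
      finally show "(real (fact (card F)) \<cdot>\<^sub>v x) $ i = (M *\<^sub>v vec n (\<lambda>i. real_of_int (z i))) $ i"
        using i xc by simp
    qed (use xc M in auto)
    then show ?thesis by blast
  qed
  then show ?thesis using that[of "fact (card F)"] by (simp add: of_nat_fact)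
qed

text \<open>A lattice basis is a nonsingular matrix of lattice vectors of least \<open>\<bar>det\<bar>\<close>: replacing a column
  by a lattice vector with a fractional coordinate \<open>c\<close> there multiplies the determinant by \<open>c\<close>.\<close>

lemma lattice_basis:
  obtains M where "M \<in> carrier_mat n n" "det M \<noteq> 0" "\<And>j. j < n \<Longrightarrow> col M j \<in> \<Lambda>"
    "\<And>x. x \<in> \<Lambda> \<Longrightarrow> \<exists>z. x = M *\<^sub>v vec n (\<lambda>i. real_of_int (z i))"
proof -
  obtain M0 where M0: "M0 \<in> carrier_mat n n" "det M0 \<noteq> 0" "\<And>j. j < n \<Longrightarrow> col M0 j \<in> \<Lambda>" using full by blast
  obtain q :: nat where q: "q > 0" "\<forall>x\<in>\<Lambda>. \<exists>z. real q \<cdot>\<^sub>v x = M0 *\<^sub>v vec n (\<lambda>i. real_of_int (z i))"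
    by (rule common_denominator[OF M0])
  define P where "P M \<longleftrightarrow> M \<in> carrier_mat n n \<and> det M \<noteq> 0 \<and> (\<forall>j<n. col M j \<in> \<Lambda>)" for M
  \<comment> \<open>The determinant rescaled to an integer: \<open>real q \<cdot>\<^sub>m M\<close>
    is \<open>M0\<close> times an integer matrix, and \<open>\<nu> M\<close> is the absolute value
    of the determinant of that matrix. This is what guarantees a minimum.\<close>
  define \<nu> where "\<nu> M = real q ^ n * \<bar>det M\<bar> / \<bar>det M0\<bar>" for M
  have int: "\<exists>k::nat. \<nu> M = real k" if PM: "P M" for M
  proof -
    have M: "M \<in> carrier_mat n n" using PM by (simp add: P_def)
    have "\<exists>z. real q \<cdot>\<^sub>v col M j = M0 *\<^sub>v vec n (\<lambda>i. real_of_int (z i))" if "j < n" for j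
      using q(2) PM that by (simp add: P_def)
    then obtain z where z: "\<And>j. j < n \<Longrightarrow> real q \<cdot>\<^sub>v col M j = M0 *\<^sub>v vec n (\<lambda>i. real_of_int (z j i))" by metis
    define Z where "Z = mat n n (\<lambda>(i, j). z j i)"
    have Z: "map_mat real_of_int Z \<in> carrier_mat n n" by (simp add: Z_def)
    have "real q \<cdot>\<^sub>m M = M0 * map_mat real_of_int Z"
    proof (rule eq_matI)
      fix i j assume "i < dim_row (M0 * map_mat real_of_int Z)" "j < dim_col (M0 * map_mat real_of_int Z)"
      then have ij: "i < n" "j < n" using M0(1) Z by auto
      have "(real q \<cdot>\<^sub>m M) $$ (i, j) = (real q \<cdot>\<^sub>v col M j) $ i" using ij M by simp
      also have "\<dots> = (M0 *\<^sub>v vec n (\<lambda>i. real_of_int (z j i))) $ i" unfolding z[OF ij(2)] ..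
      also have "\<dots> = (M0 * map_mat real_of_int Z) $$ (i, j)"
        using ij M0(1) Z by (simp add: scalar_prod_def Z_def)
      finally show "(real q \<cdot>\<^sub>m M) $$ (i, j) = (M0 * map_mat real_of_int Z) $$ (i, j)" .
    qed (use M M0(1) Z in auto)
    then have "det (real q \<cdot>\<^sub>m M) = det M0 * det (map_mat real_of_int Z)" using det_mult[OF M0(1) Z] by simp
    then have "real q ^ n * det M = det M0 * real_of_int (det Z)" using M by simp
    then have "\<bar>real q ^ n * det M\<bar> = \<bar>det M0 * real_of_int (det Z)\<bar>" by simp
    then have "real q ^ n * \<bar>det M\<bar> = \<bar>det M0\<bar> * real_of_int \<bar>det Z\<bar>" by (simp add: abs_mult)
    then have "\<nu> M = real (nat \<bar>det Z\<bar>)" using M0(2) by (simp add: \<nu>_def)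
    then show ?thesis by blast
  qed
  have "P M0" using M0 by (simp add: P_def)
  then obtain M where PM: "P M" and min: "\<And>M'. P M' \<Longrightarrow> nat \<lfloor>\<nu> M\<rfloor> \<le> nat \<lfloor>\<nu> M'\<rfloor>"
    using ex_has_least_nat[of P M0 "\<lambda>M. nat \<lfloor>\<nu> M\<rfloor>"] by blast
  have M: "M \<in> carrier_mat n n" and det: "det M \<noteq> 0" and cols: "\<And>j. j < n \<Longrightarrow> col M j \<in> \<Lambda>"
    using PM by (auto simp: P_def)
  obtain B where B: "B \<in> carrier_mat n n" "M * B = 1\<^sub>m n" "B * M = 1\<^sub>m n"
    by (rule nonsingular_right_inverse[OF M det])
  have "\<exists>z. x = M *\<^sub>v vec n (\<lambda>i. real_of_int (z i))" if x: "x \<in> \<Lambda>" for x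
  proof -
    note xc = \<Lambda>(1)[OF x]
    define c where "c = B *\<^sub>v x"
    have c: "c \<in> carrier_vec n" unfolding c_def by (rule mult_mat_vec_carrier[OF B(1) xc])
    have Mc: "M *\<^sub>v c = x" unfolding c_def using assoc_mult_mat_vec[OF M B(1) xc] B(2) xc by simp
    have "c $ k = real_of_int \<lfloor>c $ k\<rfloor>" if k: "k < n" for k
    proof (rule ccontr)
      assume ne: "c $ k \<noteq> real_of_int \<lfloor>c $ k\<rfloor>"
      \<comment> \<open>Subtracting an integer multiple of column \<open>k\<close> from
        \<open>x\<close> leaves the fractional part of coordinate \<open>k\<close>, strictly between
        0 and 1.\<close>
      define c' where "c' = vec n (\<lambda>i. c $ i + (if i = k then - real_of_int \<lfloor>c $ k\<rfloor> else 0))"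
      have c': "c' \<in> carrier_vec n" by (simp add: c'_def)
      have frac: "0 < c' $ k" "c' $ k < 1" using ne k by (auto simp: c'_def) linarith+
      have "M *\<^sub>v c' = x + real_of_int (- \<lfloor>c $ k\<rfloor>) \<cdot>\<^sub>v col M k"
        unfolding Mc[symmetric] by (rule mat_vec_col_sum[OF M k c' _ c]) (auto simp: c'_def)
      then have x': "M *\<^sub>v c' \<in> \<Lambda>"
        using \<Lambda>(3)[OF x add_subgroup_int_smult[OF subgroup cols[OF k], of "- \<lfloor>c $ k\<rfloor>"]] by simp
      define M' where "M' = replace_col M (M *\<^sub>v c') k"
      have M': "M' \<in> carrier_mat n n" using M by (simp add: M'_def replace_col_def)
      have det': "det M' = c' $ k * det M" unfolding M'_def by (rule cramer_lemma_mat[OF M c' k])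
      have "col M' j \<in> \<Lambda>" if j: "j < n" for j
      proof (cases "j = k")
        case True
        have "col M' j = M *\<^sub>v c'" using True j M by (intro eq_vecI) (auto simp: M'_def replace_col_def)
        then show ?thesis using x' by simp
      next
        case False
        have "col M' j = col M j" using False j M by (intro eq_vecI) (auto simp: M'_def replace_col_def)
        then show ?thesis using cols[OF j] by simp
      qed
      then have PM': "P M'" using M' det det' frac by (simp add: P_def)
      obtain a b :: nat where ab: "\<nu> M = real a" "\<nu> M' = real b" using int[OF PM] int[OF PM'] by blast
      have "\<nu> M > 0" using q(1) det M0(2) by (simp add: \<nu>_def)
      moreover have "\<nu> M' = c' $ k * \<nu> M" using frac by (simp add: \<nu>_def det' abs_mult)
      ultimately have "\<nu> M' < \<nu> M" using frac by simp
      then show False using min[OF PM'] ab by simp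
    qed
    then have "c = vec n (\<lambda>i. real_of_int \<lfloor>c $ i\<rfloor>)" using c by (intro eq_vecI) auto
    then show ?thesis using Mc by metis
  qed
  then show ?thesis using that[OF M det cols] by blast
qed

text \<open>The vector \<open>k\<close> is chosen so that the exponential takes the right values on
  a lattice basis; the vectors where two characters agree form an additive group, which then
  contains the whole lattice.\<close>

lemma lattice_character:
  fixes \<psi> :: "real vec \<Rightarrow> complex"
  assumes mult: "\<And>x y. x \<in> \<Lambda> \<Longrightarrow> y \<in> \<Lambda> \<Longrightarrow> \<psi> (x + y) = \<psi> x * \<psi> y"
    and norm: "\<And>x. x \<in> \<Lambda> \<Longrightarrow> cmod (\<psi> x) = 1"
  obtains k where "k \<in> carrier_vec n" "\<And>x. x \<in> \<Lambda> \<Longrightarrow> \<psi> x = exp (2 * pi * \<i> * complex_of_real (k \<bullet> x))"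
proof -
  obtain M where M: "M \<in> carrier_mat n n" "det M \<noteq> 0" "\<And>j. j < n \<Longrightarrow> col M j \<in> \<Lambda>"
    and basis: "\<And>x. x \<in> \<Lambda> \<Longrightarrow> \<exists>z. x = M *\<^sub>v vec n (\<lambda>i. real_of_int (z i))"
    by (rule lattice_basis) blast
  obtain B where B: "B \<in> carrier_mat n n" "M * B = 1\<^sub>m n" "B * M = 1\<^sub>m n"
    by (rule nonsingular_right_inverse[OF M(1,2)])
  \<comment> \<open>Arguments of \<open>\<psi>\<close> on the basis, in units of full turns. As
    \<open>B\<close> inverts \<open>M\<close>, the vector \<open>k\<close> below has scalar product
    \<open>\<theta> $ j\<close> with column \<open>j\<close>.\<close>
  define \<theta> where "\<theta> = vec n (\<lambda>j. Arg (\<psi> (col M j)) / (2 * pi))"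
  have \<theta>: "\<theta> \<in> carrier_vec n" by (simp add: \<theta>_def)
  define k where "k = transpose_mat B *\<^sub>v \<theta>"
  have BT: "transpose_mat B \<in> carrier_mat n n" using B(1) by simp
  have k: "k \<in> carrier_vec n" unfolding k_def by (rule mult_mat_vec_carrier[OF BT \<theta>])
  define e where "e x = exp (2 * pi * \<i> * complex_of_real (k \<bullet> x))" for x
  have kcol: "k \<bullet> col M j = \<theta> $ j" if j: "j < n" for j
  proof -
    have "k \<bullet> col M j = row (transpose_mat M) j \<bullet> k"
      using j M(1) k by (simp add: comm_scalar_prod[of k n])
    also have "\<dots> = (transpose_mat M *\<^sub>v k) $ j" using j M(1) by simp
    also have "transpose_mat M *\<^sub>v k = (transpose_mat M * transpose_mat B) *\<^sub>v \<theta>"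
      unfolding k_def by (rule assoc_mult_mat_vec[of _ n n _ n, symmetric]) (use M(1) B(1) \<theta> in auto)
    also have "transpose_mat M * transpose_mat B = transpose_mat (B * M)"
      using transpose_mult[OF B(1) M(1)] by simp
    also have "\<dots> = 1\<^sub>m n" using B(3) by simp
    finally show ?thesis using \<theta> by simp
  qed
  have \<psi>0: "\<psi> (0\<^sub>v n) = 1"
  proof -
    have "0\<^sub>v n + 0\<^sub>v n = (0\<^sub>v n :: real vec)" by simp
    then have "\<psi> (0\<^sub>v n) = \<psi> (0\<^sub>v n) * \<psi> (0\<^sub>v n)" using mult[OF \<Lambda>(2) \<Lambda>(2)] by metis
    moreover have "\<psi> (0\<^sub>v n) \<noteq> 0" using norm[OF \<Lambda>(2)] by auto
    ultimately show ?thesis by simp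
  qed
  define X where "X = {x \<in> \<Lambda>. \<psi> x = e x}"
  have "add_subgroup n X"
    unfolding add_subgroup_def
  proof (intro conjI ballI)
    show "X \<subseteq> carrier_vec n" using \<Lambda>(1) by (auto simp: X_def)
    show "0\<^sub>v n \<in> X" using \<Lambda>(2) \<psi>0 k by (simp add: X_def e_def)
    show "x + y \<in> X" if "x \<in> X" "y \<in> X" for x y
      using that \<Lambda>(1,3) mult k
      by (auto simp: X_def e_def scalar_prod_add_distrib[of k n] exp_add[symmetric] algebra_simps)
    show "- x \<in> X" if x: "x \<in> X" for x
    proof -
      have xL: "x \<in> \<Lambda>" and ex: "\<psi> x = e x" using x by (auto simp: X_def)
      have xc: "x \<in> carrier_vec n" using \<Lambda>(1)[OF xL] .
      have "x + - x = 0\<^sub>v n" using xc by (intro eq_vecI) auto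
      then have "e x * \<psi> (- x) = 1" using mult[OF xL \<Lambda>(4)[OF xL]] \<psi>0 ex by simp
      moreover have "e x * e (- x) = 1"
      proof -
        have "k \<bullet> (- x) = - (k \<bullet> x)" using k xc by simp
        then show ?thesis by (simp add: e_def flip: exp_add)
      qed
      moreover have "e x \<noteq> 0" by (simp add: e_def)
      ultimately have "\<psi> (- x) = e (- x)" by (metis mult_left_cancel)
      then show ?thesis using \<Lambda>(4)[OF xL] by (simp add: X_def)
    qed
  qed
  moreover have "col M j \<in> X" if j: "j < n" for j
  proof -
    have "\<psi> (col M j) \<noteq> 0" using norm[OF M(3)[OF j]] by auto
    then have "\<psi> (col M j) = exp (\<i> * complex_of_real (Arg (\<psi> (col M j))))"
      using Arg_eq[of "\<psi> (col M j)"] norm[OF M(3)[OF j]] by simp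
    also have "\<i> * complex_of_real (Arg (\<psi> (col M j))) = 2 * pi * \<i> * complex_of_real (k \<bullet> col M j)"
      unfolding kcol[OF j] using j by (simp add: \<theta>_def)
    finally show ?thesis using M(3)[OF j] by (simp add: X_def e_def)
  qed
  ultimately have "\<And>z. M *\<^sub>v vec n (\<lambda>i. real_of_int (z i)) \<in> X" by (rule add_subgroup_combination[OF _ M(1)])
  then have "\<psi> x = e x" if "x \<in> \<Lambda>" for x using basis[OF that] by (auto simp: X_def)
  then show ?thesis using that[OF k] by (simp add: e_def)
qed

text \<open>A linear map is determined by the images of \<open>n\<close> independent lattice
  vectors, and orthogonality confines each image to the finitely many lattice vectors within a
  coordinate bound.\<close>

lemma finite_orthogonal_stabilizer:
  assumes P: "\<And>L. L \<in> P \<Longrightarrow> L \<in> orthogonal_mats n" and stab: "\<And>L x. L \<in> P \<Longrightarrow> x \<in> \<Lambda> \<Longrightarrow> L *\<^sub>v x \<in> \<Lambda>"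
  shows "finite P"
proof -
  obtain M where M: "M \<in> carrier_mat n n" "det M \<noteq> 0" "\<And>j. j < n \<Longrightarrow> col M j \<in> \<Lambda>" using full by blast
  obtain B where B: "B \<in> carrier_mat n n" "M * B = 1\<^sub>m n" "B * M = 1\<^sub>m n"
    by (rule nonsingular_right_inverse[OF M(1,2)])
  define f where "f L = (\<lambda>j\<in>{..<n}. L *\<^sub>v col M j)" for L :: "real mat"
  define Y where "Y j = {x \<in> \<Lambda>. \<forall>i<n. \<bar>x $ i\<bar> \<le> sqrt (col M j \<bullet> col M j)}" for j
  have Pc: "L \<in> carrier_mat n n" if "L \<in> P" for L using P[OF that] by (simp add: orthogonal_mats_def)
  have "f ` P \<subseteq> PiE {..<n} Y"
  proof (intro image_subsetI PiE_I)
    fix L j assume L: "L \<in> P" and "j \<in> {..<n}"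
    then have j: "j < n" by simp
    have xc: "col M j \<in> carrier_vec n" using M(1) by auto
    have Lx: "L *\<^sub>v col M j \<in> carrier_vec n" by (rule mult_mat_vec_carrier[OF Pc[OF L] xc])
    have "L * transpose_mat L = 1\<^sub>m n" using P[OF L] by (simp add: orthogonal_mats_def)
    then have LL: "transpose_mat L * L = 1\<^sub>m n"
      by (rule mat_mult_left_right_inverse[OF Pc[OF L], of "transpose_mat L", rotated]) (use Pc[OF L] in simp)
    have "(L *\<^sub>v col M j) \<bullet> (L *\<^sub>v col M j) = col M j \<bullet> (transpose_mat L *\<^sub>v (L *\<^sub>v col M j))"
      using transpose_vec_mult_scalar[OF Pc[OF L] xc Lx] comm_scalar_prod[of "transpose_mat L *\<^sub>v (L *\<^sub>v col M j)" n "col M j"]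
        Pc[OF L] xc Lx by simp
    also have "transpose_mat L *\<^sub>v (L *\<^sub>v col M j) = (transpose_mat L * L) *\<^sub>v col M j"
      by (rule assoc_mult_mat_vec[of _ n n _ n, symmetric]) (use Pc[OF L] xc in auto)
    also have "\<dots> = col M j" unfolding LL using xc by simp
    finally have "(L *\<^sub>v col M j) \<bullet> (L *\<^sub>v col M j) = col M j \<bullet> col M j" .
    then have "\<bar>(L *\<^sub>v col M j) $ i\<bar> \<le> sqrt (col M j \<bullet> col M j)" if "i < n" for i
      using real_vec_norm_index_le[OF Lx that] by simp
    then show "f L j \<in> Y j" using stab[OF L M(3)[OF j]] j by (simp add: f_def Y_def)
  qed (auto simp: f_def)
  moreover have "finite (PiE {..<n} Y)" by (intro finite_PiE) (auto simp: Y_def finite_bounded)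
  ultimately have "finite (f ` P)" by (rule finite_subset)
  moreover have "inj_on f P"
  proof (rule inj_onI)
    fix L L' assume L: "L \<in> P" "L' \<in> P" and eq: "f L = f L'"
    have "L * M = L' * M"
    proof (rule eq_matI)
      fix i j assume "i < dim_row (L' * M)" "j < dim_col (L' * M)"
      then have ij: "i < n" "j < n" using Pc[OF L(2)] M(1) by auto
      have "L *\<^sub>v col M j = L' *\<^sub>v col M j" using fun_cong[OF eq, of j] ij by (simp add: f_def)
      then have "(L *\<^sub>v col M j) $ i = (L' *\<^sub>v col M j) $ i" by simp
      then show "(L * M) $$ (i, j) = (L' * M) $$ (i, j)" using ij Pc[OF L(1)] Pc[OF L(2)] M(1) by simp
    qed (use Pc[OF L(1)] Pc[OF L(2)] in auto)
    then have "L * M * B = L' * M * B" by simp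
    then show "L = L'" using Pc[OF L(1)] Pc[OF L(2)] M(1) B by (simp add: mat_assoc)
  qed
  ultimately show ?thesis by (rule finite_imageD)
qed

lemma fixes_lattice_imp_one:
  assumes L: "L \<in> carrier_mat n n" and "\<And>x. x \<in> \<Lambda> \<Longrightarrow> L *\<^sub>v x = x"
  shows "L = 1\<^sub>m n"
proof -
  obtain M where M: "M \<in> carrier_mat n n" "det M \<noteq> 0" "\<And>j. j < n \<Longrightarrow> col M j \<in> \<Lambda>" using full by blast
  obtain B where B: "B \<in> carrier_mat n n" "M * B = 1\<^sub>m n" "B * M = 1\<^sub>m n"
    by (rule nonsingular_right_inverse[OF M(1,2)])
  have "L * M = M"
  proof (rule eq_matI)
    fix i j assume ij: "i < dim_row M" "j < dim_col M"
    then have "L *\<^sub>v col M j = col M j" using assms(2) M by simp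
    then have "(L *\<^sub>v col M j) $ i = col M j $ i" by simp
    then show "(L * M) $$ (i, j) = M $$ (i, j)" using ij L M(1) by simp
  qed (use L M(1) in auto)
  then have "L * M * B = M * B" by simp
  then show ?thesis using L M(1) B by (simp add: mat_assoc)
qed

end

lemma lin_indpt_matrix:
  assumes "B \<subseteq> carrier_vec n" "finite B" "card B = n"
    "\<not> LinearCombinations.module.lin_dep class_ring (module_vec TYPE(real) n) B"
  obtains M where "M \<in> carrier_mat n n" "det M \<noteq> 0" "\<forall>j<n. col M j \<in> B"
proof -
  interpret vec_space "TYPE(real)" n .
  obtain bs where bs: "set bs = B" "distinct bs" using finite_distinct_list[OF assms(2)] by blast
  have len: "length bs = n" using distinct_card[OF bs(2)] bs(1) assms(3) by simp
  define M where "M = mat_of_cols n bs"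
  have M: "M \<in> carrier_mat n n" using mat_of_cols_carrier(1)[of n bs] len by (simp add: M_def)
  have cols: "cols M = bs" unfolding M_def by (rule cols_mat_of_cols) (use bs(1) assms(1) in auto)
  have "det M \<noteq> 0"
  proof
    assume "det M = 0"
    then obtain v where "v \<in> carrier_vec n" "v \<noteq> 0\<^sub>v n" "M *\<^sub>v v = 0\<^sub>v n"
      using det_0_iff_vec_prod_zero[OF M] by blast
    then have "lin_dep (set (cols M))" using lin_depI[OF M] cols bs(2) by simp
    then show False using assms(4) cols bs(1) by simp
  qed
  moreover have "col M j \<in> B" if "j < n" for j
    using cols bs(1) that M by (metis carrier_matD(2) cols_length cols_nth nth_mem)
  ultimately show ?thesis using that[OF M] by blast
qed

section \<open>Groups acting on a lattice by a finite point group\<close>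

lemma orthogonal_scalar_prod:
  assumes L: "L \<in> orthogonal_mats n" and x: "x \<in> carrier_vec n" and y: "y \<in> carrier_vec n"
  shows "(L *\<^sub>v x) \<bullet> (L *\<^sub>v y) = x \<bullet> y"
proof -
  have Lc: "L \<in> carrier_mat n n" and "L * transpose_mat L = 1\<^sub>m n" using L by (auto simp: orthogonal_mats_def)
  then have LL: "transpose_mat L * L = 1\<^sub>m n"
    using mat_mult_left_right_inverse[of L n "transpose_mat L"] by simp
  have LT: "transpose_mat L \<in> carrier_mat n n" using Lc by simp
  have Lx: "L *\<^sub>v x \<in> carrier_vec n" by (rule mult_mat_vec_carrier[OF Lc x])
  have "(L *\<^sub>v x) \<bullet> (L *\<^sub>v y) = (transpose_mat L *\<^sub>v (L *\<^sub>v x)) \<bullet> y"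
    by (rule transpose_vec_mult_scalar[OF Lc y Lx, symmetric])
  also have "transpose_mat L *\<^sub>v (L *\<^sub>v x) = x"
    using assoc_mult_mat_vec[OF LT Lc x] LL x by simp
  finally show ?thesis .
qed

lemma (in group) rep_class_cong:
  assumes "\<And>x. x \<in> carrier G \<Longrightarrow> \<sigma> x = \<sigma>' x"
  shows "rep_class G \<sigma> = rep_class G \<sigma>'"
  using assms by (auto simp: rep_class_def rep_equiv_def rep_dim_def)

lemma vec_add_cancel:
  assumes "x \<in> carrier_vec n" "y \<in> carrier_vec n" "z \<in> carrier_vec n" "x + y = x + (z :: real vec)"
  shows "y = z"
proof (rule eq_vecI)
  fix i assume "i < dim_vec z"
  then show "y $ i = z $ i" using arg_cong[OF assms(4), of "\<lambda>v. v $ i"] assms(1-3) by simp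
qed (use assms in auto)

lemma mat_smult_1: "1 \<cdot>\<^sub>m M = (M :: 'a :: monoid_mult mat)"
  by (rule eq_matI) auto

lemma ex1_unique: "\<exists>!x. P x \<Longrightarrow> P a \<Longrightarrow> P b \<Longrightarrow> a = b"
  by blast

text \<open>The group is kept abstract; only the linear part \<open>L\<close> and the translation
  part \<open>\<tau>\<close> of the projected isometry are retained, so the orthogonal factor on the
  first coordinates disappears from view. Injectivity of \<open>\<tau>\<close> is asked on
  \<open>A\<close> only, because all elements of the kernel of the projection share the value
  zero.\<close>

locale crystal = group H for H (structure) +
  fixes n :: nat and L :: "'a \<Rightarrow> real mat" and \<tau> :: "'a \<Rightarrow> real vec" and A :: "'a set"
  assumes L_orthogonal: "g \<in> carrier H \<Longrightarrow> L g \<in> orthogonal_mats n"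
    and \<tau>_carrier: "g \<in> carrier H \<Longrightarrow> \<tau> g \<in> carrier_vec n"
    and L_mult: "g \<in> carrier H \<Longrightarrow> h \<in> carrier H \<Longrightarrow> L (g \<otimes> h) = L g * L h"
    and \<tau>_mult: "g \<in> carrier H \<Longrightarrow> h \<in> carrier H \<Longrightarrow> \<tau> (g \<otimes> h) = \<tau> g + L g *\<^sub>v \<tau> h"
    and A_norm: "A \<lhd> H"
    and L_A: "a \<in> A \<Longrightarrow> L a = 1\<^sub>m n"
    and inj_\<tau>: "inj_on \<tau> A"
    and lattice: "vec_lattice n (\<tau> ` A)"
begin

text \<open>The elements that project to translations; for the group of the theorem this is
  \<open>TF\<close>, see \<open>TF_eq\<close>.\<close>

definition K :: "'a set" where "K = {g \<in> carrier H. L g = 1\<^sub>m n}"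

lemma L_carrier: "g \<in> carrier H \<Longrightarrow> L g \<in> carrier_mat n n"
  using L_orthogonal by (auto simp: orthogonal_mats_def)

lemma L_one: "L \<one> = 1\<^sub>m n"
proof -
  have "L \<one> = 1\<^sub>m n * L \<one>" using L_carrier[OF one_closed] by simp
  also have "1\<^sub>m n = transpose_mat (L \<one>) * L \<one>"
    using L_orthogonal[OF one_closed] mat_mult_left_right_inverse[of "L \<one>" n "transpose_mat (L \<one>)"]
    by (auto simp: orthogonal_mats_def)
  also have "transpose_mat (L \<one>) * L \<one> * L \<one> = transpose_mat (L \<one>) * L (\<one> \<otimes> \<one>)"
    using L_carrier[OF one_closed] L_mult[OF one_closed one_closed] by (simp add: mat_assoc)
  also have "\<dots> = 1\<^sub>m n"
    using L_orthogonal[OF one_closed] mat_mult_left_right_inverse[of "L \<one>" n "transpose_mat (L \<one>)"]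
    by (auto simp: orthogonal_mats_def)
  finally show ?thesis .
qed

lemma \<tau>_one: "\<tau> \<one> = 0\<^sub>v n"
proof -
  have "\<tau> \<one> + \<tau> \<one> = \<tau> \<one> + 0\<^sub>v n"
    using \<tau>_mult[OF one_closed one_closed] L_one \<tau>_carrier[OF one_closed] by simp
  then show ?thesis using vec_add_cancel[of "\<tau> \<one>" n "\<tau> \<one>" "0\<^sub>v n"] \<tau>_carrier[OF one_closed] by simp
qed

lemma L_inv_mult: "g \<in> carrier H \<Longrightarrow> L g * L (inv g) = 1\<^sub>m n"
  using L_mult[of g "inv g"] L_one by simp

lemma K_normal: "K \<lhd> H"
  unfolding normal_inv_iff
proof (intro conjI ballI)
  show "subgroup K H"
  proof
    show "K \<subseteq> carrier H" by (auto simp: K_def)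
    show "x \<otimes> y \<in> K" if "x \<in> K" "y \<in> K" for x y using that L_mult by (auto simp: K_def)
    show "\<one> \<in> K" by (simp add: K_def L_one)
    show "inv x \<in> K" if "x \<in> K" for x
      using that L_inv_mult[of x] L_carrier[of "inv x"] by (auto simp: K_def)
  qed
  fix g k assume g: "g \<in> carrier H" and k: "k \<in> K"
  have "L (g \<otimes> k \<otimes> inv g) = L g * L k * L (inv g)" using g k L_mult by (simp add: K_def)
  also have "\<dots> = 1\<^sub>m n" using k L_carrier[OF g] L_inv_mult[OF g] by (simp add: K_def)
  finally show "g \<otimes> k \<otimes> inv g \<in> K" using g k by (simp add: K_def)
qed

lemma A_subgroup': "subgroup A H" using A_norm by (simp add: normal_def)

lemma A_carrier: "a \<in> A \<Longrightarrow> a \<in> carrier H" using subgroup.mem_carrier[OF A_subgroup'] .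

lemma A_sub_K: "A \<subseteq> K" using A_carrier L_A by (auto simp: K_def)

lemma \<tau>_mult_K: "x \<in> K \<Longrightarrow> g \<in> carrier H \<Longrightarrow> \<tau> (x \<otimes> g) = \<tau> x + \<tau> g"
  using \<tau>_mult[of x g] \<tau>_carrier[of g] by (auto simp: K_def)

lemma A_conj_mem: "g \<in> carrier H \<Longrightarrow> a \<in> A \<Longrightarrow> g \<otimes> a \<otimes> inv g \<in> A"
  using A_norm by (simp add: normal_inv_iff)

text \<open>Compare \<open>\<tau>\<close> of \<open>g \<otimes> a\<close> with \<open>\<tau>\<close>
  of the same element written as \<open>(g \<otimes> a \<otimes> inv g) \<otimes> g\<close>. This is
  how the group acts on the lattice.\<close>

lemma \<tau>_conj:
  assumes g: "g \<in> carrier H" and a: "a \<in> K"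
  shows "\<tau> (g \<otimes> a \<otimes> inv g) = L g *\<^sub>v \<tau> a"
proof -
  have aG: "a \<in> carrier H" using a by (simp add: K_def)
  have c: "g \<otimes> a \<otimes> inv g \<in> K" using K_normal g a by (simp add: normal_inv_iff)
  have "(g \<otimes> a \<otimes> inv g) \<otimes> g = g \<otimes> a" using g aG by (simp add: m_assoc)
  then have "\<tau> (g \<otimes> a \<otimes> inv g) + \<tau> g = \<tau> g + L g *\<^sub>v \<tau> a"
    using \<tau>_mult_K[OF c g] \<tau>_mult[OF g aG] by simp
  moreover have cG: "g \<otimes> a \<otimes> inv g \<in> carrier H" using g aG by simp
  moreover have "\<tau> (g \<otimes> a \<otimes> inv g) + \<tau> g = \<tau> g + \<tau> (g \<otimes> a \<otimes> inv g)"
    by (rule comm_add_vec[OF \<tau>_carrier[OF cG] \<tau>_carrier[OF g]])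
  ultimately have "\<tau> g + \<tau> (g \<otimes> a \<otimes> inv g) = \<tau> g + L g *\<^sub>v \<tau> a" by metis
  then show ?thesis
    by (rule vec_add_cancel[OF \<tau>_carrier[OF g] \<tau>_carrier[OF cG] mult_mat_vec_carrier[OF L_carrier[OF g] \<tau>_carrier[OF aG]]])
qed

lemma finite_L: "finite (L ` carrier H)"
proof (rule vec_lattice.finite_orthogonal_stabilizer[OF lattice])
  show "M \<in> orthogonal_mats n" if "M \<in> L ` carrier H" for M using that L_orthogonal by auto
  show "M *\<^sub>v x \<in> \<tau> ` A" if Mx: "M \<in> L ` carrier H" "x \<in> \<tau> ` A" for M x
  proof -
    obtain g a where ga: "g \<in> carrier H" "M = L g" "a \<in> A" "x = \<tau> a" using Mx by blast
    have "M *\<^sub>v x = \<tau> (g \<otimes> a \<otimes> inv g)" using \<tau>_conj[OF ga(1) subsetD[OF A_sub_K ga(3)]] ga(2,4) by simp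
    then show ?thesis using A_conj_mem[OF ga(1,3)] by blast
  qed
qed

lemma L_K: "k \<in> K \<Longrightarrow> L k = 1\<^sub>m n" by (simp add: K_def)

lemma K_I: "k \<in> carrier H \<Longrightarrow> L k = 1\<^sub>m n \<Longrightarrow> k \<in> K" by (simp add: K_def)

sublocale normal_subgroup H K
  by (intro normal_subgroup.intro normal_subgroup_axioms.intro group_axioms K_normal)

lemma coset_iff_L:
  assumes g: "g \<in> carrier H" and h: "h \<in> carrier H"
  shows "inv g \<otimes> h \<in> K \<longleftrightarrow> L g = L h"
proof
  have ig: "inv g \<in> carrier H" by (rule inv_closed[OF g])
  have igh: "inv g \<otimes> h \<in> carrier H" by (rule m_closed[OF ig h])
  show "L g = L h" if k: "inv g \<otimes> h \<in> K"
  proof -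
    have "L (g \<otimes> (inv g \<otimes> h)) = L g * L (inv g \<otimes> h)" by (rule L_mult[OF g igh])
    also have "L (inv g \<otimes> h) = 1\<^sub>m n" by (rule L_K[OF k])
    also have "L g * 1\<^sub>m n = L g" by (rule right_mult_one_mat[OF L_carrier[OF g]])
    finally have "L (g \<otimes> (inv g \<otimes> h)) = L g" .
    then show ?thesis unfolding inv_cancel(1)[OF g h] by (rule sym)
  qed
  show "inv g \<otimes> h \<in> K" if eq: "L g = L h"
  proof -
    have "L (inv g \<otimes> h) = L (inv g) * L g" unfolding eq by (rule L_mult[OF ig h])
    also have "\<dots> = L (inv g \<otimes> g)" by (rule L_mult[OF ig g, symmetric])
    also have "\<dots> = 1\<^sub>m n" unfolding l_inv[OF g] by (rule L_one)
    finally show ?thesis by (rule K_I[OF igh])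
  qed
qed

text \<open>\<open>L\<close> takes finitely many values and separates the cosets of
  \<open>K\<close>; one preimage of each value is a transversal.\<close>

lemma transversal_exists: "\<exists>rs. left_transversal H K rs"
proof -
  obtain Ms where Ms: "set Ms = L ` carrier H" "distinct Ms" using finite_distinct_list[OF finite_L] by blast
  define r where "r M = (SOME g. g \<in> carrier H \<and> L g = M)" for M
  have r: "r M \<in> carrier H \<and> L (r M) = M" if "M \<in> L ` carrier H" for M
    unfolding r_def by (rule someI_ex) (use that in blast)
  have nth: "Ms ! p \<in> L ` carrier H" if "p < length Ms" for p using nth_mem[OF that] Ms(1) by simp
  have iff: "h \<in> r (Ms ! p) <# K \<longleftrightarrow> Ms ! p = L h" if "h \<in> carrier H" "p < length Ms" for h p
    using mem_coset_iff[of "r (Ms ! p)" h] coset_iff_L[of "r (Ms ! p)" h] r[OF nth[OF that(2)]] that by simp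
  have "left_transversal H K (map r Ms)"
    unfolding left_transversal_def
  proof (intro conjI ballI)
    show "set (map r Ms) \<subseteq> carrier H" using r Ms(1) by auto
    fix h assume h: "h \<in> carrier H"
    then obtain p where p: "p < length Ms" "Ms ! p = L h" using Ms(1) by (metis imageI in_set_conv_nth)
    show "\<exists>!p. p < length (map r Ms) \<and> h \<in> map r Ms ! p <# K"
    proof (rule ex1I[of _ p])
      show "p < length (map r Ms) \<and> h \<in> map r Ms ! p <# K" using p iff[OF h p(1)] by simp
      fix q assume q: "q < length (map r Ms) \<and> h \<in> map r Ms ! q <# K"
      then have ql: "q < length Ms" by simp
      then have "Ms ! q = Ms ! p" using q iff[OF h ql] p(2) by simp
      then show "q = p" using nth_eq_iff_index_eq[OF Ms(2) ql p(1)] by simp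
    qed
  qed
  then show ?thesis by blast
qed

text \<open>Conjugation by \<open>g\<close> acts on the lattice as \<open>L g\<close>, and
  \<open>\<tau>\<close> is injective on \<open>A\<close>. So \<open>g\<close> commutes with
  \<open>A\<close> exactly when \<open>L g\<close> fixes the lattice pointwise, which for a full
  lattice means \<open>L g = 1\<^sub>m n\<close>.\<close>

sublocale central_extension H K A
proof (intro central_extension.intro central_extension_axioms.intro)
  show "normal_subgroup H K" by (rule normal_subgroup_axioms)
  show "A \<lhd> H" by (rule A_norm)
  show "A \<subseteq> K" by (rule A_sub_K)
  have inj: "a = b" if "a \<in> A" "b \<in> A" "\<tau> a = \<tau> b" for a b using inj_onD[OF inj_\<tau>] that by blast
  show "a \<otimes> k = k \<otimes> a" if a: "a \<in> A" and k: "k \<in> K" for a k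
  proof -
    have aG: "a \<in> carrier H" and kG: "k \<in> carrier H" using a k A_carrier by auto
    have aK: "a \<in> K" using a A_sub_K by blast
    have "\<tau> (k \<otimes> a \<otimes> inv k) = \<tau> a" using \<tau>_conj[OF kG aK] L_K[OF k] \<tau>_carrier[OF aG] by simp
    then have "k \<otimes> a \<otimes> inv k = a" using inj[OF A_conj_mem[OF kG a] a] by simp
    then have "k \<otimes> a \<otimes> inv k \<otimes> k = a \<otimes> k" by simp
    then show ?thesis using aG kG by (simp add: m_assoc)
  qed
  show "h \<in> K" if h: "h \<in> carrier H" and comm: "\<And>a. a \<in> A \<Longrightarrow> h \<otimes> a = a \<otimes> h" for h
  proof -
    have "L h *\<^sub>v x = x" if "x \<in> \<tau> ` A" for x
    proof -
      obtain a where a: "a \<in> A" "x = \<tau> a" using \<open>x \<in> \<tau> ` A\<close> by blast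
      have aG: "a \<in> carrier H" by (rule A_carrier[OF a(1)])
      have "h \<otimes> a \<otimes> inv h = a" using comm[OF a(1)] h aG by (simp add: m_assoc)
      then show ?thesis using \<tau>_conj[OF h, of a] A_sub_K a by auto
    qed
    then have "L h = 1\<^sub>m n" using vec_lattice.fixes_lattice_imp_one[OF lattice L_carrier[OF h]] by blast
    then show ?thesis by (rule K_I[OF h])
  qed
  show "\<exists>rs. left_transversal H K rs" by (rule transversal_exists)
qed

lemma \<tau>_eq_0_iff: "a \<in> A \<Longrightarrow> \<tau> a = 0\<^sub>v n \<longleftrightarrow> a = \<one>"
  using inj_onD[OF inj_\<tau>, of a \<one>] A_closed(3) \<tau>_one by auto

definition \<chi> :: "real vec \<Rightarrow> 'a \<Rightarrow> complex" where
  "\<chi> k g = exp (2 * pi * \<i> * complex_of_real (k \<bullet> \<tau> g))"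

lemma \<chi>_mult: "k \<in> carrier_vec n \<Longrightarrow> x \<in> K \<Longrightarrow> y \<in> K \<Longrightarrow> \<chi> k (x \<otimes> y) = \<chi> k x * \<chi> k y"
  using \<tau>_mult_K[of x y] \<tau>_carrier[of x] \<tau>_carrier[of y]
  by (simp add: \<chi>_def scalar_prod_add_distrib[of k n] exp_add[symmetric] algebra_simps)

lemma \<chi>_add: "k \<in> carrier_vec n \<Longrightarrow> l \<in> carrier_vec n \<Longrightarrow> x \<in> K \<Longrightarrow> \<chi> (k + l) x = \<chi> k x * \<chi> l x"
  using \<tau>_carrier[of x]
  by (simp add: \<chi>_def add_scalar_prod_distrib[of k n] exp_add[symmetric] algebra_simps)

lemma \<chi>_zero: "x \<in> K \<Longrightarrow> \<chi> (0\<^sub>v n) x = 1"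
  using \<tau>_carrier[of x] by (simp add: \<chi>_def)

lemma \<chi>_cnj: "\<chi> k x * cnj (\<chi> k x) = 1"
  by (simp add: \<chi>_def exp_cnj flip: exp_add)

text \<open>\<open>\<tau> x\<close> is \<open>L g\<close> applied to the translation part of the
  conjugated element, and \<open>L g\<close> preserves scalar products; so conjugation rotates the
  parameter of the character.\<close>

lemma \<chi>_conj:
  assumes g: "g \<in> carrier H" and k: "k \<in> carrier_vec n" and x: "x \<in> K"
  shows "\<chi> k (inv g \<otimes> x \<otimes> g) = \<chi> (L g *\<^sub>v k) x"
proof -
  have xG: "x \<in> carrier H" using x by simp
  let ?y = "inv g \<otimes> x \<otimes> g"
  have y: "?y \<in> K" by (rule K_conj'[OF g x])
  have "g \<otimes> ?y \<otimes> inv g = x" using g xG by (simp add: m_assoc)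
  then have "\<tau> x = L g *\<^sub>v \<tau> ?y" using \<tau>_conj[OF g y] by simp
  then show ?thesis
    using orthogonal_scalar_prod[OF L_orthogonal[OF g] k \<tau>_carrier[of ?y]] y by (simp add: \<chi>_def)
qed

section \<open>Conjugations and twists on the dual of \<open>K\<close>\<close>

abbreviation "actc \<equiv> dual_act H GK"
abbreviation "twist k \<equiv> dual_twist GK (\<chi> k)"
abbreviation "twist_rep k \<sigma> \<equiv> (\<lambda>x. \<chi> k x \<cdot>\<^sub>m \<sigma> x)"

lemma twist_rep_hom:
  assumes \<sigma>: "\<sigma> \<in> hom GK (unitary_group s)" and k: "k \<in> carrier_vec n"
  shows "twist_rep k \<sigma> \<in> hom GK (unitary_group s)"
proof (rule homI)
  fix x assume x: "x \<in> carrier GK"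
  note c = K.unitary_homD(1)[OF \<sigma> x]
  have "mat_adjoint (twist_rep k \<sigma> x) * twist_rep k \<sigma> x = (\<chi> k x * cnj (\<chi> k x)) \<cdot>\<^sub>m (mat_adjoint (\<sigma> x) * \<sigma> x)"
    using c by (simp add: mat_adjoint_smult mat_smult_left mat_smult_right mat_smult_smult)
  also have "\<dots> = 1\<^sub>m s" unfolding \<chi>_cnj K.unitary_homD(6)[OF \<sigma> x] by (auto intro!: eq_matI)
  finally show "twist_rep k \<sigma> x \<in> carrier (unitary_group s)"
    using c by (simp add: carrier_unitary_group isometric_def)
next
  fix x y assume x: "x \<in> carrier GK" and y: "y \<in> carrier GK"
  note c = K.unitary_homD(1)[OF \<sigma> x] K.unitary_homD(1)[OF \<sigma> y]
  show "twist_rep k \<sigma> (x \<otimes>\<^bsub>GK\<^esub> y) = twist_rep k \<sigma> x \<otimes>\<^bsub>unitary_group s\<^esub> twist_rep k \<sigma> y"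
    using c \<chi>_mult[OF k, of x y] K.unitary_homD(7)[OF \<sigma> x y] x y
    by (simp add: mat_smult_left mat_smult_right mat_smult_smult mult.commute)
qed

lemma twist_class:
  assumes \<sigma>: "\<sigma> \<in> hom GK (unitary_group s)" and k: "k \<in> carrier_vec n"
  shows "twist k (rep_class GK \<sigma>) = rep_class GK (twist_rep k \<sigma>)"
proof -
  have eq: "rep_class GK (twist_rep k \<upsilon>) = rep_class GK (twist_rep k \<sigma>)" if \<upsilon>: "\<upsilon> \<in> rep_class GK \<sigma>" for \<upsilon>
  proof -
    note \<upsilon>h = K.rep_class_mem_hom[OF \<sigma> \<upsilon>]
    obtain V where V: "isometric s s V" "\<And>x. x \<in> K \<Longrightarrow> \<sigma> x * V = V * \<upsilon> x"
      by (rule K.rep_equivE[OF \<sigma> \<upsilon>h(2)]) auto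
    have "rep_equiv GK (twist_rep k \<sigma>) (twist_rep k \<upsilon>)"
    proof (rule K.rep_equivI[OF twist_rep_hom[OF \<sigma> k] V(1)])
      fix x assume x: "x \<in> carrier GK"
      note c = K.unitary_homD(1)[OF \<sigma> x] K.unitary_homD(1)[OF \<upsilon>h(1) x] isometricD(1)[OF V(1)]
      show "twist_rep k \<upsilon> x \<in> carrier_mat s s" using c by simp
      show "twist_rep k \<sigma> x * V = V * twist_rep k \<upsilon> x"
        using V(2)[of x] x c by (simp add: mat_smult_left mat_smult_right)
    qed
    then show ?thesis using K.rep_class_eq_iff[OF twist_rep_hom[OF \<sigma> k] twist_rep_hom[OF \<upsilon>h(1) k]] by simp
  qed
  show ?thesis
    unfolding dual_twist_def
  proof (rule SUP_eq_const)
    show "rep_class GK \<sigma> \<noteq> {}" using K.rep_class_self[OF \<sigma>] by blast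
  qed (rule eq)
qed

text \<open>Multiplying operators by complex numbers of modulus 1 does not change their invariant
  subspaces.\<close>

lemma twist_irreducible:
  assumes \<sigma>: "\<sigma> \<in> hom GK (unitary_group s)" and irr: "irreducible_rep GK \<sigma>" and k: "k \<in> carrier_vec n"
  shows "irreducible_rep GK (twist_rep k \<sigma>)"
proof (rule K.irreducibleI_isometric[OF twist_rep_hom[OF \<sigma> k]])
  show "s > 0" using irr K.irreducible_iff[OF \<sigma>] by blast
  fix r Q assume Q: "isometric s r Q" and inv: "\<forall>x\<in>carrier GK. \<exists>M\<in>carrier_mat r r. twist_rep k \<sigma> x * Q = Q * M"
  show "r = 0 \<or> r = s"
  proof (rule K.irreducible_isometric[OF \<sigma> irr Q])
    fix x assume x: "x \<in> carrier GK"
    note c = K.unitary_homD(1)[OF \<sigma> x] isometricD(1)[OF Q]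
    obtain M where M: "M \<in> carrier_mat r r" "twist_rep k \<sigma> x * Q = Q * M" using inv x by blast
    have "cnj (\<chi> k x) * \<chi> k x = 1" using \<chi>_cnj[of k x] by (simp only: mult.commute)
    then have "\<sigma> x * Q = (cnj (\<chi> k x) * \<chi> k x) \<cdot>\<^sub>m (\<sigma> x * Q)" by (simp only: mat_smult_1)
    also have "\<dots> = cnj (\<chi> k x) \<cdot>\<^sub>m (Q * M)"
      unfolding M(2)[symmetric] using c by (simp add: mat_smult_left mat_smult_smult)
    also have "\<dots> = Q * (cnj (\<chi> k x) \<cdot>\<^sub>m M)" using c M(1) by (simp add: mat_smult_right)
    finally show "\<exists>M\<in>carrier_mat r r. \<sigma> x * Q = Q * M" using M(1) smult_carrier_mat[OF M(1)] by blast
  qed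
qed

lemma conj_irreducible:
  assumes \<sigma>: "\<sigma> \<in> hom GK (unitary_group s)" and irr: "irreducible_rep GK \<sigma>" and g: "g \<in> carrier H"
  shows "irreducible_rep GK (conj_rep H g \<sigma>)"
proof (rule K.irreducibleI_isometric[OF conj_rep_hom[OF \<sigma> g]])
  show "s > 0" using irr K.irreducible_iff[OF \<sigma>] by blast
  fix r Q assume Q: "isometric s r Q"
    and inv: "\<forall>x\<in>carrier GK. \<exists>M\<in>carrier_mat r r. conj_rep H g \<sigma> x * Q = Q * M"
  show "r = 0 \<or> r = s"
  proof (rule K.irreducible_isometric[OF \<sigma> irr Q])
    fix x assume x: "x \<in> carrier GK"
    then have "g \<otimes> x \<otimes> inv g \<in> K" using K_conj[OF g] by simp
    then have "\<exists>M\<in>carrier_mat r r. conj_rep H g \<sigma> (g \<otimes> x \<otimes> inv g) * Q = Q * M" using inv by simp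
    moreover have "inv g \<otimes> (g \<otimes> x \<otimes> inv g) \<otimes> g = x" using x g by (simp add: m_assoc)
    ultimately show "\<exists>M\<in>carrier_mat r r. \<sigma> x * Q = Q * M" by (simp add: conj_rep_def)
  qed
qed

lemma dualE:
  assumes "c \<in> dual GK"
  obtains s \<sigma> where "c = rep_class GK \<sigma>" "\<sigma> \<in> hom GK (unitary_group s)" "irreducible_rep GK \<sigma>"
proof -
  obtain \<sigma> where \<sigma>: "irreducible_rep GK \<sigma>" "c = rep_class GK \<sigma>" using assms by (auto simp: dual_def)
  have "unitary_rep GK \<sigma>" using \<sigma>(1) by (simp add: irreducible_rep_def)
  then show ?thesis using that[OF \<sigma>(2) K.unitary_rep_hom \<sigma>(1)] by blast
qed

lemma dualI: "irreducible_rep GK \<sigma> \<Longrightarrow> rep_class GK \<sigma> \<in> dual GK"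
  by (auto simp: dual_def)

lemma actc_dual: "c \<in> dual GK \<Longrightarrow> g \<in> carrier H \<Longrightarrow> actc g c \<in> dual GK"
  by (elim dualE) (simp add: dual_act_class dualI conj_irreducible)

lemma twist_dual: "c \<in> dual GK \<Longrightarrow> k \<in> carrier_vec n \<Longrightarrow> twist k c \<in> dual GK"
  by (elim dualE) (simp add: twist_class dualI twist_irreducible)

lemma actc_actc:
  assumes "c \<in> dual GK" and g: "g \<in> carrier H" and h: "h \<in> carrier H"
  shows "actc g (actc h c) = actc (g \<otimes> h) c"
proof -
  obtain s \<sigma> where c: "c = rep_class GK \<sigma>" and \<sigma>: "\<sigma> \<in> hom GK (unitary_group s)" by (rule dualE[OF assms(1)])
  have "rep_class GK (conj_rep H g (conj_rep H h \<sigma>)) = rep_class GK (conj_rep H (g \<otimes> h) \<sigma>)"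
    by (rule K.rep_class_cong) (use g h in \<open>simp add: conj_rep_def inv_mult_group m_assoc\<close>)
  then show ?thesis
    unfolding c by (simp add: dual_act_class[OF \<sigma>] dual_act_class[OF conj_rep_hom[OF \<sigma> h] g] g h)
qed

lemma actc_one:
  assumes "c \<in> dual GK"
  shows "actc \<one> c = c"
proof -
  obtain s \<sigma> where c: "c = rep_class GK \<sigma>" and \<sigma>: "\<sigma> \<in> hom GK (unitary_group s)" by (rule dualE[OF assms(1)])
  have "rep_class GK (conj_rep H \<one> \<sigma>) = rep_class GK \<sigma>"
    by (rule K.rep_class_cong) (simp add: conj_rep_def)
  then show ?thesis unfolding c by (simp add: dual_act_class[OF \<sigma>])
qed

lemma twist_twist:
  assumes "c \<in> dual GK" and k: "k \<in> carrier_vec n" and l: "l \<in> carrier_vec n"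
  shows "twist k (twist l c) = twist (k + l) c"
proof -
  obtain s \<sigma> where c: "c = rep_class GK \<sigma>" and \<sigma>: "\<sigma> \<in> hom GK (unitary_group s)" by (rule dualE[OF assms(1)])
  have kl: "k + l \<in> carrier_vec n" using k l by simp
  have "rep_class GK (twist_rep k (twist_rep l \<sigma>)) = rep_class GK (twist_rep (k + l) \<sigma>)"
    by (rule K.rep_class_cong) (simp add: \<chi>_add[OF k l] mat_smult_smult)
  then show ?thesis
    unfolding c twist_class[OF \<sigma> l] twist_class[OF \<sigma> kl] twist_class[OF twist_rep_hom[OF \<sigma> l] k] .
qed

lemma twist_zero:
  assumes "c \<in> dual GK"
  shows "twist (0\<^sub>v n) c = c"
proof -
  obtain s \<sigma> where c: "c = rep_class GK \<sigma>" and \<sigma>: "\<sigma> \<in> hom GK (unitary_group s)" by (rule dualE[OF assms(1)])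
  have z: "0\<^sub>v n \<in> carrier_vec n" by simp
  have "rep_class GK (twist_rep (0\<^sub>v n) \<sigma>) = rep_class GK \<sigma>"
    by (rule K.rep_class_cong) (auto simp: \<chi>_zero intro!: eq_matI)
  then show ?thesis unfolding c twist_class[OF \<sigma> z] .
qed

text \<open>The commutation rule of Euclidean motions: moving a conjugation past a twist rotates the
  twisting vector. This is the reason why \<open>stab\<close> pairs a vector with the linear part
  \<open>L g\<close>.\<close>

lemma actc_twist:
  assumes "c \<in> dual GK" and g: "g \<in> carrier H" and k: "k \<in> carrier_vec n"
  shows "actc g (twist k c) = twist (L g *\<^sub>v k) (actc g c)"
proof -
  obtain s \<sigma> where c: "c = rep_class GK \<sigma>" and \<sigma>: "\<sigma> \<in> hom GK (unitary_group s)" by (rule dualE[OF assms(1)])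
  have Lk: "L g *\<^sub>v k \<in> carrier_vec n" by (rule mult_mat_vec_carrier[OF L_carrier[OF g] k])
  have "rep_class GK (conj_rep H g (twist_rep k \<sigma>)) = rep_class GK (twist_rep (L g *\<^sub>v k) (conj_rep H g \<sigma>))"
    by (rule K.rep_class_cong) (simp add: conj_rep_def \<chi>_conj[OF g k])
  then show ?thesis
    unfolding c twist_class[OF \<sigma> k] dual_act_class[OF \<sigma> g] dual_act_class[OF twist_rep_hom[OF \<sigma> k] g]
      twist_class[OF conj_rep_hom[OF \<sigma> g] Lk] .
qed

lemma twist_cancel:
  assumes c: "c \<in> dual GK" and c': "c' \<in> dual GK" and k: "k \<in> carrier_vec n" and l: "l \<in> carrier_vec n"
    and eq: "twist k c = twist l c'"
  shows "c = twist (l - k) c'"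
proof -
  have mk: "- k \<in> carrier_vec n" using k by simp
  have "- k + k = 0\<^sub>v n" "- k + l = l - k" using k l by (auto intro!: eq_vecI)
  then show ?thesis
    using twist_twist[OF c mk k] twist_twist[OF c' mk l] eq twist_zero[OF c] by simp
qed

lemma induce_actc: "c \<in> dual GK \<Longrightarrow> g \<in> carrier H \<Longrightarrow> dual_induce H K (actc g c) = dual_induce H K c"
  using transversal_exists by (elim dualE) (auto simp: dual_act_class dual_induce_conj)

lemma induce_eqD:
  assumes c: "c \<in> dual GK" and c': "c' \<in> dual GK" and eq: "dual_induce H K c = dual_induce H K c'"
  obtains g where "g \<in> carrier H" "actc g c = c'"
proof -
  obtain s \<sigma> where 1: "c = rep_class GK \<sigma>" "\<sigma> \<in> hom GK (unitary_group s)" "irreducible_rep GK \<sigma>" by (rule dualE[OF c])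
  obtain s' \<sigma>' where 2: "c' = rep_class GK \<sigma>'" "\<sigma>' \<in> hom GK (unitary_group s')" "irreducible_rep GK \<sigma>'" by (rule dualE[OF c'])
  obtain rs where rs: "left_transversal H K rs" using transversal_exists by blast
  obtain g where g: "g \<in> carrier H" "rep_equiv GK (conj_rep H g \<sigma>) \<sigma>'"
    by (rule dual_induce_inj[OF 1(2,3) 2(2,3) rs eq[unfolded 1(1) 2(1)]])
  have "actc g c = c'"
    unfolding 1(1) 2(1) dual_act_class[OF 1(2) g(1)]
    using K.rep_class_eq_iff[OF conj_rep_hom[OF 1(2) g(1)] 2(2)] g(2) by simp
  then show ?thesis using that g(1) by blast
qed

section \<open>Classes trivial on \<open>A\<close> and the orbits of their stabilizers\<close>

definition trivial_dual :: "('a \<Rightarrow> complex mat) set set" where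
  "trivial_dual = {c \<in> dual GK. \<forall>\<rho>\<in>c. \<forall>t\<in>A. \<rho> t = 1\<^sub>m (rep_dim GK \<rho>)}"

lemma trivial_dualI:
  assumes \<sigma>: "\<sigma> \<in> hom GK (unitary_group s)" and irr: "irreducible_rep GK \<sigma>" and triv: "\<And>a. a \<in> A \<Longrightarrow> \<sigma> a = 1\<^sub>m s"
  shows "rep_class GK \<sigma> \<in> trivial_dual"
  unfolding trivial_dual_def
proof (intro CollectI conjI ballI dualI[OF irr])
  fix \<rho> t assume \<rho>: "\<rho> \<in> rep_class GK \<sigma>" and t: "t \<in> A"
  note h = K.rep_class_mem_hom[OF \<sigma> \<rho>]
  obtain V where V: "isometric s s V" "\<And>x. x \<in> K \<Longrightarrow> \<sigma> x * V = V * \<rho> x" by (rule K.rep_equivE[OF \<sigma> h(2)]) auto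
  have \<rho>t: "\<rho> t \<in> carrier_mat s s" using K.unitary_homD(1)[OF h(1), of t] t by simp
  note c = isometricD[OF V(1)]
  have "V * \<rho> t = V" using V(2)[of t] t triv[OF t] c(1) by simp
  then have "mat_adjoint V * V * \<rho> t = mat_adjoint V * V" using assoc_mult_mat[OF c(2,1) \<rho>t] by simp
  then show "\<rho> t = 1\<^sub>m (rep_dim GK \<rho>)" using c(3) \<rho>t K.unitary_homD(9)[OF h(1)] by simp
qed

lemma trivial_dualE:
  assumes "c \<in> trivial_dual"
  obtains s \<sigma> where "c = rep_class GK \<sigma>" "\<sigma> \<in> hom GK (unitary_group s)" "irreducible_rep GK \<sigma>"
    "\<forall>a\<in>A. \<sigma> a = 1\<^sub>m s"
proof -
  have "c \<in> dual GK" using assms by (simp add: trivial_dual_def)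
  then obtain s \<sigma> where c: "c = rep_class GK \<sigma>" and \<sigma>: "\<sigma> \<in> hom GK (unitary_group s)" "irreducible_rep GK \<sigma>"
    by (rule dualE)
  have "\<sigma> a = 1\<^sub>m s" if "a \<in> A" for a
    using assms K.rep_class_self[OF \<sigma>(1)] K.unitary_homD(9)[OF \<sigma>(1)] that by (auto simp: trivial_dual_def c)
  then show ?thesis using that[OF c \<sigma>] by blast
qed

lemma trivial_dual_dual: "c \<in> trivial_dual \<Longrightarrow> c \<in> dual GK" by (simp add: trivial_dual_def)

text \<open>The element \<open>a\<close> acts trivially on the left, where it is only conjugated
  within \<open>A\<close>, and by the scalar \<open>\<chi> l a\<close> on the right. In lattice
  terms, \<open>l\<close> lies in the dual of the lattice of translation vectors of
  \<open>A\<close>.\<close>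

lemma trivial_twist:
  assumes c: "c \<in> trivial_dual" and c': "c' \<in> trivial_dual" and g: "g \<in> carrier H" and l: "l \<in> carrier_vec n"
    and eq: "actc g c = twist l c'" and a: "a \<in> A"
  shows "\<chi> l a = 1"
proof -
  obtain s \<sigma> where 1: "c = rep_class GK \<sigma>" "\<sigma> \<in> hom GK (unitary_group s)" "irreducible_rep GK \<sigma>"
    "\<forall>a\<in>A. \<sigma> a = 1\<^sub>m s" by (rule trivial_dualE[OF c])
  obtain s' \<sigma>' where 2: "c' = rep_class GK \<sigma>'" "\<sigma>' \<in> hom GK (unitary_group s')" "irreducible_rep GK \<sigma>'"
    "\<forall>a\<in>A. \<sigma>' a = 1\<^sub>m s'" by (rule trivial_dualE[OF c'])
  note h1 = conj_rep_hom[OF 1(2) g] and h2 = twist_rep_hom[OF 2(2) l]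
  have "rep_equiv GK (conj_rep H g \<sigma>) (twist_rep l \<sigma>')"
    using eq unfolding 1(1) 2(1) dual_act_class[OF 1(2) g] twist_class[OF 2(2) l] K.rep_class_eq_iff[OF h1 h2] .
  then obtain V where V: "isometric s s V"
    "\<And>x. x \<in> carrier GK \<Longrightarrow> conj_rep H g \<sigma> x * V = V * twist_rep l \<sigma>' x"
    "twist_rep l \<sigma>' \<in> hom GK (unitary_group s)" by (rule K.rep_equivE[OF h1]) blast
  have ss: "s' = s" using K.unitary_homD(9)[OF V(3)] K.unitary_homD(9)[OF h2] by simp
  have s: "s > 0" using 1(3) K.irreducible_iff[OF 1(2)] by blast
  note c = isometricD[OF V(1)]
  have "conj_rep H g \<sigma> a = 1\<^sub>m s" using 1(4) A_conj[OF g a] by (simp add: conj_rep_def)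
  then have "V = V * (\<chi> l a \<cdot>\<^sub>m 1\<^sub>m s)" using V(2)[of a] a 2(4) c(1) ss by simp
  then have "mat_adjoint V * V = mat_adjoint V * V * (\<chi> l a \<cdot>\<^sub>m 1\<^sub>m s)"
    using c(1) by (metis assoc_mult_mat c(2) one_carrier_mat smult_carrier_mat)
  then have "1 \<cdot>\<^sub>m 1\<^sub>m s = \<chi> l a \<cdot>\<^sub>m (1\<^sub>m s :: complex mat)" unfolding c(3) by (auto intro!: eq_matI)
  then show ?thesis using smult_one_eq_iff[OF s] by metis
qed

definition stab :: "('a \<Rightarrow> complex mat) set \<Rightarrow> isometry set" where
  "stab c = {(L g, k) | g k. g \<in> carrier H \<and> k \<in> carrier_vec n \<and> actc g c = twist k c}"

text \<open>The motion \<open>(L g, l)\<close> takes \<open>k\<close> to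
  \<open>L g *\<^sub>v k + l\<close>, and by \<open>actc_twist\<close> twisting \<open>c\<close> by
  that vector amounts to conjugating \<open>twist k c\<close> by \<open>g\<close>. Orbits are thus
  the sets of parameters with conjugate twists, the form in which induction sees them.\<close>

lemma orbit_stab:
  assumes c: "c \<in> dual GK" and k: "k \<in> carrier_vec n"
  shows "orbit_of (stab c) k = {k' \<in> carrier_vec n. \<exists>g\<in>carrier H. actc g (twist k c) = twist k' c}"
proof (intro equalityI subsetI)
  fix k' assume "k' \<in> orbit_of (stab c) k"
  then obtain g l where g: "g \<in> carrier H" and l: "l \<in> carrier_vec n" and eq: "actc g c = twist l c"
    and k': "k' = L g *\<^sub>v k + l" by (auto simp: orbit_of_def stab_def act_def)
  have Lk: "L g *\<^sub>v k \<in> carrier_vec n" by (rule mult_mat_vec_carrier[OF L_carrier[OF g] k])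
  have "actc g (twist k c) = twist k' c"
    unfolding actc_twist[OF c g k] eq twist_twist[OF c Lk l] k' ..
  then show "k' \<in> {k' \<in> carrier_vec n. \<exists>g\<in>carrier H. actc g (twist k c) = twist k' c}"
    using g Lk l k' by auto
next
  fix k' assume "k' \<in> {k' \<in> carrier_vec n. \<exists>g\<in>carrier H. actc g (twist k c) = twist k' c}"
  then obtain g where g: "g \<in> carrier H" and k': "k' \<in> carrier_vec n" and eq: "actc g (twist k c) = twist k' c"
    by blast
  have Lk: "L g *\<^sub>v k \<in> carrier_vec n" by (rule mult_mat_vec_carrier[OF L_carrier[OF g] k])
  have "actc g c = twist (k' - L g *\<^sub>v k) c"
    by (rule twist_cancel[OF actc_dual[OF c g] c Lk k']) (use eq actc_twist[OF c g k] in simp)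
  then have "(L g, k' - L g *\<^sub>v k) \<in> stab c" using g Lk k' by (auto simp: stab_def)
  moreover have "k' = act (L g, k' - L g *\<^sub>v k) k" using Lk k' L_carrier[OF g] by (intro eq_vecI) (auto simp: act_def)
  ultimately show "k' \<in> orbit_of (stab c) k" unfolding orbit_of_def by blast
qed

lemma orbit_self:
  assumes c: "c \<in> dual GK" and k: "k \<in> carrier_vec n"
  shows "k \<in> orbit_of (stab c) k"
  unfolding orbit_stab[OF assms] using k actc_one[OF twist_dual[OF c k]] by auto

lemma orbit_eqI:
  assumes c: "c \<in> dual GK" and k: "k \<in> carrier_vec n" and k': "k' \<in> carrier_vec n"
    and g: "g \<in> carrier H" and eq: "actc g (twist k c) = twist k' c"
  shows "orbit_of (stab c) k = orbit_of (stab c) k'"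
proof -
  note tk = twist_dual[OF c k] and tk' = twist_dual[OF c k']
  have eq': "actc (inv g) (twist k' c) = twist k c"
    unfolding eq[symmetric] using actc_actc[OF tk inv_closed[OF g] g] actc_one[OF tk] g by simp
  have 1: "\<exists>h'\<in>carrier H. actc h' (twist k c) = twist l c" if "h \<in> carrier H" "actc h (twist k' c) = twist l c" for h l
    using actc_actc[OF tk that(1) g] eq that g by (intro bexI[of _ "h \<otimes> g"]) auto
  have 2: "\<exists>h'\<in>carrier H. actc h' (twist k' c) = twist l c" if "h \<in> carrier H" "actc h (twist k c) = twist l c" for h l
    using actc_actc[OF tk' that(1) inv_closed[OF g]] eq' that g by (intro bexI[of _ "h \<otimes> inv g"]) auto
  show ?thesis unfolding orbit_stab[OF c k] orbit_stab[OF c k'] using 1 2 by blast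
qed

section \<open>Exceptional parameters and exceptional representations\<close>

definition bad :: "real vec set" where
  "bad = {k \<in> carrier_vec n. \<exists>a\<in>A. a \<noteq> \<one> \<and> \<chi> k a = 1}"

lemma not_bad_free: "k \<in> carrier_vec n \<Longrightarrow> k \<notin> bad \<longleftrightarrow> free_char (\<chi> k)"
  by (auto simp: bad_def free_char_def)

lemma countable_A: "countable A"
  by (rule countable_image_inj_on[OF vec_lattice.countable_lattice[OF lattice] inj_\<tau>])

lemma bad_null: "bad \<in> null_sets (lborel_vec n)"
proof -
  have "bad = (\<Union>a\<in>A - {\<one>}. \<Union>z::int. {k \<in> carrier_vec n. k \<bullet> \<tau> a = real_of_int z})"
  proof -
    \<comment> \<open>Full turns occur exactly at integers, so \<open>bad\<close> is a union of
      hyperplanes indexed by \<open>A - {\<one>}\<close> and the integers; their normals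
      \<open>\<tau> a\<close> are nonzero.\<close>
    have "\<chi> k a = 1 \<longleftrightarrow> (\<exists>z::int. k \<bullet> \<tau> a = real_of_int z)" for k a
      unfolding \<chi>_def exp_eq_1 by (auto simp: algebra_simps)
    then show ?thesis by (auto simp: bad_def)
  qed
  also have "\<dots> \<in> null_sets (lborel_vec n)"
  proof (intro null_sets_UN')
    show "countable (A - {\<one>})" using countable_A by simp
    fix a and z :: int assume a: "a \<in> A - {\<one>}"
    then show "{k \<in> carrier_vec n. k \<bullet> \<tau> a = real_of_int z} \<in> null_sets (lborel_vec n)"
      using \<tau>_eq_0_iff[of a] \<tau>_carrier[of a] by (intro hyperplane_null) auto
  qed auto
  finally show ?thesis .
qed

text \<open>On \<open>A\<close> the new character is \<open>\<chi> k\<close> composed with a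
  conjugation, since \<open>\<chi> l\<close> is trivial there; conjugation permutes the nontrivial
  elements of \<open>A\<close>.\<close>

lemma free_char_transport:
  assumes g: "g \<in> carrier H" and k: "k \<in> carrier_vec n" and l: "l \<in> carrier_vec n"
    and triv: "\<And>a. a \<in> A \<Longrightarrow> \<chi> l a = 1" and free: "free_char (\<chi> k)"
  shows "free_char (\<chi> (L g *\<^sub>v k + l))"
  unfolding free_char_def
proof (intro ballI impI)
  fix a assume a: "a \<in> A" and a1: "a \<noteq> \<one>"
  have Lk: "L g *\<^sub>v k \<in> carrier_vec n" by (rule mult_mat_vec_carrier[OF L_carrier[OF g] k])
  have "\<chi> (L g *\<^sub>v k + l) a = \<chi> k (inv g \<otimes> a \<otimes> g)"
    using \<chi>_add[OF Lk l, of a] \<chi>_conj[OF g k, of a] triv[OF a] a by simp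
  then show "\<chi> (L g *\<^sub>v k + l) a \<noteq> 1"
    using free A_conj[OF g a] conj_eq_one_iff[OF g a] a1 by (simp add: free_char_def)
qed

text \<open>Elements of \<open>stab c\<close> move \<open>k\<close> to
  \<open>L g *\<^sub>v k + l\<close> with \<open>\<chi> l\<close> trivial on \<open>A\<close>, which
  preserves freeness; so \<open>bad\<close> is saturated, as \<open>orbit_null_set_image\<close>
  requires.\<close>

lemma orbit_bad_iff:
  assumes c: "c \<in> trivial_dual" and k: "k \<in> carrier_vec n"
  shows "orbit_of (stab c) k \<in> orbit_of (stab c) ` bad \<longleftrightarrow> k \<in> bad"
proof
  assume "orbit_of (stab c) k \<in> orbit_of (stab c) ` bad"
  then obtain b where b: "b \<in> bad" "orbit_of (stab c) k = orbit_of (stab c) b" by blast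
  have bc: "b \<in> carrier_vec n" using b by (simp add: bad_def)
  have "b \<in> orbit_of (stab c) k" using orbit_self[OF trivial_dual_dual[OF c] bc] b by simp
  then obtain g l where g: "g \<in> carrier H" and l: "l \<in> carrier_vec n" and eq: "actc g c = twist l c"
    and bk: "b = L g *\<^sub>v k + l" by (auto simp: orbit_of_def stab_def act_def)
  show "k \<in> bad"
  proof (rule ccontr)
    assume "k \<notin> bad"
    then have free: "free_char (\<chi> k)" using not_bad_free[OF k] by simp
    have "free_char (\<chi> b)"
      unfolding bk by (rule free_char_transport[OF g k l _ free]) (rule trivial_twist[OF c c g l eq])
    then show False using not_bad_free[OF bc] b(1) by simp
  qed
qed simp

text \<open>\<open>\<tau> (a [^] j)\<close> is \<open>j\<close> times the nonzero vector
  \<open>\<tau> a\<close>. Distinct powers are what \<open>plancherel_fixing_null\<close>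
  requires.\<close>

lemma A_powers_inj:
  assumes a: "a \<in> A" and a1: "a \<noteq> \<one>"
  shows "inj (\<lambda>j::nat. a [^] j)"
proof (rule injI)
  have aG: "a \<in> carrier H" by (rule A_carrier[OF a])
  have \<tau>p: "\<tau> (a [^] j) = real j \<cdot>\<^sub>v \<tau> a" for j :: nat
  proof (induction j)
    case 0
    then show ?case using \<tau>_one \<tau>_carrier[OF aG] by (auto intro!: eq_vecI)
  next
    case (Suc j)
    have "a [^] j \<in> K" using a by (induction j) auto
    then have "\<tau> (a [^] Suc j) = \<tau> (a [^] j) + \<tau> a" using \<tau>_mult_K[of "a [^] j" a] aG by simp
    then show ?case using Suc \<tau>_carrier[OF aG] by (auto intro!: eq_vecI simp: algebra_simps)
  qed
  fix i j :: nat assume "a [^] i = a [^] j"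
  then have eq: "real i \<cdot>\<^sub>v \<tau> a = real j \<cdot>\<^sub>v \<tau> a" using \<tau>p by metis
  have "\<tau> a \<noteq> 0\<^sub>v n" using \<tau>_eq_0_iff[OF a] a1 by simp
  then obtain t where t: "t < n" "\<tau> a $ t \<noteq> 0" using \<tau>_carrier[OF aG] by (metis carrier_vecD eq_vecI index_zero_vec)
  have "(real i \<cdot>\<^sub>v \<tau> a) $ t = (real j \<cdot>\<^sub>v \<tau> a) $ t" using eq by simp
  then show "i = j" using t \<tau>_carrier[OF aG] by simp
qed

text \<open>\<open>\<tau>\<close> identifies \<open>A\<close> with a lattice, where
  \<open>lattice_character\<close> applies.\<close>

lemma A_char_eq_\<chi>:
  fixes f :: "'a \<Rightarrow> complex"
  assumes mult: "\<And>a b. a \<in> A \<Longrightarrow> b \<in> A \<Longrightarrow> f (a \<otimes> b) = f a * f b" and norm: "\<And>a. a \<in> A \<Longrightarrow> cmod (f a) = 1"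
  obtains k where "k \<in> carrier_vec n" "\<And>a. a \<in> A \<Longrightarrow> f a = \<chi> k a"
proof -
  define \<psi> where "\<psi> x = f (inv_into A \<tau> x)" for x
  have \<psi>: "\<psi> (\<tau> a) = f a" if "a \<in> A" for a unfolding \<psi>_def using inv_into_f_f[OF inj_\<tau> that] by simp
  obtain k where k: "k \<in> carrier_vec n"
    "\<And>x. x \<in> \<tau> ` A \<Longrightarrow> \<psi> x = exp (2 * pi * \<i> * complex_of_real (k \<bullet> x))"
  proof (rule vec_lattice.lattice_character[OF lattice, of \<psi>])
    fix x y assume "x \<in> \<tau> ` A" "y \<in> \<tau> ` A"
    then obtain a b where ab: "a \<in> A" "b \<in> A" "x = \<tau> a" "y = \<tau> b" by blast
    then have "x + y = \<tau> (a \<otimes> b)" using \<tau>_mult_K[of a b] by simp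
    then show "\<psi> (x + y) = \<psi> x * \<psi> y" using \<psi> mult ab by simp
  next
    show "cmod (\<psi> x) = 1" if "x \<in> \<tau> ` A" for x using that \<psi> norm by auto
  qed blast
  have "f a = \<chi> k a" if "a \<in> A" for a using \<psi>[OF that] k(2)[of "\<tau> a"] that by (simp add: \<chi>_def)
  then show ?thesis using that k(1) by blast
qed

definition exceptional :: "('a \<Rightarrow> complex mat) set set" where
  "exceptional = (\<Union>a\<in>A - {\<one>}. fixing_classes a)"

lemma exceptional_null: "plancherel_measure H \<mu> \<Longrightarrow> exceptional \<in> null_sets \<mu>"
  unfolding exceptional_def
  using countable_A by (intro null_sets_UN' plancherel_fixing_null A_powers_inj) auto

lemma not_exceptional_iff:
  assumes "\<rho> \<in> irreps H N"
  shows "rep_class H \<rho> \<notin> exceptional \<longleftrightarrow> free_rep N \<rho>"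
  using rep_class_mem_fixing_classes[OF assms] by (auto simp: exceptional_def free_rep_def)

lemma induce_mem:
  assumes c: "c \<in> trivial_dual" and k: "k \<in> carrier_vec n" and free: "free_char (\<chi> k)"
  shows "dual_induce H K (twist k c) \<in> dual H - exceptional"
proof -
  obtain s \<sigma> where 1: "c = rep_class GK \<sigma>" "\<sigma> \<in> hom GK (unitary_group s)" "irreducible_rep GK \<sigma>"
    "\<forall>a\<in>A. \<sigma> a = 1\<^sub>m s" by (rule trivial_dualE[OF c])
  obtain rs where rs: "left_transversal H K rs" using transversal_exists by blast
  note h = twist_rep_hom[OF 1(2) k] and irr = twist_irreducible[OF 1(2,3) k]
  let ?\<rho> = "induced_rep H K rs s (twist_rep k \<sigma>)"
  note \<rho> = induced_rep_hom[OF rs h]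
  obtain E where E: "induced_via H K s (twist_rep k \<sigma>) (length rs * s) ?\<rho> E" by (rule induced_rep_via[OF rs h])
  \<comment> \<open>\<open>\<sigma>\<close> is trivial on \<open>A\<close>, so the twist acts there
    by \<open>\<chi> k\<close> alone.\<close>
  have sc: "scalar_on s (twist_rep k \<sigma>) (\<chi> k)" using 1(4) by (simp add: scalar_on_def)
  have "irreducible_rep H ?\<rho>" by (rule induced_irreducible[OF \<rho> h irr E rs refl sc free])
  then have irrep: "?\<rho> \<in> irreps H (length rs * s)" using unitary_homD(9)[OF \<rho>] by (simp add: irreps_def)
  have "dual_induce H K (twist k c) = rep_class H ?\<rho>"
    unfolding 1(1) twist_class[OF 1(2) k] by (rule dual_induce_class[OF \<rho> h E rs refl])
  moreover have "rep_class H ?\<rho> \<in> dual H" using irrep by (auto simp: dual_def irreps_def)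
  ultimately show ?thesis
    using not_exceptional_iff[OF irrep] induced_free[OF \<rho> h E rs refl sc free] by simp
qed

lemma induce_surj:
  assumes c: "c \<in> dual H - exceptional"
  obtains c' k where "c' \<in> trivial_dual" "k \<in> carrier_vec n" "free_char (\<chi> k)" "c = dual_induce H K (twist k c')"
proof -
  obtain \<rho> where irr: "irreducible_rep H \<rho>" and c\<rho>: "c = rep_class H \<rho>" using c by (auto simp: dual_def)
  define N where "N = rep_dim H \<rho>"
  have irrep: "\<rho> \<in> irreps H N" using irr by (simp add: irreps_def N_def)
  note \<rho> = irreps_hom[OF irrep]
  have free: "free_rep N \<rho>" using not_exceptional_iff[OF irrep] c c\<rho> by simp
  obtain rs where rs: "left_transversal H K rs" using transversal_exists by blast
  obtain s \<sigma> E f where \<sigma>: "\<sigma> \<in> hom GK (unitary_group s)" "irreducible_rep GK \<sigma>"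
    and E: "induced_via H K s \<sigma> N \<rho> E" and N: "N = length rs * s"
    and sc: "scalar_on s \<sigma> f" and fr: "free_char f"
    by (rule free_rep_induced[OF \<rho> irr free rs])
  have s: "s > 0" using \<sigma> K.irreducible_iff[OF \<sigma>(1)] by blast
  obtain k where k: "k \<in> carrier_vec n" "\<And>a. a \<in> A \<Longrightarrow> f a = \<chi> k a"
    by (rule A_char_eq_\<chi>[of f]) (use scalar_on_char[OF \<sigma>(1) s sc] in auto)
  have mk: "- k \<in> carrier_vec n" using k(1) by simp
  \<comment> \<open>\<open>\<chi> k\<close> agrees on \<open>A\<close> with the scalars
    \<open>f\<close> by which \<open>\<sigma>\<close> acts; twisting by \<open>- k\<close> removes
    them.\<close>
  let ?\<sigma> = "twist_rep (- k) \<sigma>"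
  have "?\<sigma> a = 1\<^sub>m s" if a: "a \<in> A" for a
  proof -
    have "- k + k = 0\<^sub>v n" using k(1) by (auto intro!: eq_vecI)
    then have "\<chi> (- k) a * \<chi> k a = 1" using \<chi>_add[OF mk k(1), of a] \<chi>_zero[of a] a by simp
    then show ?thesis using sc a k(2)[OF a] by (auto simp: scalar_on_def mat_smult_smult intro!: eq_matI)
  qed
  then have c0: "rep_class GK ?\<sigma> \<in> trivial_dual"
    by (rule trivial_dualI[OF twist_rep_hom[OF \<sigma>(1) mk] twist_irreducible[OF \<sigma> mk]])
  have fk: "free_char (\<chi> k)" using fr k(2) by (simp add: free_char_def)
  have d: "rep_class GK \<sigma> \<in> dual GK" by (rule dualI[OF \<sigma>(2)])
  have "k + - k = 0\<^sub>v n" using k(1) by (auto intro!: eq_vecI)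
  then have "twist k (rep_class GK ?\<sigma>) = rep_class GK \<sigma>"
    using twist_twist[OF d k(1) mk] twist_zero[OF d] twist_class[OF \<sigma>(1) mk] by simp
  then have "c = dual_induce H K (twist k (rep_class GK ?\<sigma>))"
    using dual_induce_class[OF \<rho> \<sigma>(1) E rs N] c\<rho> by simp
  then show ?thesis using that[OF c0 k(1) fk] by blast
qed

text \<open>Induction identifies exactly the conjugate classes, by \<open>induce_actc\<close> and
  \<open>induce_eqD\<close>. Conjugacy between twists of different members of \<open>R\<close> is
  excluded by the choice of \<open>R\<close>, and conjugacy between twists of one class is the orbit
  relation of \<open>orbit_stab\<close>. Freeness makes induction land in, and cover, the
  nonexceptional part of the dual.\<close>

theorem induce_bijection:
  assumes R: "representation_set trivial_dual
      (\<lambda>c c'. \<exists>g\<in>carrier H. \<exists>k\<in>carrier_vec n. actc g c = twist k c') R"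
    and \<mu>: "plancherel_measure H \<mu>"
  shows "\<exists>N N\<^sub>R \<Phi>. N \<in> null_sets \<mu> \<and> (\<forall>c\<in>R. orbit_null_set n (stab c) (N\<^sub>R c)) \<and>
    (\<forall>c\<in>R. \<forall>k\<in>carrier_vec n. orbit_of (stab c) k \<notin> N\<^sub>R c \<longrightarrow>
       \<Phi> (orbit_of (stab c) k, c) = dual_induce H K (twist k c)) \<and>
    bij_betw \<Phi> {(X, c). c \<in> R \<and> X \<in> orbit_space n (stab c) - N\<^sub>R c} (dual H - N)"
proof -
  have RX: "c \<in> trivial_dual" if "c \<in> R" for c using R that by (auto simp: representation_set_def)
  have RD: "c \<in> dual GK" if "c \<in> R" for c using trivial_dual_dual[OF RX[OF that]] .
  have ex1: "\<exists>!y. y \<in> R \<and> (\<exists>g\<in>carrier H. \<exists>k\<in>carrier_vec n. actc g c = twist k y)"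
    if "c \<in> trivial_dual" for c
    using R that by (simp add: representation_set_def)
  \<comment> \<open>Conjugation by \<open>\<one>\<close> and the zero twist relate \<open>c\<close>
    to itself, so both \<open>c\<close> and \<open>c'\<close> represent \<open>c\<close> and
    uniqueness applies.\<close>
  have uniq: "c' = c"
    if c: "c \<in> R" and c': "c' \<in> R" and g: "g \<in> carrier H" and k: "k \<in> carrier_vec n" and eq: "actc g c = twist k c'"
    for c c' g k
  proof (rule ex1_unique[OF ex1[OF RX[OF c]]])
    show "c' \<in> R \<and> (\<exists>g\<in>carrier H. \<exists>k\<in>carrier_vec n. actc g c = twist k c')"
      by (intro conjI c' bexI[OF _ g] bexI[OF _ k] eq)
    have "actc \<one> c = twist (0\<^sub>v n) c" using actc_one[OF RD[OF c]] twist_zero[OF RD[OF c]] by simp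
    then show "c \<in> R \<and> (\<exists>g\<in>carrier H. \<exists>k\<in>carrier_vec n. actc g c = twist k c)"
      by (intro conjI c bexI[OF _ one_closed] bexI[OF _ zero_carrier_vec])
  qed
  define N\<^sub>R where "N\<^sub>R c = orbit_of (stab c) ` bad" for c
  \<comment> \<open>An arbitrary parameter of the orbit is chosen; the next fact shows that the
    induced class does not depend on it, as another parameter gives a conjugate twist.\<close>
  define \<Phi> where "\<Phi> = (\<lambda>(X, c). dual_induce H K (twist (SOME k. k \<in> carrier_vec n \<and> orbit_of (stab c) k = X) c))"
  have \<Phi>: "\<Phi> (orbit_of (stab c) k, c) = dual_induce H K (twist k c)" if c: "c \<in> R" and k: "k \<in> carrier_vec n" for c k
  proof -
    define k' where "k' = (SOME k'. k' \<in> carrier_vec n \<and> orbit_of (stab c) k' = orbit_of (stab c) k)"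
    have k': "k' \<in> carrier_vec n \<and> orbit_of (stab c) k' = orbit_of (stab c) k"
      unfolding k'_def by (rule someI[of _ k]) (use k in simp)
    have "k' \<in> orbit_of (stab c) k" using orbit_self[OF RD[OF c], of k'] k' by simp
    then obtain g where "g \<in> carrier H" "actc g (twist k c) = twist k' c"
      unfolding orbit_stab[OF RD[OF c] k] by blast
    then have "dual_induce H K (twist k' c) = dual_induce H K (twist k c)"
      using induce_actc[OF twist_dual[OF RD[OF c] k], of g] by simp
    then show ?thesis by (simp add: \<Phi>_def k'_def)
  qed
  have good: "free_char (\<chi> k) \<longleftrightarrow> orbit_of (stab c) k \<notin> N\<^sub>R c" if "c \<in> R" "k \<in> carrier_vec n" for c k
    using orbit_bad_iff[OF RX[OF that(1)] that(2)] not_bad_free[OF that(2)] by (simp add: N\<^sub>R_def)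
  let ?D = "{(X, c). c \<in> R \<and> X \<in> orbit_space n (stab c) - N\<^sub>R c}"
  have "inj_on \<Phi> ?D"
  proof (rule inj_onI, clarify)
    fix X c X' c' assume c: "c \<in> R" and X: "X \<in> orbit_space n (stab c)" and c': "c' \<in> R"
      and X': "X' \<in> orbit_space n (stab c')" and eq: "\<Phi> (X, c) = \<Phi> (X', c')"
    obtain k where k: "k \<in> carrier_vec n" "X = orbit_of (stab c) k" using X by (auto simp: orbit_space_def)
    obtain k' where k': "k' \<in> carrier_vec n" "X' = orbit_of (stab c') k'" using X' by (auto simp: orbit_space_def)
    have "dual_induce H K (twist k c) = dual_induce H K (twist k' c')"
      using eq \<Phi>[OF c k(1)] \<Phi>[OF c' k'(1)] k k' by simp
    then obtain g where g: "g \<in> carrier H" "actc g (twist k c) = twist k' c'"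
      by (rule induce_eqD[OF twist_dual[OF RD[OF c] k(1)] twist_dual[OF RD[OF c'] k'(1)]])
    have Lk: "L g *\<^sub>v k \<in> carrier_vec n" by (rule mult_mat_vec_carrier[OF L_carrier[OF g(1)] k(1)])
    \<comment> \<open>Moving the twist by \<open>k\<close> to the other side turns conjugacy of the
      twists into the relation that defines \<open>R\<close>, now between \<open>c\<close> and
      \<open>c'\<close>.\<close>
    have act: "actc g c = twist (k' - L g *\<^sub>v k) c'"
      by (rule twist_cancel[OF actc_dual[OF RD[OF c] g(1)] RD[OF c'] Lk k'(1)])
         (use g(2) actc_twist[OF RD[OF c] g(1) k(1)] in simp)
    have cc: "c' = c" by (rule uniq[OF c c' g(1) _ act]) (use Lk k'(1) in simp)
    then have "X = X'" using orbit_eqI[OF RD[OF c] k(1) k'(1) g(1)] g(2) k k' by simp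
    then show "X = X' \<and> c = c'" using cc by simp
  qed
  moreover have "\<Phi> ` ?D = dual H - exceptional"
  proof (intro equalityI subsetI)
    fix x assume "x \<in> \<Phi> ` ?D"
    then obtain c k where "c \<in> R" "k \<in> carrier_vec n" "orbit_of (stab c) k \<notin> N\<^sub>R c" "x = \<Phi> (orbit_of (stab c) k, c)"
      by (auto simp: orbit_space_def)
    then show "x \<in> dual H - exceptional" using induce_mem[OF RX] good \<Phi> by simp
  next
    fix x assume "x \<in> dual H - exceptional"
    then obtain c0 k where c0: "c0 \<in> trivial_dual" and k: "k \<in> carrier_vec n" and free: "free_char (\<chi> k)"
      and x: "x = dual_induce H K (twist k c0)" by (rule induce_surj)
    obtain c g l where c: "c \<in> R" and g: "g \<in> carrier H" and l: "l \<in> carrier_vec n" and eq: "actc g c0 = twist l c"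
      using ex1[OF c0] by (elim ex1E conjE bexE)
    have Lk: "L g *\<^sub>v k \<in> carrier_vec n" by (rule mult_mat_vec_carrier[OF L_carrier[OF g] k])
    \<comment> \<open>Replacing \<open>c0\<close> by its representative \<open>c\<close> rotates the
      parameter by \<open>L g\<close> and shifts it by the vector \<open>l\<close> that relates the
      two classes.\<close>
    define k' where "k' = L g *\<^sub>v k + l"
    have k': "k' \<in> carrier_vec n" using Lk l by (simp add: k'_def)
    note d0 = trivial_dual_dual[OF c0]
    have "actc g (twist k c0) = twist k' c"
      unfolding actc_twist[OF d0 g k] eq twist_twist[OF RD[OF c] Lk l] k'_def ..
    then have x': "x = dual_induce H K (twist k' c)" using induce_actc[OF twist_dual[OF d0 k] g] x by simp
    have "free_char (\<chi> k')"
      unfolding k'_def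
      by (rule free_char_transport[OF g k l _ free]) (rule trivial_twist[OF c0 RX[OF c] g l eq])
    then have "orbit_of (stab c) k' \<notin> N\<^sub>R c" using good[OF c k'] by simp
    then have "(orbit_of (stab c) k', c) \<in> ?D" using c k' by (auto simp: orbit_space_def)
    then show "x \<in> \<Phi> ` ?D" using image_eqI[of x \<Phi> "(orbit_of (stab c) k', c)"] \<Phi>[OF c k'] x' by simp
  qed
  ultimately have "bij_betw \<Phi> ?D (dual H - exceptional)" by (simp add: bij_betw_def)
  moreover have "orbit_null_set n (stab c) (N\<^sub>R c)" if "c \<in> R" for c
    unfolding N\<^sub>R_def by (rule orbit_null_set_image[OF bad_null]) (use orbit_bad_iff[OF RX[OF that]] in blast)
  ultimately show ?thesis
    using exceptional_null[OF \<mu>] \<Phi>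
    by (intro exI[of _ exceptional] exI[of _ N\<^sub>R] exI[of _ \<Phi>] conjI ballI impI) simp_all
qed

end

section \<open>The Euclidean group\<close>

lemma orthogonal_matsD:
  assumes "A \<in> orthogonal_mats d"
  shows "A \<in> carrier_mat d d" "A * transpose_mat A = 1\<^sub>m d" "transpose_mat A * A = 1\<^sub>m d"
proof -
  show A: "A \<in> carrier_mat d d" and AA: "A * transpose_mat A = 1\<^sub>m d" using assms by (auto simp: orthogonal_mats_def)
  show "transpose_mat A * A = 1\<^sub>m d"
    by (rule mat_mult_left_right_inverse[OF A _ AA]) (use A in simp)
qed

lemma orthogonal_mats_mult:
  assumes "A \<in> orthogonal_mats d" "B \<in> orthogonal_mats d"
  shows "A * B \<in> orthogonal_mats d"
proof -
  note A = orthogonal_matsD[OF assms(1)] and B = orthogonal_matsD[OF assms(2)]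
  have "A * B * transpose_mat (A * B) = A * (B * transpose_mat B) * transpose_mat A"
    unfolding transpose_mult[OF A(1) B(1)] using A(1) B(1) by (simp add: mat_assoc)
  then show ?thesis using A B by (simp add: orthogonal_mats_def)
qed

lemma orthogonal_mats_transpose:
  assumes "A \<in> orthogonal_mats d"
  shows "transpose_mat A \<in> orthogonal_mats d"
  using orthogonal_matsD(1,3)[OF assms] by (simp add: orthogonal_mats_def)

lemma euclidean_group_mult [simp]:
  "(A, a) \<otimes>\<^bsub>euclidean_group d\<^esub> (B, b) = (A * B, a + A *\<^sub>v b)"
  by (simp add: euclidean_group_def)

lemma euclidean_group_carrier [simp]: "carrier (euclidean_group d) = orthogonal_mats d \<times> carrier_vec d"
  by (simp add: euclidean_group_def)

lemma euclidean_group_one [simp]: "\<one>\<^bsub>euclidean_group d\<^esub> = (1\<^sub>m d, 0\<^sub>v d)"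
  by (simp add: euclidean_group_def)

lemma group_euclidean: "group (euclidean_group d)"
proof (rule groupI)
  fix x y assume x: "x \<in> carrier (euclidean_group d)" and y: "y \<in> carrier (euclidean_group d)"
  obtain A a B b where xy: "x = (A, a)" "y = (B, b)" by (metis surj_pair)
  show "x \<otimes>\<^bsub>euclidean_group d\<^esub> y \<in> carrier (euclidean_group d)"
    using x y orthogonal_matsD(1)[of A d] by (auto simp: xy orthogonal_mats_mult)
next
  have "1\<^sub>m d \<in> orthogonal_mats d" by (simp add: orthogonal_mats_def)
  then show "\<one>\<^bsub>euclidean_group d\<^esub> \<in> carrier (euclidean_group d)" by simp
next
  fix x y z assume x: "x \<in> carrier (euclidean_group d)" and y: "y \<in> carrier (euclidean_group d)"
    and z: "z \<in> carrier (euclidean_group d)"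
  obtain A a B b C c where xyz: "x = (A, a)" "y = (B, b)" "z = (C, c)" by (metis surj_pair)
  have m: "A \<in> carrier_mat d d" "B \<in> carrier_mat d d" "C \<in> carrier_mat d d"
    "a \<in> carrier_vec d" "b \<in> carrier_vec d" "c \<in> carrier_vec d"
    using x y z orthogonal_matsD(1) by (auto simp: xyz)
  have Bc: "B *\<^sub>v c \<in> carrier_vec d" using m by auto
  have "a + A *\<^sub>v b + (A * B) *\<^sub>v c = a + A *\<^sub>v (b + B *\<^sub>v c)"
    unfolding mult_add_distrib_mat_vec[OF m(1,5) Bc] assoc_mult_mat_vec[OF m(1,2,6)]
    using m Bc by (intro assoc_add_vec[of _ d]) auto
  then show "x \<otimes>\<^bsub>euclidean_group d\<^esub> y \<otimes>\<^bsub>euclidean_group d\<^esub> z =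
      x \<otimes>\<^bsub>euclidean_group d\<^esub> (y \<otimes>\<^bsub>euclidean_group d\<^esub> z)"
    using m by (simp add: xyz)
next
  fix x assume x: "x \<in> carrier (euclidean_group d)"
  obtain A a where xA: "x = (A, a)" by (metis surj_pair)
  have A: "A \<in> orthogonal_mats d" and a: "a \<in> carrier_vec d" using x by (auto simp: xA)
  note Ac = orthogonal_matsD[OF A]
  show "\<one>\<^bsub>euclidean_group d\<^esub> \<otimes>\<^bsub>euclidean_group d\<^esub> x = x" using Ac(1) a by (simp add: xA)
  have Ta: "transpose_mat A *\<^sub>v a \<in> carrier_vec d" using Ac(1) a by auto
  have "(transpose_mat A, - (transpose_mat A *\<^sub>v a)) \<in> carrier (euclidean_group d)"
    using orthogonal_mats_transpose[OF A] Ta by simp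
  moreover have "(transpose_mat A, - (transpose_mat A *\<^sub>v a)) \<otimes>\<^bsub>euclidean_group d\<^esub> x = \<one>\<^bsub>euclidean_group d\<^esub>"
    using Ac(3) Ta by (simp add: xA)
  ultimately show "\<exists>y\<in>carrier (euclidean_group d). y \<otimes>\<^bsub>euclidean_group d\<^esub> x = \<one>\<^bsub>euclidean_group d\<^esub>" by blast
qed

section \<open>Block sums and the projection to the last coordinates\<close>

lemma oplus_mult:
  assumes A: "A \<in> carrier_mat d\<^sub>1 d\<^sub>1" and B: "B \<in> carrier_mat d\<^sub>1 d\<^sub>1"
    and g: "g \<in> carrier_mat d\<^sub>2 d\<^sub>2 \<times> carrier_vec d\<^sub>2" and h: "h \<in> carrier_mat d\<^sub>2 d\<^sub>2 \<times> carrier_vec d\<^sub>2"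
  shows "oplus d\<^sub>1 d\<^sub>2 A g \<otimes>\<^bsub>euclidean_group (d\<^sub>1 + d\<^sub>2)\<^esub> oplus d\<^sub>1 d\<^sub>2 B h =
    oplus d\<^sub>1 d\<^sub>2 (A * B) (g \<otimes>\<^bsub>euclidean_group d\<^sub>2\<^esub> h)"
proof -
  obtain M a N b where gh: "g = (M, a)" "h = (N, b)" by (metis surj_pair)
  have c: "M \<in> carrier_mat d\<^sub>2 d\<^sub>2" "a \<in> carrier_vec d\<^sub>2" "N \<in> carrier_mat d\<^sub>2 d\<^sub>2" "b \<in> carrier_vec d\<^sub>2"
    using g h by (auto simp: gh)
  have "four_block_mat A (0\<^sub>m d\<^sub>1 d\<^sub>2) (0\<^sub>m d\<^sub>2 d\<^sub>1) M * four_block_mat B (0\<^sub>m d\<^sub>1 d\<^sub>2) (0\<^sub>m d\<^sub>2 d\<^sub>1) N =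
      four_block_mat (A * B) (0\<^sub>m d\<^sub>1 d\<^sub>2) (0\<^sub>m d\<^sub>2 d\<^sub>1) (M * N)"
    using A B c by (subst mult_four_block_mat[of _ d\<^sub>1 d\<^sub>1 _ d\<^sub>2 _ d\<^sub>2 _ _ d\<^sub>1 _ d\<^sub>2]) auto
  moreover have "(0\<^sub>v d\<^sub>1 @\<^sub>v a) + four_block_mat A (0\<^sub>m d\<^sub>1 d\<^sub>2) (0\<^sub>m d\<^sub>2 d\<^sub>1) M *\<^sub>v (0\<^sub>v d\<^sub>1 @\<^sub>v b) =
      0\<^sub>v d\<^sub>1 @\<^sub>v (a + M *\<^sub>v b)"
  proof -
    have "four_block_mat A (0\<^sub>m d\<^sub>1 d\<^sub>2) (0\<^sub>m d\<^sub>2 d\<^sub>1) M *\<^sub>v (0\<^sub>v d\<^sub>1 @\<^sub>v b) = 0\<^sub>v d\<^sub>1 @\<^sub>v (M *\<^sub>v b)"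
    proof -
      have "A *\<^sub>v 0\<^sub>v d\<^sub>1 = 0\<^sub>v d\<^sub>1" using A by (intro eq_vecI) (auto simp: scalar_prod_def)
      then show ?thesis using mult_mat_vec_split[OF A c(1) zero_carrier_vec c(4)] by simp
    qed
    moreover have "(0\<^sub>v d\<^sub>1 @\<^sub>v a) + (0\<^sub>v d\<^sub>1 @\<^sub>v (M *\<^sub>v b)) = 0\<^sub>v d\<^sub>1 @\<^sub>v (a + M *\<^sub>v b)"
      using c by (intro eq_vecI) auto
    ultimately show ?thesis by simp
  qed
  ultimately show ?thesis by (simp add: oplus_def gh)
qed

text \<open>Elements of \<open>oplus_group\<close> have vanishing off-diagonal blocks, so lower
  right blocks and last coordinates multiply among themselves.\<close>

lemma proj_mult:
  assumes S: "S \<subseteq> carrier (euclidean_group d\<^sub>2)"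
    and x: "x \<in> oplus_group d\<^sub>1 d\<^sub>2 S" and y: "y \<in> oplus_group d\<^sub>1 d\<^sub>2 S"
  shows "proj d\<^sub>1 d\<^sub>2 (x \<otimes>\<^bsub>euclidean_group (d\<^sub>1 + d\<^sub>2)\<^esub> y) =
    proj d\<^sub>1 d\<^sub>2 x \<otimes>\<^bsub>euclidean_group d\<^sub>2\<^esub> proj d\<^sub>1 d\<^sub>2 y"
proof -
  interpret E: group "euclidean_group d\<^sub>2" by (rule group_euclidean)
  have sub: "carrier (euclidean_group d\<^sub>2) \<subseteq> carrier_mat d\<^sub>2 d\<^sub>2 \<times> carrier_vec d\<^sub>2"
    using orthogonal_matsD(1) by auto
  obtain A g where A: "A \<in> carrier_mat d\<^sub>1 d\<^sub>1" and gS: "g \<in> carrier (euclidean_group d\<^sub>2)" and x': "x = oplus d\<^sub>1 d\<^sub>2 A g"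
    using x S orthogonal_matsD(1) unfolding oplus_group_def by blast
  obtain B h where B: "B \<in> carrier_mat d\<^sub>1 d\<^sub>1" and hS: "h \<in> carrier (euclidean_group d\<^sub>2)" and y': "y = oplus d\<^sub>1 d\<^sub>2 B h"
    using y S orthogonal_matsD(1) unfolding oplus_group_def by blast
  have g: "g \<in> carrier_mat d\<^sub>2 d\<^sub>2 \<times> carrier_vec d\<^sub>2" and h: "h \<in> carrier_mat d\<^sub>2 d\<^sub>2 \<times> carrier_vec d\<^sub>2"
    and gh: "g \<otimes>\<^bsub>euclidean_group d\<^sub>2\<^esub> h \<in> carrier_mat d\<^sub>2 d\<^sub>2 \<times> carrier_vec d\<^sub>2"
    using subsetD[OF sub gS] subsetD[OF sub hS] subsetD[OF sub E.m_closed[OF gS hS]] by blast+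
  show ?thesis
    unfolding x' y' oplus_mult[OF A B g h] proj_oplus[OF A g] proj_oplus[OF B h]
    by (rule proj_oplus[OF mult_carrier_mat[OF A B] gh])
qed

theorem theorem4p19:
  fixes d\<^sub>1 d\<^sub>2 m :: nat
    and S G T :: "isometry set"
    and R :: "(isometry \<Rightarrow> complex mat) set set"
    and \<mu> :: "(isometry \<Rightarrow> complex mat) set measure"
  assumes "d\<^sub>1 + d\<^sub>2 \<ge> 1"
    and "space_group d\<^sub>2 S"
    and "discrete_subgroup (d\<^sub>1 + d\<^sub>2) G"
    and "G \<subseteq> oplus_group d\<^sub>1 d\<^sub>2 S"
    and "proj d\<^sub>1 d\<^sub>2 ` G = S"
    and "T \<subseteq> G"
    and "bij_betw (proj d\<^sub>1 d\<^sub>2) T (translation_subgroup d\<^sub>2 S)"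
    and "infinite G"
    and "m \<ge> 1"
    and "normal_exponents (d\<^sub>1 + d\<^sub>2) G T = {m * n | n. n \<ge> 1}"
    and "representation_set (TF_dual_trivial_on d\<^sub>1 d\<^sub>2 G T m) (TF_rel d\<^sub>1 d\<^sub>2 G T) R"
    and "plancherel_measure (as_group (d\<^sub>1 + d\<^sub>2) G) \<mu>"
  shows "\<exists>N N\<^sub>R \<Phi>.
           N \<in> null_sets \<mu> \<and>
           (\<forall>\<rho>\<in>R. orbit_null_set d\<^sub>2 (stab_group d\<^sub>1 d\<^sub>2 G T \<rho>) (N\<^sub>R \<rho>)) \<and>
           (\<forall>\<rho>\<in>R. \<forall>k\<in>carrier_vec d\<^sub>2.
              orbit_of (stab_group d\<^sub>1 d\<^sub>2 G T \<rho>) k \<notin> N\<^sub>R \<rho> \<longrightarrow>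
              \<Phi> (orbit_of (stab_group d\<^sub>1 d\<^sub>2 G T \<rho>) k, \<rho>) =
                dual_induce (as_group (d\<^sub>1 + d\<^sub>2) G) (TF d\<^sub>1 d\<^sub>2 G T) (TF_twist d\<^sub>1 d\<^sub>2 G T k \<rho>)) \<and>
           bij_betw \<Phi>
             {(X, \<rho>). \<rho> \<in> R \<and> X \<in> orbit_space d\<^sub>2 (stab_group d\<^sub>1 d\<^sub>2 G T \<rho>) - N\<^sub>R \<rho>}
             (dual (as_group (d\<^sub>1 + d\<^sub>2) G) - N)"
proof -
  let ?d = "d\<^sub>1 + d\<^sub>2" and ?H = "as_group (d\<^sub>1 + d\<^sub>2) G"
  define L where "L g = fst (proj d\<^sub>1 d\<^sub>2 g)" for g
  define \<tau> where "\<tau> g = snd (proj d\<^sub>1 d\<^sub>2 g)" for g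
  define A where "A = power_set ?d T m"
  interpret E: group "euclidean_group ?d" by (rule group_euclidean)
  have Gsub: "subgroup G (euclidean_group ?d)" using assms(3) by (simp add: discrete_subgroup_def)
  interpret H: group ?H by (rule E.subgroup_imp_group[OF Gsub])
  have Ssub: "subgroup S (euclidean_group d\<^sub>2)" using assms(2) by (simp add: space_group_def discrete_subgroup_def)
  have Sc: "S \<subseteq> carrier (euclidean_group d\<^sub>2)" by (rule subgroup.subset[OF Ssub])
  have projS: "proj d\<^sub>1 d\<^sub>2 g \<in> S" if "g \<in> G" for g using assms(5) that by blast
  have proj_eq: "proj d\<^sub>1 d\<^sub>2 g = (L g, \<tau> g)" for g by (simp add: L_def \<tau>_def)
  have Lo: "L g \<in> orthogonal_mats d\<^sub>2" and \<tau>c: "\<tau> g \<in> carrier_vec d\<^sub>2" if "g \<in> G" for g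
    using subsetD[OF Sc projS[OF that]] by (auto simp: proj_eq)
  have mult: "L (x \<otimes>\<^bsub>euclidean_group ?d\<^esub> y) = L x * L y"
    "\<tau> (x \<otimes>\<^bsub>euclidean_group ?d\<^esub> y) = \<tau> x + L x *\<^sub>v \<tau> y" if "x \<in> G" "y \<in> G" for x y
    using proj_mult[OF Sc subsetD[OF assms(4) that(1)] subsetD[OF assms(4) that(2)]] by (auto simp: proj_eq)
  have mult_closed: "x \<otimes>\<^bsub>euclidean_group ?d\<^esub> y \<in> G" if "x \<in> G" "y \<in> G" for x y
    by (rule subgroup.m_closed[OF Gsub that])
  have oneG: "\<one>\<^bsub>euclidean_group ?d\<^esub> \<in> G" by (rule subgroup.one_closed[OF Gsub])
  have L1: "L \<one>\<^bsub>euclidean_group ?d\<^esub> = 1\<^sub>m d\<^sub>2" and \<tau>1: "\<tau> \<one>\<^bsub>euclidean_group ?d\<^esub> = 0\<^sub>v d\<^sub>2"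
    by (auto simp: L_def \<tau>_def proj_def intro!: eq_matI eq_vecI)
  have T_trans: "L t = 1\<^sub>m d\<^sub>2" "t \<in> G" if "t \<in> T" for t
    using assms(6,7) that by (auto simp: bij_betw_def translation_subgroup_def L_def)
  have T_lift: "\<exists>t\<in>T. \<tau> t = b" if "(1\<^sub>m d\<^sub>2, b) \<in> S" for b
  proof -
    have "(1\<^sub>m d\<^sub>2, b) \<in> proj d\<^sub>1 d\<^sub>2 ` T" using assms(7) that by (simp add: bij_betw_def translation_subgroup_def)
    then obtain t where "t \<in> T" "(1\<^sub>m d\<^sub>2, b) = proj d\<^sub>1 d\<^sub>2 t" by blast
    then show ?thesis by (intro bexI[of _ t]) (auto simp: \<tau>_def dest: arg_cong[of _ _ snd])
  qed
  \<comment> \<open>Lifts of translations have trivial linear part, so taking powers multiplies the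
    translation vector.\<close>
  have pow: "t [^]\<^bsub>euclidean_group ?d\<^esub> j \<in> G \<and> L (t [^]\<^bsub>euclidean_group ?d\<^esub> j) = 1\<^sub>m d\<^sub>2 \<and>
      \<tau> (t [^]\<^bsub>euclidean_group ?d\<^esub> j) = real j \<cdot>\<^sub>v \<tau> t" if t: "t \<in> T" for t and j :: nat
  proof (induction j)
    case 0
    have "0 \<cdot>\<^sub>v \<tau> t = 0\<^sub>v d\<^sub>2" using \<tau>c[OF T_trans(2)[OF t]] by (intro eq_vecI) auto
    then show ?case using oneG L1 \<tau>1 by simp
  next
    case (Suc j)
    note tG = T_trans(2)[OF t] and tc = \<tau>c[OF T_trans(2)[OF t]]
    have "real j \<cdot>\<^sub>v \<tau> t + \<tau> t = real (Suc j) \<cdot>\<^sub>v \<tau> t" using tc by (intro eq_vecI) (auto simp: algebra_simps)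
    then show ?case using Suc mult_closed[of _ t] mult[of "t [^]\<^bsub>euclidean_group ?d\<^esub> j" t] tG tc T_trans(1)[OF t] by simp
  qed
  have A_norm: "A \<lhd> ?H"
  proof -
    \<comment> \<open>With \<open>n = 1\<close>: the generator of the set of exponents is itself an
      exponent.\<close>
    have "m \<in> {m * n | n. n \<ge> 1}" by (intro CollectI exI[of _ 1]) simp
    then have "m \<in> normal_exponents ?d G T" using assms(10) by simp
    then show ?thesis by (simp add: normal_exponents_def A_def)
  qed
  have A_pow: "\<exists>t\<in>T. a = t [^]\<^bsub>euclidean_group ?d\<^esub> m" if "a \<in> A" for a using that by (auto simp: A_def power_set_def)
  have pow_A: "t [^]\<^bsub>euclidean_group ?d\<^esub> m \<in> A" if "t \<in> T" for t using that by (auto simp: A_def power_set_def)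
  have A_facts: "a \<in> G" "L a = 1\<^sub>m d\<^sub>2" if "a \<in> A" for a using A_pow[OF that] pow by auto
  have inj: "inj_on \<tau> A"
  proof (rule inj_onI)
    fix a b assume "a \<in> A" "b \<in> A" and eq: "\<tau> a = \<tau> b"
    then obtain t u where t: "t \<in> T" "a = t [^]\<^bsub>euclidean_group ?d\<^esub> m" and u: "u \<in> T" "b = u [^]\<^bsub>euclidean_group ?d\<^esub> m"
      using A_pow by metis
    note tc = \<tau>c[OF T_trans(2)[OF t(1)]] and uc = \<tau>c[OF T_trans(2)[OF u(1)]]
    have e: "real m \<cdot>\<^sub>v \<tau> t = real m \<cdot>\<^sub>v \<tau> u" using eq pow[OF t(1), of m] pow[OF u(1), of m] t u by simp
    \<comment> \<open>Since \<open>m \<ge> 1\<close> the factor \<open>m\<close> cancels; equal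
      translation parts then give equal projections, and the projection is injective on
      \<open>T\<close>.\<close>
    have "\<tau> t = \<tau> u"
    proof (rule eq_vecI)
      fix i assume "i < dim_vec (\<tau> u)"
      then show "\<tau> t $ i = \<tau> u $ i" using arg_cong[OF e, of "\<lambda>v. v $ i"] tc uc assms(9) by simp
    qed (use tc uc in auto)
    then have "proj d\<^sub>1 d\<^sub>2 t = proj d\<^sub>1 d\<^sub>2 u" using T_trans(1)[OF t(1)] T_trans(1)[OF u(1)] by (simp add: proj_eq)
    then have "t = u" using assms(7) t(1) u(1) by (auto simp: bij_betw_def dest: inj_onD)
    then show "a = b" using t u by simp
  qed
  have A_sub: "subgroup A ?H" using A_norm by (simp add: normal_def)
  have lattice: "vec_lattice d\<^sub>2 (\<tau> ` A)"
  proof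
    show "add_subgroup d\<^sub>2 (\<tau> ` A)"
      unfolding add_subgroup_def
    proof (intro conjI ballI)
      show "\<tau> ` A \<subseteq> carrier_vec d\<^sub>2" using \<tau>c A_facts by auto
      have "\<one>\<^bsub>euclidean_group ?d\<^esub> \<in> A" using subgroup.one_closed[OF A_sub] by simp
      then show "0\<^sub>v d\<^sub>2 \<in> \<tau> ` A" using \<tau>1 by (intro image_eqI[of _ \<tau>]) (rule sym)
      show "x + y \<in> \<tau> ` A" if xy: "x \<in> \<tau> ` A" "y \<in> \<tau> ` A" for x y
      proof -
        obtain a b where ab: "a \<in> A" "b \<in> A" "x = \<tau> a" "y = \<tau> b" using xy by blast
        have "\<tau> (a \<otimes>\<^bsub>euclidean_group ?d\<^esub> b) = x + y" using mult(2)[of a b] A_facts ab \<tau>c by simp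
        moreover have "a \<otimes>\<^bsub>euclidean_group ?d\<^esub> b \<in> A" using subgroup.m_closed[OF A_sub ab(1,2)] by simp
        ultimately show ?thesis by (intro image_eqI[of _ \<tau>]) (rule sym)
      qed
      show "- x \<in> \<tau> ` A" if x: "x \<in> \<tau> ` A" for x
      proof -
        obtain a where a: "a \<in> A" "x = \<tau> a" using x by blast
        let ?b = "inv\<^bsub>?H\<^esub> a"
        have b: "?b \<in> A" by (rule subgroup.m_inv_closed[OF A_sub a(1)])
        have "?b \<otimes>\<^bsub>euclidean_group ?d\<^esub> a = \<one>\<^bsub>euclidean_group ?d\<^esub>" using H.l_inv[of a] A_facts(1)[OF a(1)] by simp
        then have "\<tau> ?b + \<tau> a = 0\<^sub>v d\<^sub>2"
          using mult(2)[OF A_facts(1)[OF b] A_facts(1)[OF a(1)]] \<tau>1 A_facts(2)[OF b] \<tau>c[OF A_facts(1)[OF a(1)]] by simp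
        then have "(\<tau> ?b + \<tau> a) $ i = 0" if "i < d\<^sub>2" for i using that by simp
        then have "\<tau> ?b = - x"
          using \<tau>c[OF A_facts(1)[OF a(1)]] \<tau>c[OF A_facts(1)[OF b]] a(2)
          by (intro eq_vecI) (auto simp: eq_neg_iff_add_eq_0)
        then show ?thesis using b by (intro image_eqI[of _ \<tau>]) (rule sym)
      qed
    qed
    \<comment> \<open>Isolation of zero in the lattice comes from isolation of the identity in
      \<open>S\<close>, as the pairs \<open>(1\<^sub>m d\<^sub>2, x)\<close> with \<open>x\<close>
      in the lattice belong to \<open>S\<close>.\<close>
    have oneS: "(1\<^sub>m d\<^sub>2, 0\<^sub>v d\<^sub>2) \<in> S" using subgroup.one_closed[OF Ssub] by simp
    have "\<forall>(A, a)\<in>S. \<exists>\<epsilon>>0. \<forall>(B, b)\<in>S.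
        (\<forall>i<d\<^sub>2. \<forall>j<d\<^sub>2. \<bar>A $$ (i, j) - B $$ (i, j)\<bar> < \<epsilon>) \<and> (\<forall>i<d\<^sub>2. \<bar>a $ i - b $ i\<bar> < \<epsilon>) \<longrightarrow> (B, b) = (A, a)"
      using assms(2) by (simp add: space_group_def discrete_subgroup_def)
    from bspec[OF this oneS] obtain \<epsilon> where \<epsilon>: "\<epsilon> > 0" and disc: "\<forall>(B, b)\<in>S.
        (\<forall>i<d\<^sub>2. \<forall>j<d\<^sub>2. \<bar>1\<^sub>m d\<^sub>2 $$ (i, j) - B $$ (i, j)\<bar> < \<epsilon>) \<and> (\<forall>i<d\<^sub>2. \<bar>0\<^sub>v d\<^sub>2 $ i - b $ i\<bar> < \<epsilon>)
          \<longrightarrow> (B, b) = (1\<^sub>m d\<^sub>2, 0\<^sub>v d\<^sub>2)" by auto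
    show "\<exists>\<epsilon>>0. \<forall>x\<in>\<tau> ` A. (\<forall>i<d\<^sub>2. \<bar>x $ i\<bar> < \<epsilon>) \<longrightarrow> x = 0\<^sub>v d\<^sub>2"
    proof (intro exI[of _ \<epsilon>] conjI \<epsilon> ballI impI)
      fix x assume x: "x \<in> \<tau> ` A" and small: "\<forall>i<d\<^sub>2. \<bar>x $ i\<bar> < \<epsilon>"
      then obtain a where a: "a \<in> A" "x = \<tau> a" by blast
      have "(1\<^sub>m d\<^sub>2, x) \<in> S" using projS[OF A_facts(1)[OF a(1)]] A_facts(2)[OF a(1)] a(2) by (simp add: proj_eq)
      from bspec[OF disc this] show "x = 0\<^sub>v d\<^sub>2" using small \<epsilon> by simp
    qed
    obtain B where B: "B \<subseteq> carrier_vec d\<^sub>2" "finite B" "card B = d\<^sub>2"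
      "\<not> LinearCombinations.module.lin_dep class_ring (module_vec TYPE(real) d\<^sub>2) B"
      "\<forall>b\<in>B. (1\<^sub>m d\<^sub>2, b) \<in> translation_subgroup d\<^sub>2 S"
      using assms(2) unfolding space_group_def by blast
    obtain M where M: "M \<in> carrier_mat d\<^sub>2 d\<^sub>2" "det M \<noteq> 0" "\<forall>j<d\<^sub>2. col M j \<in> B"
      by (rule lin_indpt_matrix[OF B(1-4)])
    \<comment> \<open>The columns of \<open>M\<close> are translation vectors of \<open>S\<close>;
      their lifts lie in \<open>T\<close>, and passing to \<open>m\<close>-th powers of the lifts
      accounts for the factor \<open>m\<close>.\<close>
    show "\<exists>M\<in>carrier_mat d\<^sub>2 d\<^sub>2. det M \<noteq> 0 \<and> (\<forall>j<d\<^sub>2. col M j \<in> \<tau> ` A)"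
    proof (intro bexI[of _ "real m \<cdot>\<^sub>m M"] conjI allI impI)
      show "det (real m \<cdot>\<^sub>m M) \<noteq> 0" using M(1,2) assms(9) by simp
      fix j assume j: "j < d\<^sub>2"
      obtain t where t: "t \<in> T" "\<tau> t = col M j" using T_lift[of "col M j"] M(3) j B(5) by (auto simp: translation_subgroup_def)
      have "col (real m \<cdot>\<^sub>m M) j = real m \<cdot>\<^sub>v col M j" using j M(1) by (intro eq_vecI) auto
      also have "\<dots> = \<tau> (t [^]\<^bsub>euclidean_group ?d\<^esub> m)" using pow[OF t(1), of m] t(2) by simp
      finally show "col (real m \<cdot>\<^sub>m M) j \<in> \<tau> ` A" using pow_A[OF t(1)] by simp
    qed (use M(1) in simp)
  qed
  \<comment> \<open>From here on the abstract setting does the work; \<open>TF\<close>, the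
    characters, the stabilizers and the relation are matched with their counterparts there.\<close>
  interpret C: crystal ?H d\<^sub>2 L \<tau> A
    by (intro crystal.intro crystal_axioms.intro H.group_axioms)
      (use Lo \<tau>c mult A_norm A_facts inj lattice in simp_all)
  have TF_eq: "TF d\<^sub>1 d\<^sub>2 G T = C.K"
  proof (intro equalityI subsetI)
    fix x assume "x \<in> TF d\<^sub>1 d\<^sub>2 G T"
    then obtain t f where t: "t \<in> T" and f: "f \<in> G" "proj d\<^sub>1 d\<^sub>2 f = (1\<^sub>m d\<^sub>2, 0\<^sub>v d\<^sub>2)"
      and x: "x = t \<otimes>\<^bsub>euclidean_group ?d\<^esub> f"
      by (auto simp: TF_def set_mult_def proj_kernel_def kernel_def)
    have "L f = 1\<^sub>m d\<^sub>2" using f(2) by (simp add: L_def)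
    then show "x \<in> C.K"
      using mult_closed[OF T_trans(2)[OF t] f(1)] mult(1)[OF T_trans(2)[OF t] f(1)] T_trans(1)[OF t] by (simp add: C.K_def x)
  next
    fix x assume "x \<in> C.K"
    then have x: "x \<in> G" "L x = 1\<^sub>m d\<^sub>2" by (auto simp: C.K_def)
    have "(1\<^sub>m d\<^sub>2, \<tau> x) \<in> S" using projS[OF x(1)] x(2) by (simp add: proj_eq)
    \<comment> \<open>The lift in \<open>T\<close> of the translation below \<open>x\<close> is
      divided off; what remains projects to the identity, hence lies in the kernel.\<close>
    then obtain t where t: "t \<in> T" "\<tau> t = \<tau> x" using T_lift by blast
    note tG = T_trans(2)[OF t(1)]
    define f where "f = inv\<^bsub>?H\<^esub> t \<otimes>\<^bsub>?H\<^esub> x"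
    have fG: "f \<in> G" using H.m_closed[OF H.inv_closed, of t x] tG x(1) by (simp add: f_def)
    have "t \<otimes>\<^bsub>?H\<^esub> f = x" unfolding f_def using tG x(1) by (intro C.inv_cancel(1)) auto
    then have tf: "t \<otimes>\<^bsub>euclidean_group ?d\<^esub> f = x" by simp
    have Lf: "L f = 1\<^sub>m d\<^sub>2"
      using mult(1)[OF tG fG] x(2) T_trans(1)[OF t(1)] orthogonal_matsD(1)[OF Lo[OF fG]] by (simp add: tf)
    have "\<tau> x = \<tau> x + \<tau> f" using mult(2)[OF tG fG] T_trans(1)[OF t(1)] t(2) \<tau>c[OF fG] by (simp add: tf)
    then have "\<tau> x + \<tau> f = \<tau> x + 0\<^sub>v d\<^sub>2" using \<tau>c[OF x(1)] by simp
    then have "\<tau> f = 0\<^sub>v d\<^sub>2" by (rule vec_add_cancel[OF \<tau>c[OF x(1)] \<tau>c[OF fG] zero_carrier_vec])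
    then have "f \<in> proj_kernel d\<^sub>1 d\<^sub>2 G" using fG Lf by (simp add: proj_kernel_def kernel_def proj_eq)
    then show "x \<in> TF d\<^sub>1 d\<^sub>2 G T" using t(1) tf unfolding TF_def set_mult_def by blast
  qed
  have GK: "as_group ?d (TF d\<^sub>1 d\<^sub>2 G T) = ?H\<lparr>carrier := C.K\<rparr>" by (simp add: TF_eq)
  have chi: "chi d\<^sub>1 d\<^sub>2 = C.\<chi>" by (intro ext) (simp add: chi_def C.\<chi>_def \<tau>_def)
  have trivial: "TF_dual_trivial_on d\<^sub>1 d\<^sub>2 G T m = C.trivial_dual"
    unfolding TF_dual_trivial_on_def C.trivial_dual_def GK A_def[symmetric] by (rule refl)
  have stab: "stab_group d\<^sub>1 d\<^sub>2 G T = C.stab"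
    by (intro ext) (simp add: stab_group_def C.stab_def GK chi L_def)
  have rel: "TF_rel d\<^sub>1 d\<^sub>2 G T =
      (\<lambda>c c'. \<exists>g\<in>carrier ?H. \<exists>k\<in>carrier_vec d\<^sub>2. C.actc g c = C.twist k c')"
    by (intro ext) (simp add: TF_rel_def GK chi)
  show ?thesis
    unfolding stab GK chi
    unfolding TF_eq
    by (rule C.induce_bijection[OF assms(11)[unfolded trivial rel] assms(12)])
qed

end
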